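(* The following laws hold for quantum programs. (1) (Cancellation) $\bar q:=|\varphi\rangle;\ \bar q:=|\psi\rangle\ \equiv\ \bar q:=|\psi\rangle$. If $\bar q_1\cap\bar q_2=\emptyset$, then $\bar q_1:=|\phi\rangle;\ \bar q_2:=|\psi\rangle\ \equiv\ \bar q_1,\bar q_2:=|\phi\rangle|\psi\rangle$. In particular, if $\bar q,\bar q_1,\bar q_2$ are registers whose variable sets satisfy $\bar q=\bar q_1\cup\bar q_2$, then $\bar q_1:=|0\rangle;\ \bar q_2:=|0\rangle\equiv\bar q:=|0\rangle$. (2) (Unitary-Elimination) If $C$ is a circuit with $[\![C]\!]=U_{\bar q}$ for some unitary operator $U$, then $\bar q:=|\psi\rangle;\ C\equiv\bar q:=U|\psi\rangle$. In particular, $\bar q:=|\psi\rangle;\ U[\bar q]\equiv\bar q:=U|\psi\rangle$. (3) (qif-Elimination) If $q$ is a qubit, $\{|\varphi_0\rangle,|\varphi_1\rangle\}$ an orthonormal basis of $\mathcal H_q$ and $\langle\psi|\varphi_0\rangle=0$, then $$q:=|\psi\rangle;\ \big(C_0\stackrel{|\varphi_0\rangle}{\leftarrow}q\stackrel{|\varphi_1\rangle}{\rightarrow}C_1\big)\ \equiv\ q:=|\varphi_1\rangle;\ C_1\ \equiv\ q:=|\psi\rangle;\ C_1 .$$ More generally, if for each $i$ there exists $U_i$ with $[\![C_i]\!]=(U_i)_{\bar r}$, then $$\bar q,\bar r:=\sum_i\lambda_i|\phi_i\rangle|\psi_i\rangle;\ \mathbf{qif}\,[\bar q](\square_{i=1}^d|\phi_i\rangle\to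 C_i)\,\mathbf{fiq}\ \equiv\ \bar q,\bar r:=\sum_i\lambda_i|\phi_i\rangle(U_i|\psi_i\rangle).$$ (4) (if-Elimination) For a binary measurement $M$: $[M[q]];\ q:=|\phi\rangle\equiv q:=|\phi\rangle$. Moreover, if $M=[|\psi\rangle]$, then $q:=|\psi\rangle;\ (P_0\vartriangleleft M[q]\vartriangleright P_1)\equiv q:=|\psi\rangle;\ P_1$; and if $M=[|\psi\rangle]$ and $\langle\varphi|\psi\rangle=0$, then $q:=|\varphi\rangle;\ (P_0\vartriangleleft M[q]\vartriangleright P_1)\equiv q:=|\varphi\rangle;\ P_0$. (5) (if-Expansion) If $\bar q\subseteq\bar r$ and $\bar r\cap qv(P_m)=\emptyset$ for all $m$, then $$\mathbf{if}\,[\bar q](\square m\to P_m)\,\mathbf{fi};\ \bar r:=|0\rangle\ \equiv\ \mathbf{if}\,[\bar r](\square k\to P_{k\downarrow_{\bar q}})\,\mathbf{fi};\ \bar r:=|0\rangle,$$ where $m$ and $k$ are bit strings and $k\downarrow_{\bar q}$ denotes the restriction of $k$ to $\bar q$.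
   Context: A set $QV$ of quantum variables is given; each quantum variable $q$ has a Hilbert space $\mathcal H_q$; a register $\bar q$ is a sequence $q_1,\dots,q_n$ of distinct variables (identified with its set), with space $\mathcal H_{\bar q}=\bigotimes_i\mathcal H_{q_i}$; $\bar q_1,\bar q_2$ denotes concatenation; $|0\rangle$ on a register means $|0\rangle\otimes\cdots\otimes|0\rangle$ for fixed standard basis states. $\mathcal H_{QV}$ is the state space of the composite system of all variables in $QV$; $A_{\bar q}$ denotes the operator $A$ on $\mathcal H_{\bar q}$, identified with its extension by the identity. $\mathcal D(\mathcal H_{QV})$ is the set of partial density operators (positive operators of trace $\le1$) on $\mathcal H_{QV}$. Circuits: $C::=\mathbf{skip}\mid U[\bar q]\mid C_1;C_2\mid \mathbf{qif}\,[\bar q](\square_{i=1}^d|\psi_i\rangle\to C_i)\,\mathbf{fiq}$ ($U$ a unitary constant from a given set, $\{|\psi_i\rangle\}$ an orthonormal basis of $\mathcal H_{\bar q}$, $\bar q$ disjoint from the variables of all $C_i$), with unitary semantics $I$, $U_{\bar q}$, $[\![C_2]\!][\![C_1]\!]$, $\sum_i|\psi_i\rangle_{\bar q}\langle\psi_i|\otimes[\![C_i]\!]$ respectively. $C_0\stackrel{|\varphi_0\rangle}{\leftarrow}q\stackrel{|\varphi_1\rangle}{\rightarrow}C_1$ denotes $\mathbf{qif}\,[q](|\varphi_0\rangle\to C_0\ \square\ |\varphi_1\rangle\to C_1)\,\mathbf{fiq}$ for a qubit $q$. A measurement on $\bar q$ is a family $M=\{M_m\}$ of linear operators with $\sum_mM_m^\dagger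 M_m=I$; binary if the outcomes are $0,1$. Programs: $P::=\mathbf{skip}\mid\mathbf{abort}\mid\bar q:=|\psi\rangle\mid C\mid P_1;P_2\mid\mathbf{if}\,M[\bar q](\square m\to P_m)\,\mathbf{fi}\mid\mathbf{while}\,M[\bar q]=1\,\mathbf{do}\,P\,\mathbf{od}$ (states in initialisations are unit vectors; $M$ binary in loops); $qv(P)$ is the set of variables occurring in $P$. Semantics on $\mathcal D(\mathcal H_{QV})$: $[\![\mathbf{skip}]\!](\rho)=\rho$; $[\![\mathbf{abort}]\!](\rho)=0$; $[\![\bar q:=|\psi\rangle]\!](\rho)=\sum_n|\psi\rangle_{\bar q}\langle n|\rho|n\rangle_{\bar q}\langle\psi|$ ($\{|n\rangle\}$ an orthonormal basis of $\mathcal H_{\bar q}$); $[\![C]\!](\rho)=[\![C]\!]\rho[\![C]\!]^\dagger$; $[\![P_1;P_2]\!]=[\![P_2]\!]\circ[\![P_1]\!]$; $[\![\mathbf{if}\,M[\bar q](\square m\to P_m)\,\mathbf{fi}]\!](\rho)=\sum_m[\![P_m]\!](M_m\rho M_m^\dagger)$; $[\![\mathbf{while}\,M[\bar q]=1\,\mathbf{do}\,P\,\mathbf{od}]\!]=\sum_{n\ge0}\mathcal E_0\circ([\![P]\!]\circ\mathcal E_1)^n$, $\mathcal E_i(\rho)=M_i\rho M_i^\dagger$. $P\equiv Q$ iff $[\![P]\!]=[\![Q]\!]$. Notation: $\mathbf{if}\,[\bar q](\cdots)\,\mathbf{fi}$ without $M$ uses the computational-basis measurement of qubits; $P_0\vartriangleleft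 M[q]\vartriangleright P_1$ is the if-statement for binary $M$ executing $P_0$ on outcome $0$, $P_1$ on outcome $1$; $[M[q]]$ abbreviates $\mathbf{skip}\vartriangleleft M[q]\vartriangleright\mathbf{skip}$. $M=[|\psi\rangle]$ means $M_0=I-|\psi\rangle\langle\psi|$, $M_1=|\psi\rangle\langle\psi|$ for a unit vector $|\psi\rangle$. *)

theory Defs
  imports "HOL-Analysis.Analysis"
begin

text \<open>
  Every Hilbert space is presented as the space of square-summable families over the index set
  \<open>X\<close> of an orthonormal basis. \<open>X\<close> may be infinite; no space is assumed to be
  finite-dimensional or separable. A bounded operator is given by its matrix
  \<open>A x y = \<langle>x|A|y\<rangle>\<close> in that basis, which determines it.
\<close>

type_synonym 'x vec = "'x \<Rightarrow> complex"
type_synonym 'x op = "'x \<Rightarrow> 'x \<Rightarrow> complex"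

definition hilb :: "'x set \<Rightarrow> 'x vec set" where
  "hilb X = {v. (\<forall>x. x \<notin> X \<longrightarrow> v x = 0) \<and> (\<lambda>x. (cmod (v x))\<^sup>2) summable_on UNIV}"

definition braket :: "'x vec \<Rightarrow> 'x vec \<Rightarrow> complex" where
  "braket v w = (\<Sum>\<^sub>\<infinity>x. cnj (v x) * w x)"

definition vnorm :: "'x vec \<Rightarrow> real" where
  "vnorm v = sqrt (\<Sum>\<^sub>\<infinity>x. (cmod (v x))\<^sup>2)"

definition unit_vec :: "'x set \<Rightarrow> 'x vec \<Rightarrow> bool" where
  "unit_vec X v \<longleftrightarrow> v \<in> hilb X \<and> vnorm v = 1"

definition orthonormal_basis :: "'x set \<Rightarrow> nat \<Rightarrow> (nat \<Rightarrow> 'x vec) \<Rightarrow> bool" where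
  "orthonormal_basis X d \<phi> \<longleftrightarrow>
     (\<forall>i\<in>{1..d}. \<phi> i \<in> hilb X) \<and>
     (\<forall>i\<in>{1..d}. \<forall>j\<in>{1..d}. braket (\<phi> i) (\<phi> j) = (if i = j then 1 else 0)) \<and>
     (\<forall>v\<in>hilb X. \<exists>c. v = (\<lambda>x. \<Sum>i=1..d. c i * \<phi> i x))"

definition ket :: "'x \<Rightarrow> 'x vec" where
  "ket x = (\<lambda>y. if y = x then 1 else 0)"

definition ketbra :: "'x vec \<Rightarrow> 'x vec \<Rightarrow> 'x op" where
  "ketbra v w = (\<lambda>x y. v x * cnj (w y))"

definition id_op :: "'x set \<Rightarrow> 'x op" where
  "id_op X = (\<lambda>x y. if x \<in> X \<and> x = y then 1 else 0)"

definition app :: "'x op \<Rightarrow> 'x vec \<Rightarrow> 'x vec" where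
  "app A v = (\<lambda>x. \<Sum>\<^sub>\<infinity>y. A x y * v y)"

definition mult :: "'x op \<Rightarrow> 'x op \<Rightarrow> 'x op" where
  "mult A A' = (\<lambda>x z. \<Sum>\<^sub>\<infinity>y. A x y * A' y z)"

definition adj :: "'x op \<Rightarrow> 'x op" where
  "adj A = (\<lambda>x y. cnj (A y x))"

definition sandwich :: "'x op \<Rightarrow> 'x op \<Rightarrow> 'x op" where
  "sandwich A \<rho> = mult (mult A \<rho>) (adj A)"

text \<open>
  The matrices of bounded operators. The estimate for finitely supported \<open>v\<close> already
  forces all rows and columns to be square-summable, so that the sums in \<^const>\<open>app\<close> and in
  products of such matrices converge absolutely.
\<close>

definition bounded_op :: "'x set \<Rightarrow> 'x op \<Rightarrow> bool" where
  "bounded_op X A \<longleftrightarrow>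
     (\<forall>x y. x \<notin> X \<or> y \<notin> X \<longrightarrow> A x y = 0) \<and>
     (\<exists>c. \<forall>v\<in>hilb X. app A v \<in> hilb X \<and> vnorm (app A v) \<le> c * vnorm v)"

definition unitary_op :: "'x set \<Rightarrow> 'x op \<Rightarrow> bool" where
  "unitary_op X U \<longleftrightarrow>
     bounded_op X U \<and> mult (adj U) U = id_op X \<and> mult U (adj U) = id_op X"

definition partial_density :: "'x set \<Rightarrow> 'x op \<Rightarrow> bool" where
  "partial_density X \<rho> \<longleftrightarrow>
     bounded_op X \<rho> \<and>
     (\<forall>v\<in>hilb X. braket v (app \<rho> v) \<in> \<real>\<^sub>\<ge>\<^sub>0) \<and>
     (\<lambda>x. Re (\<rho> x x)) summable_on UNIV \<and> (\<Sum>\<^sub>\<infinity>x. Re (\<rho> x x)) \<le> 1"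

text \<open>
  An everywhere defined operator on a Hilbert space that has an adjoint is bounded. The sum over
  a possibly infinite set \<open>S\<close> of outcomes is taken in the weak operator sense.
\<close>

definition measurement :: "'x set \<Rightarrow> 'o set \<Rightarrow> ('o \<Rightarrow> 'x op) \<Rightarrow> bool" where
  "measurement X S M \<longleftrightarrow>
     (\<forall>m\<in>S. bounded_op X (M m)) \<and>
     (\<forall>x y. ((\<lambda>m. mult (adj (M m)) (M m) x y) has_sum id_op X x y) S)"

text \<open>
  The quantum variables are the elements of the type \<open>'q\<close>, and \<open>B q\<close> indexes the standard
  basis of the space of \<open>q\<close>; the label \<open>0 \<in> B q\<close> is the standard basis state \<open>|0\<rangle>\<close>.
  A register is a distinct list of variables; the standard basis of its space consists of the
  lists of labels. The state space of all variables is the tensor product of the spaces of the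
  variables; if there are infinitely many variables, it is the tensor product relative to
  the reference vectors \<open>|0\<rangle>\<close>, whose standard basis consists of the configurations with finitely
  many nonzero labels.
\<close>

definition reg_basis :: "('q \<Rightarrow> 'b set) \<Rightarrow> 'q list \<Rightarrow> 'b list set" where
  "reg_basis B qs = {xs. list_all2 (\<lambda>q x. x \<in> B q) qs xs}"

definition conf :: "('q \<Rightarrow> 'b::zero set) \<Rightarrow> ('q \<Rightarrow> 'b) set" where
  "conf B = {\<sigma>. (\<forall>q. \<sigma> q \<in> B q) \<and> finite {q. \<sigma> q \<noteq> 0}}"

text \<open>\<open>ext B qs A\<close> is \<open>A \<otimes> I\<close>, with \<open>A\<close> acting on the register \<open>qs\<close>.\<close>

definition ext :: "('q \<Rightarrow> 'b::zero set) \<Rightarrow> 'q list \<Rightarrow> 'b list op \<Rightarrow> ('q \<Rightarrow> 'b) op" where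
  "ext B qs A = (\<lambda>\<sigma> \<tau>.
     if \<sigma> \<in> conf B \<and> \<tau> \<in> conf B \<and> (\<forall>q. q \<notin> set qs \<longrightarrow> \<sigma> q = \<tau> q)
     then A (map \<sigma> qs) (map \<tau> qs) else 0)"

definition zero_ket :: "'q list \<Rightarrow> 'b::zero list vec" where
  "zero_ket qs = ket (replicate (length qs) 0)"

text \<open>The vector \<open>|\<phi>\<rangle>|\<psi>\<rangle>\<close> on the concatenation of \<open>qs\<close>, which carries \<open>\<phi>\<close>, with a second register.\<close>

definition tensor :: "'q list \<Rightarrow> 'b list vec \<Rightarrow> 'b list vec \<Rightarrow> 'b list vec" where
  "tensor qs \<phi> \<psi> = (\<lambda>xs. \<phi> (take (length qs) xs) * \<psi> (drop (length qs) xs))"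

definition qubit :: "('q \<Rightarrow> 'b::zero_neq_one set) \<Rightarrow> 'q \<Rightarrow> bool" where
  "qubit B q \<longleftrightarrow> B q = {0, 1}"

text \<open>
  In \<open>CQif qs d \<psi> C\<close> and \<open>PIf qs S M P\<close> only the values of the functions at the indices
  \<open>1, \<dots>, d\<close> and at the outcomes in \<open>S\<close> are relevant.
\<close>

datatype ('q, 'b) circ =
    CSkip
  | CGate "'b list op" "'q list"
  | CSeq "('q, 'b) circ" "('q, 'b) circ"
  | CQif "'q list" nat "nat \<Rightarrow> 'b list vec" "nat \<Rightarrow> ('q, 'b) circ"

primrec circ_vars :: "('q, 'b) circ \<Rightarrow> 'q set" where
  "circ_vars CSkip = {}"
| "circ_vars (CGate U qs) = set qs"
| "circ_vars (CSeq C\<^sub>1 C\<^sub>2) = circ_vars C\<^sub>1 \<union> circ_vars C\<^sub>2"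
| "circ_vars (CQif qs d \<psi> C) = set qs \<union> (\<Union>i\<in>{1..d}. circ_vars (C i))"

text \<open>\<open>G\<close> is the given set of unitary constants.\<close>

primrec wf_circ :: "('q \<Rightarrow> 'b set) \<Rightarrow> 'b list op set \<Rightarrow> ('q, 'b) circ \<Rightarrow> bool" where
  "wf_circ B G CSkip \<longleftrightarrow> True"
| "wf_circ B G (CGate U qs) \<longleftrightarrow> distinct qs \<and> U \<in> G \<and> unitary_op (reg_basis B qs) U"
| "wf_circ B G (CSeq C\<^sub>1 C\<^sub>2) \<longleftrightarrow> wf_circ B G C\<^sub>1 \<and> wf_circ B G C\<^sub>2"
| "wf_circ B G (CQif qs d \<psi> C) \<longleftrightarrow>
     distinct qs \<and> orthonormal_basis (reg_basis B qs) d \<psi> \<and>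
     (\<forall>i\<in>{1..d}. wf_circ B G (C i) \<and> set qs \<inter> circ_vars (C i) = {})"

text \<open>
  The operators are extended to all variables, so \<open>|\<psi>\<^sub>i\<rangle>\<langle>\<psi>\<^sub>i| \<otimes> \<lbrakk>C\<^sub>i\<rbrakk>\<close> is the product of
  the extensions of the two factors, which act on disjoint sets of variables.
\<close>

primrec circ_sem :: "('q \<Rightarrow> 'b::zero set) \<Rightarrow> ('q, 'b) circ \<Rightarrow> ('q \<Rightarrow> 'b) op" where
  "circ_sem B CSkip = id_op (conf B)"
| "circ_sem B (CGate U qs) = ext B qs U"
| "circ_sem B (CSeq C\<^sub>1 C\<^sub>2) = mult (circ_sem B C\<^sub>2) (circ_sem B C\<^sub>1)"
| "circ_sem B (CQif qs d \<psi> C) =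
     (\<lambda>\<sigma> \<tau>. \<Sum>i=1..d. mult (ext B qs (ketbra (\<psi> i) (\<psi> i))) (circ_sem B (C i)) \<sigma> \<tau>)"

text \<open>
  Measurement outcomes are label lists, so that the outcomes of measuring a register in the
  computational basis are its basis labels. The outcomes \<open>0\<close> and \<open>1\<close> of a binary measurement
  are \<open>[0]\<close> and \<open>[1]\<close>.
\<close>

datatype ('q, 'b) prog =
    PSkip
  | PAbort
  | PInit "'q list" "'b list vec"
  | PCirc "('q, 'b) circ"
  | PSeq "('q, 'b) prog" "('q, 'b) prog"  (infixr ";;" 60)
  | PIf "'q list" "'b list set" "'b list \<Rightarrow> 'b list op" "'b list \<Rightarrow> ('q, 'b) prog"
  | PWhile "'q list" "'b list \<Rightarrow> 'b list op" "('q, 'b) prog"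

definition binary_outcomes :: "'b::zero_neq_one list set" where
  "binary_outcomes = {[0], [1]}"

primrec prog_vars :: "('q, 'b) prog \<Rightarrow> 'q set" where
  "prog_vars PSkip = {}"
| "prog_vars PAbort = {}"
| "prog_vars (PInit qs \<psi>) = set qs"
| "prog_vars (PCirc C) = circ_vars C"
| "prog_vars (P\<^sub>1 ;; P\<^sub>2) = prog_vars P\<^sub>1 \<union> prog_vars P\<^sub>2"
| "prog_vars (PIf qs S M P) = set qs \<union> (\<Union>m\<in>S. prog_vars (P m))"
| "prog_vars (PWhile qs M P) = set qs \<union> prog_vars P"

primrec wf_prog ::
  "('q \<Rightarrow> 'b::zero_neq_one set) \<Rightarrow> 'b list op set \<Rightarrow> ('q, 'b) prog \<Rightarrow> bool" where
  "wf_prog B G PSkip \<longleftrightarrow> True"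
| "wf_prog B G PAbort \<longleftrightarrow> True"
| "wf_prog B G (PInit qs \<psi>) \<longleftrightarrow> distinct qs \<and> unit_vec (reg_basis B qs) \<psi>"
| "wf_prog B G (PCirc C) \<longleftrightarrow> wf_circ B G C"
| "wf_prog B G (P\<^sub>1 ;; P\<^sub>2) \<longleftrightarrow> wf_prog B G P\<^sub>1 \<and> wf_prog B G P\<^sub>2"
| "wf_prog B G (PIf qs S M P) \<longleftrightarrow>
     distinct qs \<and> measurement (reg_basis B qs) S M \<and> (\<forall>m\<in>S. wf_prog B G (P m))"
| "wf_prog B G (PWhile qs M P) \<longleftrightarrow>
     distinct qs \<and> measurement (reg_basis B qs) binary_outcomes M \<and> wf_prog B G P"

text \<open>
  Infinite sums of operators are taken entrywise. The sums below have positive summands whose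
  traces add up to at most \<open>1\<close>, so they also converge in trace norm, to the same limit.
\<close>

primrec sem :: "('q \<Rightarrow> 'b::zero_neq_one set) \<Rightarrow> ('q, 'b) prog \<Rightarrow> ('q \<Rightarrow> 'b) op \<Rightarrow> ('q \<Rightarrow> 'b) op" where
  "sem B PSkip = (\<lambda>\<rho>. \<rho>)"
| "sem B PAbort = (\<lambda>\<rho> \<sigma> \<tau>. 0)"
| "sem B (PInit qs \<psi>) = (\<lambda>\<rho> \<sigma> \<tau>.
     \<Sum>\<^sub>\<infinity>n\<in>reg_basis B qs. sandwich (ext B qs (ketbra \<psi> (ket n))) \<rho> \<sigma> \<tau>)"
| "sem B (PCirc C) = sandwich (circ_sem B C)"
| "sem B (P\<^sub>1 ;; P\<^sub>2) = sem B P\<^sub>2 \<circ> sem B P\<^sub>1"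
| "sem B (PIf qs S M P) = (\<lambda>\<rho> \<sigma> \<tau>.
     \<Sum>\<^sub>\<infinity>m\<in>S. sem B (P m) (sandwich (ext B qs (M m)) \<rho>) \<sigma> \<tau>)"
| "sem B (PWhile qs M P) = (\<lambda>\<rho> \<sigma> \<tau>.
     \<Sum>\<^sub>\<infinity>n::nat. sandwich (ext B qs (M [0]))
       (((sem B P \<circ> sandwich (ext B qs (M [1]))) ^^ n) \<rho>) \<sigma> \<tau>)"

definition prog_equiv ::
  "('q \<Rightarrow> 'b::zero_neq_one set) \<Rightarrow> ('q, 'b) prog \<Rightarrow> ('q, 'b) prog \<Rightarrow> bool"
  ("_ \<turnstile> _ \<approx> _" [51, 51, 51] 50) where
  "B \<turnstile> P \<approx> Q \<longleftrightarrow> (\<forall>\<rho>. partial_density (conf B) \<rho> \<longrightarrow> sem B P \<rho> = sem B Q \<rho>)"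

text \<open>\<open>qif2 q \<phi>\<^sub>0 C\<^sub>0 \<phi>\<^sub>1 C\<^sub>1\<close>: the indices \<open>1\<close> and \<open>2\<close> of \<^const>\<open>CQif\<close> stand for \<open>0\<close> and \<open>1\<close>.\<close>

definition qif2 ::
  "'q \<Rightarrow> 'b list vec \<Rightarrow> ('q, 'b) circ \<Rightarrow> 'b list vec \<Rightarrow> ('q, 'b) circ \<Rightarrow> ('q, 'b) circ" where
  "qif2 q \<phi>\<^sub>0 C\<^sub>0 \<phi>\<^sub>1 C\<^sub>1 =
     CQif [q] 2 (\<lambda>i. if i = 1 then \<phi>\<^sub>0 else \<phi>\<^sub>1) (\<lambda>i. if i = 1 then C\<^sub>0 else C\<^sub>1)"

text \<open>\<open>cond P\<^sub>0 M qs P\<^sub>1\<close> runs \<open>P\<^sub>0\<close> on outcome \<open>0\<close> and \<open>P\<^sub>1\<close> on outcome \<open>1\<close>.\<close>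

definition cond ::
  "('q, 'b::zero_neq_one) prog \<Rightarrow> ('b list \<Rightarrow> 'b list op) \<Rightarrow> 'q list \<Rightarrow> ('q, 'b) prog \<Rightarrow> ('q, 'b) prog"
  where
  "cond P\<^sub>0 M qs P\<^sub>1 = PIf qs binary_outcomes M (\<lambda>m. if m = [0] then P\<^sub>0 else P\<^sub>1)"

definition meas_only ::
  "('b::zero_neq_one list \<Rightarrow> 'b list op) \<Rightarrow> 'q list \<Rightarrow> ('q, 'b) prog" where
  "meas_only M qs = cond PSkip M qs PSkip"

text \<open>\<open>M = [|\<psi>\<rangle>]\<close>, as a binary measurement on the space with standard basis \<open>X\<close>.\<close>

definition is_test ::
  "'x set \<Rightarrow> 'x vec \<Rightarrow> ('b::zero_neq_one list \<Rightarrow> 'x op) \<Rightarrow> bool" where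
  "is_test X \<psi> M \<longleftrightarrow>
     M [0] = (\<lambda>x y. id_op X x y - ketbra \<psi> \<psi> x y) \<and> M [1] = ketbra \<psi> \<psi>"

definition bit_strings :: "nat \<Rightarrow> 'b::zero_neq_one list set" where
  "bit_strings n = {k. length k = n \<and> set k \<subseteq> {0, 1}}"

definition comp_if ::
  "'q list \<Rightarrow> ('b::zero_neq_one list \<Rightarrow> ('q, 'b) prog) \<Rightarrow> ('q, 'b) prog" where
  "comp_if qs P = PIf qs (bit_strings (length qs)) (\<lambda>m. ketbra (ket m) (ket m)) P"

text \<open>The restriction to \<open>qs\<close> of a string \<open>k\<close> whose positions are labelled by \<open>rs\<close>.\<close>

definition restrict_string :: "'q list \<Rightarrow> 'q list \<Rightarrow> 'b list \<Rightarrow> 'b list" where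
  "restrict_string rs qs k = map (\<lambda>q. the (map_of (zip rs k) q)) qs"

end

theory Submission
  imports Defs
begin

text \<open>
  Initialising \<open>qs\<close> in \<open>\<psi>\<close> sends \<open>\<rho>\<close> to \<open>|\<psi>\<rangle>\<langle>\<psi>| \<otimes> tr\<^sub>q\<^sub>s \<rho>\<close>. An operator \<open>A\<close> on \<open>qs\<close> therefore
  only replaces \<open>\<psi>\<close> by \<open>A\<psi>\<close>, which gives unitary elimination, the laws for tests and, since a
  quantum case over circuits that act on \<open>rs\<close> is itself an operator on \<open>qs @ rs\<close>, the general
  qif-elimination. Consecutive initialisations reduce to Fubini's theorem for partial traces, where
  summability comes from \<open>|\<rho> s t|\<^sup>2 \<le> \<rho> s s * \<rho> t t\<close>. For arbitrary branches on other variables the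
  sums over \<open>qs\<close> and over the rest separate because circuits are bounded operators. The law
  \<open>[M[q]]; q := |\<phi>\<rangle> \<equiv> q := |\<phi>\<rangle>\<close> says that the blocks of \<open>\<rho>\<close> keep their trace under \<open>M\<close>; by
  polarisation the blocks may be taken positive. If-expansion holds since a program acts separately
  on the blocks of \<open>\<rho>\<close> given by the labels of variables that it does not use.
\<close>

section \<open>Operators on registers, partial trace and initialisation\<close>

text \<open>\<open>infsum\<close> takes the value 0 on families that are not summable, so every
  exchange of infinite sums has to be earned. Scaling is free: \<open>infsum_cmult_right'\<close>
  and \<open>infsum_cmult_left'\<close> hold unconditionally. Laws in which an operator meets
  nothing but the initial vector therefore become matrix identities valid for arbitrary \<rho>;
  if-expansion, too, compares sums term by term. The other laws need estimates. Partial traces can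
  be iterated because positivity dominates the entries of \<rho>. Arbitrary qif branches need
  square-summable rows, which come from bounds of bilinear forms on finite sets. For measurements no
  Fubini argument is available: the sum of \<open>cnj (K n b) * K n a * R a b\<close> over all
  \<open>n\<close>, \<open>a\<close>, \<open>b\<close> need not converge absolutely even for
  positive \<open>R\<close>, because the matrix of moduli of a bounded \<open>K\<close> may be
  unbounded. Finite sections, where \<open>a\<close> and \<open>b\<close> range over a finite set,
  are exact; positivity bounds the limit from above, and a sign change of the blocks that link a
  finite set with its complement bounds it from below.\<close>

definition labels :: "('q \<Rightarrow> 'b::zero set) \<Rightarrow> 'q set \<Rightarrow> ('q \<Rightarrow> 'b) set" where
  "labels B S = {\<nu>. (\<forall>q\<in>S. \<nu> q \<in> B q) \<and> (\<forall>q. q \<notin> S \<longrightarrow> \<nu> q = 0)}"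

text \<open>Arguments remain full configurations whose labels on \<open>S\<close> are overwritten,
  so the result is constant there and the remaining variables need no index type of their own.
  Likewise \<open>labels\<close> pads by \<open>0\<close> outside \<open>S\<close>, which gives each
  basis label of \<open>S\<close> exactly one representative.\<close>

definition ptrace ::
  "('q \<Rightarrow> 'b::zero set) \<Rightarrow> 'q set \<Rightarrow> ('q \<Rightarrow> 'b) op \<Rightarrow> ('q \<Rightarrow> 'b) op" where
  "ptrace B S \<rho> = (\<lambda>\<sigma> \<tau>. \<Sum>\<^sub>\<infinity>\<nu>\<in>labels B S. \<rho> (override_on \<sigma> \<nu> S) (override_on \<tau> \<nu> S))"

section \<open>Basis labels of a register and slices of configurations\<close>

lemma override_on_override_on [simp]: "override_on (override_on f g S) h S = override_on f h S"
  by (simp add: override_on_def fun_eq_iff)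

lemma map_override_on [simp]: "map (override_on \<sigma> \<nu> (set qs)) qs = map \<nu> qs"
  by simp

lemma map_override_on_disjoint: "set rs \<inter> S = {} \<Longrightarrow> map (override_on \<sigma> \<nu> S) rs = map \<sigma> rs"
  by (auto simp: override_on_def)

lemma reg_basis_iff: "xs \<in> reg_basis B qs \<longleftrightarrow> list_all2 (\<lambda>q x. x \<in> B q) qs xs"
  by (simp add: reg_basis_def)

lemma length_reg_basis: "xs \<in> reg_basis B qs \<Longrightarrow> length xs = length qs"
  by (simp add: reg_basis_iff list_all2_lengthD)

lemma map_in_reg_basis: "(\<And>q. q \<in> set qs \<Longrightarrow> \<sigma> q \<in> B q) \<Longrightarrow> map \<sigma> qs \<in> reg_basis B qs"
  by (auto simp: reg_basis_def list_all2_conv_all_nth)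

lemma map_labels_eq_iff:
  "\<nu> \<in> labels B (set qs) \<Longrightarrow> \<nu>' \<in> labels B (set qs) \<Longrightarrow> map \<nu> qs = map \<nu>' qs \<longleftrightarrow> \<nu> = \<nu>'"
  by (fastforce simp: labels_def fun_eq_iff)

lemma bij_betw_labels:
  assumes "distinct qs"
  shows "bij_betw (\<lambda>\<nu>. map \<nu> qs) (labels B (set qs)) (reg_basis B qs)"
proof (rule bij_betwI')
  fix x y assume "x \<in> labels B (set qs)" "y \<in> labels B (set qs)"
  then show "(map x qs = map y qs) = (x = y)"
    by (rule map_labels_eq_iff)
next
  fix x assume "x \<in> labels B (set qs)"
  then show "map x qs \<in> reg_basis B qs"
    by (auto intro!: map_in_reg_basis simp: labels_def)
next
  fix xs assume xs: "xs \<in> reg_basis B qs"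
  define \<nu> where "\<nu> = (\<lambda>q. if q \<in> set qs then the (map_of (zip qs xs) q) else 0)"
  have len: "length xs = length qs"
    by (rule length_reg_basis[OF xs])
  have \<nu>: "\<nu> (qs ! i) = xs ! i" if "i < length qs" for i
    using that len assms by (auto simp: \<nu>_def map_of_zip_nth)
  have "map \<nu> qs = xs"
    using len by (auto intro!: nth_equalityI simp: \<nu>)
  moreover have "\<nu> \<in> labels B (set qs)"
  proof -
    have "\<nu> q \<in> B q" if "q \<in> set qs" for q
      using that xs len \<nu> by (fastforce simp: reg_basis_def list_all2_conv_all_nth in_set_conv_nth)
    then show ?thesis by (auto simp: labels_def \<nu>_def)
  qed
  ultimately show "\<exists>x\<in>labels B (set qs). xs = map x qs" by auto
qed

lemma infsum_reg_basis:
  assumes "distinct qs"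
  shows "infsum f (reg_basis B qs) = (\<Sum>\<^sub>\<infinity>\<nu>\<in>labels B (set qs). f (map \<nu> qs))"
  using infsum_reindex_bij_betw[OF bij_betw_labels[OF assms], of f] by simp

lemma override_in_conf:
  assumes "\<sigma> \<in> conf B" "\<nu> \<in> labels B S \<or> \<nu> \<in> conf B" "finite S"
  shows "override_on \<sigma> \<nu> S \<in> conf B"
proof -
  have "{q. override_on \<sigma> \<nu> S q \<noteq> 0} \<subseteq> {q. \<sigma> q \<noteq> 0} \<union> S"
    by (auto simp: override_on_def)
  then have "finite {q. override_on \<sigma> \<nu> S q \<noteq> 0}"
    using assms by (auto intro: finite_subset simp: conf_def)
  then show ?thesis
    using assms by (auto simp: conf_def labels_def override_on_def)
qed

text \<open>A row \<sigma> of an operator extended from a register on \<open>S\<close> can be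
  nonzero only at these columns, so sums over all configurations reduce to sums over
  \<open>labels B S\<close>.\<close>

lemma bij_betw_slice:
  assumes "\<sigma> \<in> conf B" "finite S"
  shows "bij_betw (\<lambda>\<nu>. override_on \<sigma> \<nu> S) (labels B S) {\<upsilon> \<in> conf B. \<forall>q. q \<notin> S \<longrightarrow> \<sigma> q = \<upsilon> q}"
proof (rule bij_betwI')
  fix x y assume "x \<in> labels B S" "y \<in> labels B S"
  then show "(override_on \<sigma> x S = override_on \<sigma> y S) = (x = y)"
    by (auto simp: labels_def fun_eq_iff override_on_def) metis
next
  fix x assume "x \<in> labels B S"
  then show "override_on \<sigma> x S \<in> {\<upsilon> \<in> conf B. \<forall>q. q \<notin> S \<longrightarrow> \<sigma> q = \<upsilon> q}"
    using override_in_conf[OF assms(1) _ assms(2)] by auto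
next
  fix y assume "y \<in> {\<upsilon> \<in> conf B. \<forall>q. q \<notin> S \<longrightarrow> \<sigma> q = \<upsilon> q}"
  then show "\<exists>x\<in>labels B S. y = override_on \<sigma> x S"
    by (intro bexI[of _ "\<lambda>q. if q \<in> S then y q else 0"])
      (auto simp: labels_def conf_def override_on_def fun_eq_iff)
qed

text \<open>The discarded terms are zero, so both sides agree as values of \<open>infsum\<close>
  whether or not the sums converge. Hence the formula can be used for arbitrary \<open>A\<close> and
  \<open>R\<close>.\<close>

lemma mult_ext:
  "mult (ext B qs A) R \<sigma> \<tau> =
     (if \<sigma> \<in> conf B
      then \<Sum>\<^sub>\<infinity>\<nu>\<in>labels B (set qs). A (map \<sigma> qs) (map \<nu> qs) * R (override_on \<sigma> \<nu> (set qs)) \<tau>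
      else 0)"
proof (cases "\<sigma> \<in> conf B")
  case True
  have "mult (ext B qs A) R \<sigma> \<tau> =
      (\<Sum>\<^sub>\<infinity>\<upsilon>\<in>{\<upsilon> \<in> conf B. \<forall>q. q \<notin> set qs \<longrightarrow> \<sigma> q = \<upsilon> q}. A (map \<sigma> qs) (map \<upsilon> qs) * R \<upsilon> \<tau>)"
    unfolding mult_def by (rule infsum_cong_neutral) (auto simp: ext_def True)
  also have "\<dots> = (\<Sum>\<^sub>\<infinity>\<nu>\<in>labels B (set qs). A (map \<sigma> qs) (map \<nu> qs) * R (override_on \<sigma> \<nu> (set qs)) \<tau>)"
    by (subst infsum_reindex_bij_betw[OF bij_betw_slice[OF True], symmetric]) simp_all
  finally show ?thesis by (simp add: True)
qed (simp add: mult_def ext_def)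

lemma adj_adj [simp]: "adj (adj A) = A"
  by (simp add: adj_def)

lemma adj_mult: "adj (mult A B) = mult (adj B) (adj A)"
  by (simp add: adj_def mult_def mult.commute flip: infsum_cnj)

text \<open>Writes conjugation by \<open>A\<close> as two multiplications from the left, so that
  facts about left factors such as \<open>mult_ext\<close> suffice.\<close>

lemma sandwich_adj: "sandwich A \<rho> = adj (mult A (adj (mult A \<rho>)))"
  by (simp add: sandwich_def adj_mult)

lemma infsum_single_point:
  assumes "a \<in> A" "\<And>x. x \<in> A \<Longrightarrow> x \<noteq> a \<Longrightarrow> f x = 0"
  shows "infsum f A = (f a :: 'c::{comm_monoid_add, t2_space})"
proof -
  have "infsum f A = infsum f {a}"
    by (rule infsum_cong_neutral) (use assms in auto)
  then show ?thesis by simp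
qed

section \<open>Initialisation as a partial trace\<close>

lemma mult_ext_ketbra_ket:
  assumes "distinct qs" "\<nu> \<in> labels B (set qs)"
  shows "mult (ext B qs (ketbra \<psi> (ket (map \<nu> qs)))) R \<sigma> \<tau> =
    (if \<sigma> \<in> conf B then \<psi> (map \<sigma> qs) * R (override_on \<sigma> \<nu> (set qs)) \<tau> else 0)"
proof -
  have "(\<Sum>\<^sub>\<infinity>\<nu>'\<in>labels B (set qs).
        ketbra \<psi> (ket (map \<nu> qs)) (map \<sigma> qs) (map \<nu>' qs) * R (override_on \<sigma> \<nu>' (set qs)) \<tau>)
      = ketbra \<psi> (ket (map \<nu> qs)) (map \<sigma> qs) (map \<nu> qs) * R (override_on \<sigma> \<nu> (set qs)) \<tau>"
    by (intro infsum_single_point) (use assms in \<open>simp_all add: ketbra_def ket_def map_labels_eq_iff del: map_eq_conv\<close>)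
  then show ?thesis
    by (simp add: mult_ext ketbra_def ket_def)
qed

text \<open>The matrix of |\<psi>\<rangle>\<langle>\<psi>| \<otimes> T. The arguments of
  \<open>T\<close> carry labels of \<open>qs\<close> as well, so \<open>T\<close> stands for an
  operator on the other variables only when it ignores those labels.\<close>

definition init_op ::
  "('q \<Rightarrow> 'b::zero set) \<Rightarrow> 'q list \<Rightarrow> 'b list vec \<Rightarrow> ('q \<Rightarrow> 'b) op \<Rightarrow> ('q \<Rightarrow> 'b) op" where
  "init_op B qs \<psi> T = (\<lambda>\<sigma> \<tau>. if \<sigma> \<in> conf B \<and> \<tau> \<in> conf B
     then \<psi> (map \<sigma> qs) * cnj (\<psi> (map \<tau> qs)) * T \<sigma> \<tau> else 0)"

text \<open>The operator |\<psi>\<rangle>\<langle>n| selects the single label \<open>n\<close> of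
  \<open>qs\<close>, so the sum over \<open>n\<close> is a partial trace. The factors from \<psi>
  leave the sum by scaling alone, hence \<rho> is arbitrary.\<close>

lemma sem_PInit:
  assumes "distinct qs"
  shows "sem B (PInit qs \<psi>) \<rho> = init_op B qs \<psi> (ptrace B (set qs) \<rho>)"
proof (intro ext)
  fix \<sigma> \<tau>
  have *: "sandwich (ext B qs (ketbra \<psi> (ket (map \<nu> qs)))) \<rho> \<sigma> \<tau> =
     (if \<sigma> \<in> conf B \<and> \<tau> \<in> conf B then \<psi> (map \<sigma> qs) * cnj (\<psi> (map \<tau> qs)) *
        \<rho> (override_on \<sigma> \<nu> (set qs)) (override_on \<tau> \<nu> (set qs)) else 0)"
    if "\<nu> \<in> labels B (set qs)" for \<nu>
    using assms that override_in_conf[of \<sigma> B \<nu> "set qs"]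
    by (auto simp: sandwich_adj adj_def mult_ext_ketbra_ket)
  have "sem B (PInit qs \<psi>) \<rho> \<sigma> \<tau> =
    (\<Sum>\<^sub>\<infinity>\<nu>\<in>labels B (set qs). sandwich (ext B qs (ketbra \<psi> (ket (map \<nu> qs)))) \<rho> \<sigma> \<tau>)"
    by (simp add: infsum_reg_basis[OF assms])
  also have "\<dots> = (\<Sum>\<^sub>\<infinity>\<nu>\<in>labels B (set qs). (if \<sigma> \<in> conf B \<and> \<tau> \<in> conf B then \<psi> (map \<sigma> qs) * cnj (\<psi> (map \<tau> qs)) *
        \<rho> (override_on \<sigma> \<nu> (set qs)) (override_on \<tau> \<nu> (set qs)) else 0))"
    by (rule infsum_cong) (rule *)
  also have "\<dots> = init_op B qs \<psi> (ptrace B (set qs) \<rho>) \<sigma> \<tau>"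
  proof (cases "\<sigma> \<in> conf B \<and> \<tau> \<in> conf B")
    case True
    then show ?thesis by (simp add: init_op_def ptrace_def infsum_cmult_right')
  qed (simp only: init_op_def if_False infsum_0_simp)
  finally show "sem B (PInit qs \<psi>) \<rho> \<sigma> \<tau> = init_op B qs \<psi> (ptrace B (set qs) \<rho>) \<sigma> \<tau>" .
qed

definition blind :: "'q set \<Rightarrow> ('q \<Rightarrow> 'b) op \<Rightarrow> bool" where
  "blind S T \<longleftrightarrow> (\<forall>\<sigma> \<tau> \<nu> \<nu>'. T (override_on \<sigma> \<nu> S) (override_on \<tau> \<nu>' S) = T \<sigma> \<tau>)"

lemma blindD: "blind S T \<Longrightarrow> T (override_on \<sigma> \<nu> S) (override_on \<tau> \<nu>' S) = T \<sigma> \<tau>"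
  by (simp add: blind_def)

lemma blindD1: "blind S T \<Longrightarrow> T (override_on \<sigma> \<nu> S) \<tau> = T \<sigma> \<tau>"
  using blindD[of S T \<sigma> \<nu> \<tau> \<tau>] by (simp add: override_on_def)

lemma blindD2: "blind S T \<Longrightarrow> T \<sigma> (override_on \<tau> \<nu> S) = T \<sigma> \<tau>"
  using blindD[of S T \<sigma> \<sigma> \<tau> \<nu>] by (simp add: override_on_def)

lemma blind_ptrace: "blind S (ptrace B S \<rho>)"
  by (simp add: blind_def ptrace_def)

lemma app_reg_basis:
  assumes "distinct qs" "\<And>x y. y \<notin> reg_basis B qs \<Longrightarrow> A x y = 0"
  shows "app A \<psi> x = (\<Sum>\<^sub>\<infinity>\<nu>\<in>labels B (set qs). A x (map \<nu> qs) * \<psi> (map \<nu> qs))"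
proof -
  have "app A \<psi> x = (\<Sum>\<^sub>\<infinity>y\<in>reg_basis B qs. A x y * \<psi> y)"
    unfolding app_def by (rule infsum_cong_neutral) (auto simp: assms(2))
  then show ?thesis by (simp add: infsum_reg_basis[OF assms(1)])
qed

text \<open>Along the slices over which \<open>mult_ext\<close> sums, \<open>T\<close> is constant,
  so \<open>A\<close> meets only \<psi>. Columns of \<open>A\<close> outside the register basis must
  vanish because \<open>app\<close> sums over all lists, whereas \<open>mult_ext\<close> sums over
  labels only.\<close>

lemma sandwich_ext_init_op:
  assumes "distinct qs" "\<And>x y. y \<notin> reg_basis B qs \<Longrightarrow> A x y = 0" "blind (set qs) T"
  shows "sandwich (ext B qs A) (init_op B qs \<psi> T) = init_op B qs (app A \<psi>) T"
proof (intro ext)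
  fix \<sigma> \<tau>
  have 1: "mult (ext B qs A) (init_op B qs \<psi> T) \<sigma> \<tau> =
     (if \<sigma> \<in> conf B \<and> \<tau> \<in> conf B then app A \<psi> (map \<sigma> qs) * cnj (\<psi> (map \<tau> qs)) * T \<sigma> \<tau> else 0)" for \<sigma> \<tau>
  proof (cases "\<sigma> \<in> conf B \<and> \<tau> \<in> conf B")
    case True
    then have "mult (ext B qs A) (init_op B qs \<psi> T) \<sigma> \<tau> =
      (\<Sum>\<^sub>\<infinity>\<nu>\<in>labels B (set qs). A (map \<sigma> qs) (map \<nu> qs) * \<psi> (map \<nu> qs) * (cnj (\<psi> (map \<tau> qs)) * T \<sigma> \<tau>))"
      unfolding mult_ext using override_in_conf[of \<sigma> B _ "set qs"]
      by (simp add: init_op_def blindD1[OF assms(3)] mult.assoc cong: infsum_cong)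
    also have "\<dots> = app A \<psi> (map \<sigma> qs) * (cnj (\<psi> (map \<tau> qs)) * T \<sigma> \<tau>)"
      by (simp only: infsum_cmult_left' app_reg_basis[OF assms(1,2)])
    finally show ?thesis using True by simp
  qed (auto simp: mult_ext init_op_def)
  show "sandwich (ext B qs A) (init_op B qs \<psi> T) \<sigma> \<tau> = init_op B qs (app A \<psi>) T \<sigma> \<tau>"
  proof (cases "\<sigma> \<in> conf B \<and> \<tau> \<in> conf B")
    case True
    then have "mult (ext B qs A) (adj (mult (ext B qs A) (init_op B qs \<psi> T))) \<tau> \<sigma> =
      (\<Sum>\<^sub>\<infinity>\<nu>\<in>labels B (set qs). A (map \<tau> qs) (map \<nu> qs) * \<psi> (map \<nu> qs) * (cnj (app A \<psi> (map \<sigma> qs)) * cnj (T \<sigma> \<tau>)))"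
      unfolding mult_ext[of B qs A "adj _"] using override_in_conf[of \<tau> B _ "set qs"]
      by (simp add: adj_def 1 blindD2[OF assms(3)] mult_ac cong: infsum_cong)
    also have "\<dots> = app A \<psi> (map \<tau> qs) * (cnj (app A \<psi> (map \<sigma> qs)) * cnj (T \<sigma> \<tau>))"
      by (simp only: infsum_cmult_left' app_reg_basis[OF assms(1,2)])
    finally show ?thesis using True by (simp add: sandwich_adj adj_def init_op_def)
  next
    case False
    then have "mult (ext B qs A) (adj (mult (ext B qs A) (init_op B qs \<psi> T))) \<tau> \<sigma> = 0"
      unfolding mult_ext[of B qs A "adj _"] by (auto simp: adj_def 1)
    then show ?thesis using False by (auto simp: sandwich_adj adj_def init_op_def)
  qed
qed

lemma sandwich_zero: "sandwich A (\<lambda>_ _. 0) = (\<lambda>_ _. 0)"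
  by (simp add: sandwich_def mult_def)

text \<open>Removes the branch that a test enters with amplitude zero, and the outcomes that
  contradict a fixed basis label.\<close>

lemma sem_zero: "sem B P (\<lambda>_ _. 0) = (\<lambda>_ _. 0)"
proof (induction P)
  case (PWhile qs M P)
  have "((sem B P \<circ> sandwich (ext B qs (M [1]))) ^^ n) (\<lambda>_ _. 0) = (\<lambda>_ _. 0)" for n
  proof (induction n)
    case (Suc n)
    then show ?case by (simp only: funpow.simps o_apply sandwich_zero PWhile)
  qed simp
  then show ?case by (simp add: sandwich_zero)
qed (simp_all add: sandwich_zero)

lemma prog_equivI: "(\<And>\<rho>. partial_density (conf B) \<rho> \<Longrightarrow> sem B P \<rho> = sem B Q \<rho>) \<Longrightarrow> B \<turnstile> P \<approx> Q"
  by (simp add: prog_equiv_def)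

lemma hilbD: "v \<in> hilb X \<Longrightarrow> x \<notin> X \<Longrightarrow> v x = 0"
  by (simp add: hilb_def)

lemma unit_vec_hilb: "unit_vec X v \<Longrightarrow> v \<in> hilb X"
  by (simp add: unit_vec_def)

lemma infsum_unit_vec:
  assumes "unit_vec X v"
  shows "(\<Sum>\<^sub>\<infinity>x. (cmod (v x))\<^sup>2) = 1"
  using assms by (simp add: unit_vec_def vnorm_def)

lemma braket_unit_vec:
  assumes "unit_vec X v"
  shows "braket v v = 1"
proof -
  have "((\<lambda>x. (cmod (v x))\<^sup>2) has_sum 1) UNIV"
    using assms infsum_unit_vec[OF assms] by (auto simp: has_sum_iff unit_vec_def hilb_def)
  then have "((\<lambda>x. complex_of_real ((cmod (v x))\<^sup>2)) has_sum of_real 1) UNIV"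
    by (rule has_sum_of_real)
  moreover have "complex_of_real ((cmod (v x))\<^sup>2) = cnj (v x) * v x" for x
    by (metis complex_norm_square mult.commute)
  ultimately show ?thesis
    by (simp add: braket_def infsumI)
qed

lemma braket_reg_basis:
  assumes "distinct qs" "\<phi> \<in> hilb (reg_basis B qs)"
  shows "braket \<phi> \<psi> = (\<Sum>\<^sub>\<infinity>\<nu>\<in>labels B (set qs). cnj (\<phi> (map \<nu> qs)) * \<psi> (map \<nu> qs))"
proof -
  have "braket \<phi> \<psi> = (\<Sum>\<^sub>\<infinity>y\<in>reg_basis B qs. cnj (\<phi> y) * \<psi> y)"
    unfolding braket_def by (rule infsum_cong_neutral) (auto simp: hilbD[OF assms(2)])
  then show ?thesis by (simp add: infsum_reg_basis[OF assms(1)])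
qed

text \<open>The inner partial trace is already constant on the labels of \<open>qs\<close>, so the
  outer one only produces the factor \<langle>\<phi>|\<phi>\<rangle> = 1.\<close>

lemma law_cancel_same:
  assumes "distinct qs" "unit_vec (reg_basis B qs) \<phi>"
  shows "B \<turnstile> PInit qs \<phi> ;; PInit qs \<psi> \<approx> PInit qs \<psi>"
proof (rule prog_equivI)
  fix \<rho>
  have "ptrace B (set qs) (init_op B qs \<phi> (ptrace B (set qs) \<rho>)) \<sigma> \<tau> = ptrace B (set qs) \<rho> \<sigma> \<tau>"
    if "\<sigma> \<in> conf B" "\<tau> \<in> conf B" for \<sigma> \<tau>
  proof -
    have "ptrace B (set qs) (init_op B qs \<phi> (ptrace B (set qs) \<rho>)) \<sigma> \<tau> =
      (\<Sum>\<^sub>\<infinity>\<nu>\<in>labels B (set qs). cnj (\<phi> (map \<nu> qs)) * \<phi> (map \<nu> qs) * ptrace B (set qs) \<rho> \<sigma> \<tau>)"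
      unfolding ptrace_def[of B "set qs" "init_op _ _ _ _"]
      by (rule infsum_cong)
        (simp add: init_op_def override_in_conf that blindD[OF blind_ptrace] mult.commute)
    also have "\<dots> = ptrace B (set qs) \<rho> \<sigma> \<tau>"
      using braket_reg_basis[OF assms(1) unit_vec_hilb[OF assms(2)], of \<phi>]
      by (simp add: infsum_cmult_left' braket_unit_vec[OF assms(2)])
    finally show ?thesis .
  qed
  then show "sem B (PInit qs \<phi> ;; PInit qs \<psi>) \<rho> = sem B (PInit qs \<psi>) \<rho>"
    by (auto simp: sem_PInit[OF assms(1)] init_op_def fun_eq_iff simp del: sem.simps(3))
qed

lemma law_unitary:
  assumes "distinct qs" "unitary_op (reg_basis B qs) U" "circ_sem B C = ext B qs U"
  shows "B \<turnstile> PInit qs \<psi> ;; PCirc C \<approx> PInit qs (app U \<psi>)"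
proof -
  have "\<And>x y. y \<notin> reg_basis B qs \<Longrightarrow> U x y = 0"
    using assms(2) by (auto simp: unitary_op_def bounded_op_def)
  then show ?thesis
    using assms by (auto intro!: prog_equivI simp: sem_PInit sandwich_ext_init_op blind_ptrace simp del: sem.simps(3))
qed

section \<open>Square-summable families, and tests on a freshly initialised register\<close>

lemma ell2_mult_summable:
  assumes "(\<lambda>x. (cmod (f x))\<^sup>2) summable_on A" "(\<lambda>x. (cmod (g x))\<^sup>2) summable_on A"
  shows "(\<lambda>x. norm (f x * g x)) summable_on A"
  by (rule abs_summable_product) (use assms in \<open>simp_all add: norm_mult power2_eq_square\<close>)

lemma hilb_summable: "v \<in> hilb X \<Longrightarrow> (\<lambda>x. (cmod (v x))\<^sup>2) summable_on A"
  by (auto simp: hilb_def intro: summable_on_subset_banach)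

lemma braket_summable:
  assumes "v \<in> hilb X" "w \<in> hilb Y"
  shows "(\<lambda>x. cnj (v x) * w x) summable_on A"
  by (rule abs_summable_summable, rule ell2_mult_summable)
    (use hilb_summable[OF assms(1), of A] hilb_summable[OF assms(2), of A] in simp_all)

lemma infsum_binary_outcomes: "infsum f (binary_outcomes :: 'b::zero_neq_one list set) = f [0] + f [1]"
  by (simp add: binary_outcomes_def)

lemma app_ketbra: "app (ketbra v w) u = (\<lambda>x. v x * braket w u)"
  by (simp add: app_def ketbra_def braket_def infsum_cmult_right' mult.assoc)

lemma app_id_minus_ketbra:
  assumes "\<psi> \<in> hilb X" "\<phi> \<in> hilb X"
  shows "app (\<lambda>x y. id_op X x y - ketbra \<psi> \<psi> x y) \<phi> = (\<lambda>x. \<phi> x - \<psi> x * braket \<psi> \<phi>)"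
proof
  fix x
  have s1: "(\<lambda>y. id_op X x y * \<phi> y) summable_on UNIV"
    by (rule finite_nonzero_values_imp_summable_on, rule finite_subset[of _ "{x}"]) (auto simp: id_op_def)
  have s2: "(\<lambda>y. ketbra \<psi> \<psi> x y * \<phi> y) summable_on UNIV"
    unfolding ketbra_def mult.assoc by (intro summable_on_cmult_right braket_summable[OF assms])
  have "(\<Sum>\<^sub>\<infinity>y. id_op X x y * \<phi> y) = \<phi> x"
    by (subst infsum_single_point[where a = x]) (auto simp: id_op_def hilbD[OF assms(2)])
  moreover have "app (\<lambda>x y. id_op X x y - ketbra \<psi> \<psi> x y) \<phi> x
     = (\<Sum>\<^sub>\<infinity>y. id_op X x y * \<phi> y + - (ketbra \<psi> \<psi> x y * \<phi> y))"
    by (simp add: app_def algebra_simps)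
  moreover have "\<dots> = (\<Sum>\<^sub>\<infinity>y. id_op X x y * \<phi> y) - app (ketbra \<psi> \<psi>) \<phi> x"
    unfolding app_def by (subst infsum_add[OF s1 summable_on_uminus[THEN iffD2, OF s2]]) (simp add: infsum_uminus)
  ultimately show "app (\<lambda>x y. id_op X x y - ketbra \<psi> \<psi> x y) \<phi> x = \<phi> x - \<psi> x * braket \<psi> \<phi>"
    by (simp add: app_ketbra)
qed

lemma init_op_0: "init_op B qs (\<lambda>x. 0) T = (\<lambda>_ _. 0)"
  by (simp add: init_op_def fun_eq_iff)

text \<open>The test sends \<phi> to the unnormalised vectors \<phi> -
  \<psi>\<langle>\<psi>|\<phi>\<rangle> and \<psi>\<langle>\<psi>|\<phi>\<rangle>. If \<phi> =
  \<psi> or \<phi> is orthogonal to \<psi>, one of them is zero and the other is \<phi> itself, so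
  the surviving branch starts from the undisturbed state.\<close>

lemma law_cond:
  assumes "distinct qs" "unit_vec (reg_basis B qs) \<psi>" "unit_vec (reg_basis B qs) \<phi>"
    "is_test (reg_basis B qs) \<psi> M"
  shows "\<phi> = \<psi> \<Longrightarrow> B \<turnstile> PInit qs \<phi> ;; cond P\<^sub>0 M qs P\<^sub>1 \<approx> PInit qs \<phi> ;; P\<^sub>1"
    and "braket \<phi> \<psi> = 0 \<Longrightarrow> B \<turnstile> PInit qs \<phi> ;; cond P\<^sub>0 M qs P\<^sub>1 \<approx> PInit qs \<phi> ;; P\<^sub>0"
proof -
  note h = unit_vec_hilb[OF assms(2)] unit_vec_hilb[OF assms(3)]
  have M: "M [0] = (\<lambda>x y. id_op (reg_basis B qs) x y - ketbra \<psi> \<psi> x y)" "M [1] = ketbra \<psi> \<psi>"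
    using assms(4) by (auto simp: is_test_def)
  have Mz: "y \<notin> reg_basis B qs \<Longrightarrow> M [0] x y = 0" "y \<notin> reg_basis B qs \<Longrightarrow> M [1] x y = 0" for x y
    by (auto simp: M id_op_def ketbra_def hilbD[OF h(1)])
  have sem: "sem B (PInit qs \<phi> ;; cond P\<^sub>0 M qs P\<^sub>1) \<rho> =
     (\<lambda>\<sigma> \<tau>. sem B P\<^sub>0 (init_op B qs (app (M [0]) \<phi>) (ptrace B (set qs) \<rho>)) \<sigma> \<tau> +
        sem B P\<^sub>1 (init_op B qs (app (M [1]) \<phi>) (ptrace B (set qs) \<rho>)) \<sigma> \<tau>)" for \<rho>
    using assms(1)
    by (simp add: sem_PInit cond_def infsum_binary_outcomes sandwich_ext_init_op Mz blind_ptrace del: sem.simps(3))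
  have app0: "app (M [0]) \<phi> = (\<lambda>x. \<phi> x - \<psi> x * braket \<psi> \<phi>)"
    by (simp add: M app_id_minus_ketbra h)
  have app1: "app (M [1]) \<phi> = (\<lambda>x. \<psi> x * braket \<psi> \<phi>)"
    by (simp add: M app_ketbra)
  show "B \<turnstile> PInit qs \<phi> ;; cond P\<^sub>0 M qs P\<^sub>1 \<approx> PInit qs \<phi> ;; P\<^sub>1" if "\<phi> = \<psi>"
  proof (rule prog_equivI)
    fix \<rho>
    show "sem B (PInit qs \<phi> ;; cond P\<^sub>0 M qs P\<^sub>1) \<rho> = sem B (PInit qs \<phi> ;; P\<^sub>1) \<rho>"
      unfolding sem app0 app1 using assms(1)
      by (simp add: that braket_unit_vec[OF assms(2)] init_op_0 sem_zero sem_PInit del: sem.simps(3))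
  qed
  show "B \<turnstile> PInit qs \<phi> ;; cond P\<^sub>0 M qs P\<^sub>1 \<approx> PInit qs \<phi> ;; P\<^sub>0" if "braket \<phi> \<psi> = 0"
  proof (rule prog_equivI)
    fix \<rho>
    have "braket \<psi> \<phi> = cnj (braket \<phi> \<psi>)"
      unfolding braket_def by (simp add: mult.commute flip: infsum_cnj)
    then show "sem B (PInit qs \<phi> ;; cond P\<^sub>0 M qs P\<^sub>1) \<rho> = sem B (PInit qs \<phi> ;; P\<^sub>0) \<rho>"
      unfolding sem app0 app1 using assms(1)
      by (simp add: that init_op_0 sem_zero sem_PInit del: sem.simps(3))
  qed
qed

section \<open>Programs act locally\<close>

text \<open>Block diagonality with respect to the labels on \<open>W\<close>; the blocks themselves
  may depend on the label.\<close>

definition keeps :: "'q set \<Rightarrow> ('q \<Rightarrow> 'b) op \<Rightarrow> bool" where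
  "keeps W A \<longleftrightarrow> (\<forall>\<sigma> \<tau>. A \<sigma> \<tau> \<noteq> 0 \<longrightarrow> (\<forall>q\<in>W. \<sigma> q = \<tau> q))"

text \<open>Compares a single block of two matrices: \<open>a\<close> fixes the labels on
  \<open>W\<close> of the rows and \<open>b\<close> those of the columns. They are kept apart
  because passing to the adjoint exchanges them.\<close>

definition agree :: "'q set \<Rightarrow> ('q \<Rightarrow> 'b) \<Rightarrow> ('q \<Rightarrow> 'b) \<Rightarrow> ('q \<Rightarrow> 'b) op \<Rightarrow> ('q \<Rightarrow> 'b) op \<Rightarrow> bool" where
  "agree W a b \<rho> \<rho>' \<longleftrightarrow>
     (\<forall>\<sigma> \<tau>. (\<forall>q\<in>W. \<sigma> q = a q) \<longrightarrow> (\<forall>q\<in>W. \<tau> q = b q) \<longrightarrow> \<rho> \<sigma> \<tau> = \<rho>' \<sigma> \<tau>)"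

lemma keeps_ext: "W \<inter> set qs = {} \<Longrightarrow> keeps W (ext B qs A)"
  by (auto simp: keeps_def ext_def split: if_splits)

lemma mult_nonzeroD:
  assumes "mult A A' \<sigma> \<tau> \<noteq> 0"
  obtains \<upsilon> where "A \<sigma> \<upsilon> \<noteq> 0" "A' \<upsilon> \<tau> \<noteq> 0"
proof (rule ccontr)
  assume "\<not> thesis"
  with that have "(\<lambda>\<upsilon>. A \<sigma> \<upsilon> * A' \<upsilon> \<tau>) = (\<lambda>_. 0)" by (intro HOL.ext) auto
  then show False using assms unfolding mult_def by simp
qed

lemma keeps_mult: "keeps W A \<Longrightarrow> keeps W A' \<Longrightarrow> keeps W (mult A A')"
  unfolding keeps_def by (fastforce elim: mult_nonzeroD)

lemma keeps_sum:
  assumes "\<And>i. i \<in> I \<Longrightarrow> keeps W (A i)"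
  shows "keeps W (\<lambda>\<sigma> \<tau>. \<Sum>i\<in>I. A i \<sigma> \<tau>)"
  unfolding keeps_def
proof (intro allI impI)
  fix \<sigma> \<tau> assume "(\<Sum>i\<in>I. A i \<sigma> \<tau>) \<noteq> 0"
  then obtain i where "i \<in> I" "A i \<sigma> \<tau> \<noteq> 0"
    by (rule sum.not_neutral_contains_not_neutral)
  then show "\<forall>q\<in>W. \<sigma> q = \<tau> q"
    using assms unfolding keeps_def by blast
qed

lemma keeps_circ_sem: "W \<inter> circ_vars C = {} \<Longrightarrow> keeps W (circ_sem B C)"
proof (induction C)
  case CSkip
  then show ?case by (simp add: keeps_def id_op_def)
next
  case (CGate U qs)
  then show ?case by (simp add: keeps_ext)
next
  case (CSeq C1 C2)
  then show ?case by (simp add: keeps_mult Int_Un_distrib)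
next
  case (CQif qs d \<psi> C)
  have "keeps W (ext B qs (ketbra (\<psi> i) (\<psi> i)))" for i
    using CQif.prems by (intro keeps_ext) auto
  moreover have "keeps W (circ_sem B (C i))" if "i \<in> {1..d}" for i
    using CQif.prems that by (intro CQif.IH) auto
  ultimately show ?case
    unfolding circ_sem.simps by (intro keeps_sum keeps_mult)
qed

lemma agree_mult: "keeps W A \<Longrightarrow> agree W a b \<rho> \<rho>' \<Longrightarrow> agree W a b (mult A \<rho>) (mult A \<rho>')"
  unfolding agree_def mult_def
proof (intro allI impI infsum_cong)
  fix \<sigma> \<tau> \<upsilon> assume *: "keeps W A" "\<forall>\<sigma> \<tau>. (\<forall>q\<in>W. \<sigma> q = a q) \<longrightarrow> (\<forall>q\<in>W. \<tau> q = b q) \<longrightarrow> \<rho> \<sigma> \<tau> = \<rho>' \<sigma> \<tau>"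
    "\<forall>q\<in>W. \<sigma> q = a q" "\<forall>q\<in>W. \<tau> q = b q"
  show "A \<sigma> \<upsilon> * \<rho> \<upsilon> \<tau> = A \<sigma> \<upsilon> * \<rho>' \<upsilon> \<tau>"
  proof (cases "A \<sigma> \<upsilon> = 0")
    case False
    then have "\<forall>q\<in>W. \<sigma> q = \<upsilon> q" using *(1) unfolding keeps_def by blast
    then have "\<forall>q\<in>W. \<upsilon> q = a q" using *(3) by simp
    then show ?thesis using * by simp
  qed simp
qed

lemma agree_adj: "agree W a b \<rho> \<rho>' \<Longrightarrow> agree W b a (adj \<rho>) (adj \<rho>')"
  by (simp add: agree_def adj_def)

lemma agree_sandwich:
  "keeps W A \<Longrightarrow> agree W a b \<rho> \<rho>' \<Longrightarrow> agree W a b (sandwich A \<rho>) (sandwich A \<rho>')"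
  unfolding sandwich_adj by (intro agree_adj agree_mult)

lemma agree_infsum:
  "(\<And>i. i \<in> I \<Longrightarrow> agree W a b (\<rho> i) (\<rho>' i)) \<Longrightarrow>
    agree W a b (\<lambda>\<sigma> \<tau>. \<Sum>\<^sub>\<infinity>i\<in>I. \<rho> i \<sigma> \<tau>) (\<lambda>\<sigma> \<tau>. \<Sum>\<^sub>\<infinity>i\<in>I. \<rho>' i \<sigma> \<tau>)"
  by (auto simp: agree_def intro!: infsum_cong)

text \<open>All constructs are composed of entrywise sums and of conjugations by operators that are
  block diagonal on \<open>W\<close>, so a block of the output is computed from the same block of
  the input. The sums are compared summand by summand, which makes convergence irrelevant.\<close>

lemma agree_sem:
  "W \<inter> prog_vars P = {} \<Longrightarrow> agree W a b \<rho> \<rho>' \<Longrightarrow> agree W a b (sem B P \<rho>) (sem B P \<rho>')"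
proof (induction P arbitrary: \<rho> \<rho>')
  case PAbort
  then show ?case by (simp add: agree_def)
next
  case (PInit qs \<psi>)
  then show ?case unfolding sem.simps by (intro agree_infsum agree_sandwich keeps_ext) auto
next
  case (PCirc C)
  then show ?case unfolding sem.simps by (intro agree_sandwich keeps_circ_sem) auto
next
  case (PSeq P1 P2)
  then show ?case by (simp add: Int_Un_distrib)
next
  case (PIf qs S M P)
  show ?case unfolding sem.simps
    by (intro agree_infsum PIf.IH agree_sandwich keeps_ext PIf.prems(2)) (use PIf.prems(1) in auto)
next
  case (PWhile qs M P)
  have step: "agree W a b (((sem B P \<circ> sandwich (ext B qs (M [1]))) ^^ n) \<rho>)
    (((sem B P \<circ> sandwich (ext B qs (M [1]))) ^^ n) \<rho>')" for n
  proof (induction n)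
    case 0
    show ?case by (simp only: funpow.simps id_apply PWhile.prems)
  next
    case (Suc n)
    show ?case unfolding funpow.simps o_apply
      by (intro PWhile.IH agree_sandwich keeps_ext Suc[unfolded o_def]) (use PWhile.prems(1) in auto)
  qed
  show ?case unfolding sem.simps
    by (intro agree_infsum agree_sandwich keeps_ext step) (use PWhile.prems(1) in auto)
qed simp

section \<open>Computational-basis measurements and if-expansion\<close>

lemma mult_ext_ketbra_ket_ket:
  "mult (ext B qs (ketbra (ket m) (ket m))) R \<sigma> \<tau> =
    (if \<sigma> \<in> conf B \<and> map \<sigma> qs = m then R \<sigma> \<tau> else 0)"
proof (cases "\<sigma> \<in> conf B \<and> map \<sigma> qs = m")
  case True
  define \<nu> where "\<nu> = (\<lambda>q. if q \<in> set qs then \<sigma> q else 0)"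
  have \<nu>: "\<nu> \<in> labels B (set qs)" "override_on \<sigma> \<nu> (set qs) = \<sigma>" "map \<nu> qs = m"
    using True by (auto simp: \<nu>_def labels_def conf_def override_on_def fun_eq_iff)
  have "map \<nu>' qs \<noteq> m" if "\<nu>' \<in> labels B (set qs)" "\<nu>' \<noteq> \<nu>" for \<nu>'
    using map_labels_eq_iff[OF that(1) \<nu>(1)] that(2) \<nu>(3) by simp
  then have "(\<Sum>\<^sub>\<infinity>\<nu>\<in>labels B (set qs). ketbra (ket m) (ket m) (map \<sigma> qs) (map \<nu> qs) * R (override_on \<sigma> \<nu> (set qs)) \<tau>)
      = ketbra (ket m) (ket m) (map \<sigma> qs) (map \<nu> qs) * R (override_on \<sigma> \<nu> (set qs)) \<tau>"
    using \<nu>(1) by (intro infsum_single_point) (simp_all add: ketbra_def ket_def del: map_eq_conv)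
  also have "\<dots> = R \<sigma> \<tau>"
    using True unfolding \<nu>(2,3) by (simp add: ketbra_def ket_def)
  finally show ?thesis using True by (simp add: mult_ext)
next
  case False
  then show ?thesis unfolding mult_ext by (auto simp: ketbra_def ket_def)
qed

lemma sandwich_ext_ketbra_ket_ket:
  "sandwich (ext B qs (ketbra (ket m) (ket m))) \<rho> \<sigma> \<tau> =
    (if \<sigma> \<in> conf B \<and> \<tau> \<in> conf B \<and> map \<sigma> qs = m \<and> map \<tau> qs = m then \<rho> \<sigma> \<tau> else 0)"
  by (simp add: sandwich_adj adj_def mult_ext_ketbra_ket_ket)

text \<open>Once all labels on \<open>W\<close> are fixed to \<nu>, the outcome
  \<open>map \<nu> qs\<close> is the only possible one: every other branch starts from a matrix
  whose block at \<nu> is zero. The right-hand side depends on the measured register only through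
  the branch that it selects, which is what allows two registers to be compared.\<close>

lemma sem_comp_if_override:
  assumes "set qs \<subseteq> W" "\<And>q. q \<in> W \<Longrightarrow> qubit B q" "\<nu> \<in> labels B W"
    "\<And>m. m \<in> bit_strings (length qs) \<Longrightarrow> W \<inter> prog_vars (P m) = {}"
  shows "sem B (comp_if qs P) \<rho> (override_on \<sigma> \<nu> W) (override_on \<tau> \<nu> W) =
    sem B (P (map \<nu> qs)) (\<lambda>\<sigma> \<tau>. if \<sigma> \<in> conf B \<and> \<tau> \<in> conf B then \<rho> \<sigma> \<tau> else 0)
      (override_on \<sigma> \<nu> W) (override_on \<tau> \<nu> W)"
proof -
  define test where "test m = sandwich (ext B qs (ketbra (ket m) (ket m))) \<rho>" for m
  have \<nu>_bits: "map \<nu> qs \<in> bit_strings (length qs)"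
    using assms(1-3) by (auto simp: bit_strings_def labels_def qubit_def)
  have test: "agree W \<nu> \<nu> (test m)
      (if m = map \<nu> qs then \<lambda>\<sigma> \<tau>. if \<sigma> \<in> conf B \<and> \<tau> \<in> conf B then \<rho> \<sigma> \<tau> else 0 else (\<lambda>_ _. 0))" for m
    unfolding agree_def
  proof (intro allI impI)
    fix \<sigma> \<tau> assume "\<forall>q\<in>W. \<sigma> q = \<nu> q" "\<forall>q\<in>W. \<tau> q = \<nu> q"
    then have "map \<sigma> qs = map \<nu> qs" "map \<tau> qs = map \<nu> qs"
      using assms(1) by auto
    then show "test m \<sigma> \<tau> = (if m = map \<nu> qs
        then \<lambda>\<sigma> \<tau>. if \<sigma> \<in> conf B \<and> \<tau> \<in> conf B then \<rho> \<sigma> \<tau> else 0 else (\<lambda>_ _. 0)) \<sigma> \<tau>"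
      by (simp only: test_def sandwich_ext_ketbra_ket_ket split: if_split) auto
  qed
  have "sem B (P m) (test m) (override_on \<sigma> \<nu> W) (override_on \<tau> \<nu> W) =
      sem B (P m) (if m = map \<nu> qs then \<lambda>\<sigma> \<tau>. if \<sigma> \<in> conf B \<and> \<tau> \<in> conf B then \<rho> \<sigma> \<tau> else 0 else (\<lambda>_ _. 0))
        (override_on \<sigma> \<nu> W) (override_on \<tau> \<nu> W)" if "m \<in> bit_strings (length qs)" for m
    using agree_sem[OF assms(4)[OF that] test] by (simp add: agree_def)
  then show ?thesis
    using \<nu>_bits unfolding comp_if_def sem.simps test_def[symmetric]
    by (subst infsum_single_point[where a = "map \<nu> qs"]) (auto simp: sem_zero)
qed

lemma restrict_string_map:
  assumes "set qs \<subseteq> set rs"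
  shows "restrict_string rs qs (map \<nu> rs) = map \<nu> qs"
  using assms by (auto simp: restrict_string_def map_of_zip_map)

text \<open>The final initialisation sees only the partial trace over \<open>rs\<close>, that is,
  the blocks whose row and column labels on \<open>rs\<close> are the same \<nu>. On such a block
  both programs run the branch for \<open>map \<nu> qs\<close>.\<close>

lemma law_if_expansion:
  assumes "distinct rs" "\<And>r. r \<in> set rs \<Longrightarrow> qubit B r" "set qs \<subseteq> set rs"
    "\<And>m. m \<in> bit_strings (length qs) \<Longrightarrow> set rs \<inter> prog_vars (P m) = {}"
  shows "B \<turnstile> comp_if qs P ;; PInit rs \<phi> \<approx> comp_if rs (\<lambda>k. P (restrict_string rs qs k)) ;; PInit rs \<phi>"
proof (rule prog_equivI)
  fix \<rho>
  have restr: "restrict_string rs qs k \<in> bit_strings (length qs)" if "k \<in> bit_strings (length rs)" for k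
  proof -
    have len: "length k = length rs" and k: "set k \<subseteq> {0, 1}"
      using that by (auto simp: bit_strings_def)
    have "the (map_of (zip rs k) q) \<in> set k" if "q \<in> set rs" for q
    proof -
      obtain x where "map_of (zip rs k) q = Some x"
        using \<open>q \<in> set rs\<close> len by (metis map_of_zip_is_Some)
      then show ?thesis by (auto dest!: map_of_SomeD set_zip_rightD)
    qed
    then show ?thesis using k assms(3) by (fastforce simp: bit_strings_def restrict_string_def)
  qed
  have "ptrace B (set rs) (sem B (comp_if qs P) \<rho>) =
    ptrace B (set rs) (sem B (comp_if rs (\<lambda>k. P (restrict_string rs qs k))) \<rho>)"
    unfolding ptrace_def
  proof (intro ext infsum_cong)
    fix \<sigma> \<tau> \<nu> assume \<nu>: "\<nu> \<in> labels B (set rs)"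
    show "sem B (comp_if qs P) \<rho> (override_on \<sigma> \<nu> (set rs)) (override_on \<tau> \<nu> (set rs)) =
      sem B (comp_if rs (\<lambda>k. P (restrict_string rs qs k))) \<rho> (override_on \<sigma> \<nu> (set rs)) (override_on \<tau> \<nu> (set rs))"
      using sem_comp_if_override[OF assms(3,2) \<nu> assms(4), where \<rho> = \<rho>]
        sem_comp_if_override[OF order_refl assms(2) \<nu> assms(4)[OF restr], where \<rho> = \<rho>]
      by (simp add: restrict_string_map[OF assms(3)])
  qed
  then show "sem B (comp_if qs P ;; PInit rs \<phi>) \<rho> =
    sem B (comp_if rs (\<lambda>k. P (restrict_string rs qs k)) ;; PInit rs \<phi>) \<rho>"
    by (simp add: sem_PInit[OF assms(1)] del: sem.simps(3))
qed

section \<open>Positive operators and iterated partial traces\<close>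

text \<open>Positivity is tested on finitely many indices. No convergence is involved, and the
  notion passes to pullbacks along arbitrary maps between index sets.\<close>

definition psd :: "'x op \<Rightarrow> bool" where
  "psd R \<longleftrightarrow> (\<forall>F v. finite F \<longrightarrow> (\<Sum>s\<in>F. \<Sum>t\<in>F. cnj (v s) * R s t * v t) \<in> \<real>\<^sub>\<ge>\<^sub>0)"

lemma psdD: "psd R \<Longrightarrow> finite F \<Longrightarrow> (\<Sum>s\<in>F. \<Sum>t\<in>F. cnj (v s) * R s t * v t) \<in> \<real>\<^sub>\<ge>\<^sub>0"
  by (simp add: psd_def)

lemma psd_diag: "psd R \<Longrightarrow> R s s \<in> \<real>\<^sub>\<ge>\<^sub>0"
  using psdD[of R "{s}" "\<lambda>_. 1"] by simp

lemma psd_two: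
  assumes "psd R" "s \<noteq> t"
  shows "cnj x * R s s * x + cnj x * R s t * y + cnj y * R t s * x + cnj y * R t t * y \<in> \<real>\<^sub>\<ge>\<^sub>0"
  using psdD[OF assms(1), of "{s, t}" "\<lambda>u. if u = s then x else y"] assms(2) by (simp add: add.assoc)

text \<open>The form takes real values. At the vector (1, 1) this annihilates the sum of the
  imaginary parts, at (1, \<open>\<i>\<close>) the difference of the real parts.\<close>

lemma psd_hermitian:
  assumes "psd R"
  shows "R t s = cnj (R s t)"
proof (cases "s = t")
  case True
  then show ?thesis using psd_diag[OF assms, of s] by (auto simp: complex_nonneg_Reals_iff complex_eq_iff)
next
  case False
  note d = psd_diag[OF assms, of s] psd_diag[OF assms, of t]
  have "Im (R s t) + Im (R t s) = 0"
    using psd_two[OF assms False, of 1 1] d by (simp add: complex_nonneg_Reals_iff)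
  moreover have "Re (R s t) - Re (R t s) = 0"
    using psd_two[OF assms False, of 1 \<i>] d by (simp add: complex_nonneg_Reals_iff)
  ultimately show ?thesis by (simp add: complex_eq_iff)
qed

text \<open>At the vector with entries \<open>- R s t\<close> and a real \<open>l\<close> the form
  equals \<open>a * c + b * l\<^sup>2 - 2 * c * l\<close>. The choice \<open>l = a\<close> gives
  \<open>a * (a * b - c) \<ge> 0\<close>. For \<open>a = 0\<close> the choice
  \<open>l = c / b\<close>, or \<open>l = 1\<close> if also \<open>b = 0\<close>, forces
  \<open>c = 0\<close>.\<close>

lemma psd_cauchy_schwarz:
  assumes "psd R"
  shows "(cmod (R s t))\<^sup>2 \<le> Re (R s s) * Re (R t t)"
proof (cases "s = t")
  case True
  have "cmod (R s s) = Re (R s s)"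
    using psd_diag[OF assms, of s] by (simp add: complex_nonneg_Reals_iff cmod_eq_Re)
  then show ?thesis using True by (simp add: power2_eq_square)
next
  case False
  define a b c where "a = Re (R s s)" and "b = Re (R t t)" and "c = (cmod (R s t))\<^sup>2"
  have ab: "R s s = of_real a" "R t t = of_real b" "a \<ge> 0" "b \<ge> 0"
    using psd_diag[OF assms, of s] psd_diag[OF assms, of t]
    by (auto simp: a_def b_def complex_nonneg_Reals_iff complex_eq_iff)
  have c: "cnj (R s t) * R s t = of_real c"
    unfolding c_def by (metis complex_norm_square mult.commute of_real_power)
  have quad: "a * c + b * l\<^sup>2 - 2 * c * l \<ge> 0" for l :: real
  proof -
    have "cnj (- R s t) * R s s * (- R s t) + cnj (- R s t) * R s t * of_real l +
        cnj (of_real l) * R t s * (- R s t) + cnj (of_real l) * R t t * of_real l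
      = (cnj (R s t) * R s t) * of_real a - 2 * (cnj (R s t) * R s t) * of_real l + of_real (b * l\<^sup>2)"
      by (simp add: ab psd_hermitian[OF assms, of t s] power2_eq_square algebra_simps)
    also have "\<dots> = of_real (a * c + b * l\<^sup>2 - 2 * c * l)"
      unfolding c by simp
    finally have "complex_of_real (a * c + b * l\<^sup>2 - 2 * c * l) \<in> \<real>\<^sub>\<ge>\<^sub>0"
      using psd_two[OF assms False, of "- R s t" "of_real l"] by argo
    then show ?thesis by (simp only: nonneg_Reals_of_real_iff)
  qed
  have "c \<le> a * b"
  proof (cases "a = 0")
    case True
    have "c = 0"
    proof (cases "b = 0")
      case True
      then show ?thesis using quad[of 1] \<open>a = 0\<close> by (simp add: c_def)
    next
      case False
      then have "b > 0" using ab by simp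
      have "b * (c / b)\<^sup>2 = c * (c / b)" using \<open>b > 0\<close> by (simp add: power2_eq_square)
      then have "c * (c / b) \<le> 0" using quad[of "c / b"] True by simp
      then have "c * c \<le> 0" using \<open>b > 0\<close> by (simp add: divide_le_0_iff)
      then show ?thesis by (simp add: mult_le_0_iff c_def)
    qed
    then show ?thesis using True by simp
  next
    case False
    then have "a > 0" using ab by simp
    have "a * (a * b - c) \<ge> 0" using quad[of a] by (simp add: power2_eq_square algebra_simps)
    then show ?thesis using \<open>a > 0\<close> by (simp add: zero_le_mult_iff)
  qed
  then show ?thesis by (simp add: a_def b_def c_def)
qed

lemma app_finite_support:
  assumes "finite F" "\<And>y. y \<notin> F \<Longrightarrow> v y = 0"
  shows "app A v x = (\<Sum>y\<in>F. A x y * v y)"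
proof -
  have "app A v x = infsum (\<lambda>y. A x y * v y) F"
    unfolding app_def by (rule infsum_cong_neutral) (use assms in auto)
  then show ?thesis using assms by simp
qed

lemma hilb_finite_support:
  assumes "finite F" "F \<subseteq> X" "\<And>y. y \<notin> F \<Longrightarrow> v y = 0"
  shows "v \<in> hilb X"
proof -
  have "(\<lambda>x. (cmod (v x))\<^sup>2) summable_on UNIV"
    by (rule finite_nonzero_values_imp_summable_on, rule finite_subset[OF _ assms(1)]) (use assms(3) in auto)
  then show ?thesis using assms by (auto simp: hilb_def)
qed

lemma psd_partial_density:
  assumes "partial_density X \<rho>"
  shows "psd \<rho>"
  unfolding psd_def
proof (intro allI impI)
  fix F :: "'a set" and v :: "'a \<Rightarrow> complex" assume F: "finite F"
  \<comment> \<open>Positivity of \<rho> is known for vectors of the Hilbert space only, so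
    \<open>v\<close> is cut down to \<open>X\<close>; the lost terms are zero because \<rho>
    vanishes outside \<open>X\<close>.\<close>
  define v' where "v' = (\<lambda>x. if x \<in> F \<inter> X then v x else 0)"
  have "v' \<in> hilb X" by (rule hilb_finite_support[of "F \<inter> X"]) (auto simp: v'_def F)
  then have "braket v' (app \<rho> v') \<in> \<real>\<^sub>\<ge>\<^sub>0"
    using assms by (simp add: partial_density_def)
  moreover have "braket v' (app \<rho> v') = (\<Sum>\<^sub>\<infinity>x\<in>F. cnj (v' x) * (\<Sum>y\<in>F. \<rho> x y * v' y))"
    unfolding braket_def by (rule infsum_cong_neutral) (auto simp: v'_def app_finite_support[OF F])
  moreover have "\<dots> = (\<Sum>s\<in>F. \<Sum>t\<in>F. cnj (v s) * \<rho> s t * v t)"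
  proof -
    have "\<rho> x y = 0" if "x \<notin> X \<or> y \<notin> X" for x y
      using assms that unfolding partial_density_def bounded_op_def by blast
    then show ?thesis
      using F by (auto simp: sum_distrib_left v'_def intro!: sum.cong)
  qed
  ultimately show "(\<Sum>s\<in>F. \<Sum>t\<in>F. cnj (v s) * \<rho> s t * v t) \<in> \<real>\<^sub>\<ge>\<^sub>0" by simp
qed

text \<open>What Fubini arguments use of a density operator: an entrywise bound by a square-summable
  weight, namely the root of the diagonal.\<close>

definition dominated :: "'x op \<Rightarrow> ('x \<Rightarrow> real) \<Rightarrow> bool" where
  "dominated R g \<longleftrightarrow> (\<forall>s t. cmod (R s t) \<le> g s * g t) \<and> (\<forall>s. 0 \<le> g s) \<and>
     (\<lambda>s. (g s)\<^sup>2) summable_on UNIV"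

lemma psd_dominated:
  assumes "psd R" "(\<lambda>s. Re (R s s)) summable_on UNIV"
  shows "dominated R (\<lambda>s. sqrt (Re (R s s)))"
proof -
  have "Re (R s s) \<ge> 0" for s
    using psd_diag[OF assms(1), of s] by (simp add: complex_nonneg_Reals_iff)
  moreover have "cmod (R s t) \<le> sqrt (Re (R s s)) * sqrt (Re (R t t))" for s t
    using psd_cauchy_schwarz[OF assms(1), of s t] by (simp add: real_le_rsqrt flip: real_sqrt_mult)
  ultimately show ?thesis using assms(2) by (simp add: dominated_def)
qed

lemma partial_density_dominated:
  "partial_density X \<rho> \<Longrightarrow> dominated \<rho> (\<lambda>s. sqrt (Re (\<rho> s s)))"
  by (intro psd_dominated psd_partial_density) (auto simp: partial_density_def)

section \<open>Summability on slices and iterated partial traces\<close>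

lemma inj_on_override: "inj_on (\<lambda>\<nu>. override_on \<sigma> \<nu> S) (labels B S)"
  by (rule inj_onI) (auto simp: labels_def override_on_def fun_eq_iff, metis)

lemma summable_on_slice:
  fixes g :: "('q \<Rightarrow> 'b::zero) \<Rightarrow> real"
  assumes "g summable_on UNIV"
  shows "(\<lambda>\<nu>. g (override_on \<sigma> \<nu> S)) summable_on labels B S"
proof -
  have "g summable_on ((\<lambda>\<nu>. override_on \<sigma> \<nu> S) ` labels B S)"
    using assms by (rule summable_on_subset_banach) simp
  then show ?thesis
    by (simp add: summable_on_reindex[OF inj_on_override] o_def)
qed

lemma dominated_slice_summable:
  assumes "dominated \<rho> g"
  shows "(\<lambda>\<nu>. norm (\<rho> (override_on \<sigma> \<nu> S) (override_on \<tau> \<nu> S))) summable_on labels B S"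
proof -
  have "(\<lambda>s. (g s)\<^sup>2) summable_on UNIV" using assms by (simp add: dominated_def)
  note sl = summable_on_slice[OF this]
  have "(\<lambda>\<nu>. norm (of_real (g (override_on \<sigma> \<nu> S)) * complex_of_real (g (override_on \<tau> \<nu> S)))) summable_on labels B S"
    by (rule ell2_mult_summable) (simp_all add: sl)
  then show ?thesis
    by (rule Infinite_Sum.abs_summable_on_comparison_test)
      (use assms in \<open>auto simp: dominated_def norm_mult\<close>)
qed

lemma bij_betw_labels_Un:
  assumes "D \<inter> S = {}"
  shows "bij_betw (\<lambda>(\<nu>, \<mu>). override_on \<nu> \<mu> S) (labels B D \<times> labels B S) (labels B (D \<union> S))"
proof (rule bij_betw_byWitness[where f' = "\<lambda>\<nu>. (override_on \<nu> (\<lambda>_. 0) S, override_on (\<lambda>_. 0) \<nu> S)"])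
qed (use assms in \<open>auto simp: labels_def override_on_def fun_eq_iff\<close>)

lemma override_on_Un:
  "override_on (override_on \<sigma> \<nu> D) \<mu> S = override_on \<sigma> (override_on \<nu> \<mu> S) (D \<union> S)"
  by (auto simp: override_on_def fun_eq_iff)

text \<open>Domination makes the family absolutely summable over the labels of
  \<open>D \<union> S\<close>, which identifies the iterated sum with the joint one.\<close>

lemma ptrace_ptrace:
  assumes "D \<inter> S = {}" "dominated \<rho> g"
  shows "ptrace B D (ptrace B S \<rho>) = ptrace B (D \<union> S) \<rho>"
proof (intro ext)
  fix \<sigma> \<tau>
  let ?f = "\<lambda>\<kappa>. \<rho> (override_on \<sigma> \<kappa> (D \<union> S)) (override_on \<tau> \<kappa> (D \<union> S))"
  let ?h = "\<lambda>(\<nu>, \<mu>). override_on \<nu> \<mu> S"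
  have bij: "bij_betw ?h (labels B D \<times> labels B S) (labels B (D \<union> S))"
    by (rule bij_betw_labels_Un[OF assms(1)])
  have "?f summable_on labels B (D \<union> S)"
    by (rule abs_summable_summable, rule dominated_slice_summable[OF assms(2)])
  then have "(\<lambda>p. ?f (?h p)) summable_on (labels B D \<times> labels B S)"
    using summable_on_reindex_bij_betw[OF bij, of ?f] by simp
  then have "infsum (\<lambda>p. ?f (?h p)) (labels B D \<times> labels B S) =
      (\<Sum>\<^sub>\<infinity>\<nu>\<in>labels B D. \<Sum>\<^sub>\<infinity>\<mu>\<in>labels B S. ?f (?h (\<nu>, \<mu>)))"
    by (rule infsum_Sigma_banach[symmetric])
  moreover have "infsum (\<lambda>p. ?f (?h p)) (labels B D \<times> labels B S) = infsum ?f (labels B (D \<union> S))"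
    by (rule infsum_reindex_bij_betw[OF bij])
  ultimately show "ptrace B D (ptrace B S \<rho>) \<sigma> \<tau> = ptrace B (D \<union> S) \<rho> \<sigma> \<tau>"
    by (simp add: ptrace_def override_on_Un)
qed

lemma tensor_map_append [simp]:
  "tensor qs \<phi> \<psi> (map \<sigma> (qs @ rs)) = \<phi> (map \<sigma> qs) * \<psi> (map \<sigma> rs)"
  by (simp add: tensor_def)

lemma law_cancel_tensor:
  assumes "distinct qs" "distinct rs" "set qs \<inter> set rs = {}"
  shows "B \<turnstile> PInit qs \<phi> ;; PInit rs \<psi> \<approx> PInit (qs @ rs) (tensor qs \<phi> \<psi>)"
proof (rule prog_equivI)
  fix \<rho> assume pd: "partial_density (conf B) \<rho>"
  have *: "ptrace B (set rs) (ptrace B (set qs) \<rho>) = ptrace B (set rs \<union> set qs) \<rho>"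
    using assms(3) by (intro ptrace_ptrace[OF _ partial_density_dominated[OF pd]]) auto
  \<comment> \<open>Overriding on \<open>rs\<close> leaves the labels on \<open>qs\<close> alone, so
    the factor from \<phi> is constant in the sum and only the two traces have to be merged.\<close>
  have "ptrace B (set rs) (init_op B qs \<phi> T) \<sigma> \<tau> = init_op B qs \<phi> (ptrace B (set rs) T) \<sigma> \<tau>"
    if "\<sigma> \<in> conf B" "\<tau> \<in> conf B" for \<sigma> \<tau> T
    using that assms(3)
    by (simp add: ptrace_def init_op_def override_in_conf map_override_on_disjoint infsum_cmult_right' cong: infsum_cong)
  then show "sem B (PInit qs \<phi> ;; PInit rs \<psi>) \<rho> = sem B (PInit (qs @ rs) (tensor qs \<phi> \<psi>)) \<rho>"
    using assms
    by (auto simp: sem_PInit * init_op_def Un_commute fun_eq_iff simp del: sem.simps(3) map_append)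
qed

lemma zero_ket_map: "zero_ket qs (map \<sigma> qs) = (if \<forall>q\<in>set qs. \<sigma> q = 0 then 1 else 0)"
  unfolding zero_ket_def ket_def map_replicate_const[symmetric] by auto

lemma infsum_if: "(\<Sum>\<^sub>\<infinity>x\<in>A. if P then f x else 0) = (if P then infsum f A else 0)"
  by simp

text \<open>The registers may overlap. On the overlap the second initialisation already finds
  |0\<rangle>, so only labels that vanish there contribute, and its partial trace reduces to one
  over \<open>D\<close>, the part of \<open>qs2\<close> outside \<open>qs1\<close>.\<close>

lemma law_cancel_zero:
  assumes "\<And>q. 0 \<in> B q" "distinct qs" "distinct qs1" "distinct qs2" "set qs = set qs1 \<union> set qs2"
  shows "B \<turnstile> PInit qs1 (zero_ket qs1) ;; PInit qs2 (zero_ket qs2) \<approx> PInit qs (zero_ket qs)"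
proof (rule prog_equivI)
  fix \<rho> assume pd: "partial_density (conf B) \<rho>"
  define D where "D = set qs2 - set qs1"
  have eq: "set qs = D \<union> set qs1" using assms(5) by (auto simp: D_def)
  have *: "ptrace B D (ptrace B (set qs1) \<rho>) = ptrace B (set qs) \<rho>"
    unfolding eq by (intro ptrace_ptrace[OF _ partial_density_dominated[OF pd]]) (auto simp: D_def)
  have "ptrace B (set qs2) (init_op B qs1 (zero_ket qs1) T) \<sigma> \<tau> =
      (if \<forall>q\<in>set qs1. \<sigma> q = 0 \<and> \<tau> q = 0 then ptrace B D T \<sigma> \<tau> else 0)"
    if c: "\<sigma> \<in> conf B" "\<tau> \<in> conf B" and z: "\<forall>q\<in>set qs2. \<sigma> q = 0" "\<forall>q\<in>set qs2. \<tau> q = 0" for \<sigma> \<tau> T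
  proof -
    have ov: "(\<forall>q\<in>set qs1. override_on \<upsilon> \<nu> (set qs2) q = 0) \<longleftrightarrow>
        (\<forall>q\<in>set qs1. \<upsilon> q = 0) \<and> \<nu> \<in> labels B D"
      if "\<nu> \<in> labels B (set qs2)" "\<forall>q\<in>set qs2. \<upsilon> q = 0" for \<upsilon> \<nu>
      using that by (auto simp: labels_def override_on_def D_def)
    have "ptrace B (set qs2) (init_op B qs1 (zero_ket qs1) T) \<sigma> \<tau> =
      (\<Sum>\<^sub>\<infinity>\<nu>\<in>labels B (set qs2). if (\<forall>q\<in>set qs1. \<sigma> q = 0 \<and> \<tau> q = 0) \<and> \<nu> \<in> labels B D
        then T (override_on \<sigma> \<nu> (set qs2)) (override_on \<tau> \<nu> (set qs2)) else 0)"
      unfolding ptrace_def init_op_def zero_ket_map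
      by (rule infsum_cong) (auto simp: c override_in_conf ov z)
    also have "\<dots> = (\<Sum>\<^sub>\<infinity>\<nu>\<in>labels B D. if (\<forall>q\<in>set qs1. \<sigma> q = 0 \<and> \<tau> q = 0)
        then T (override_on \<sigma> \<nu> D) (override_on \<tau> \<nu> D) else 0)"
    proof (rule infsum_cong_neutral)
      fix \<nu> assume "\<nu> \<in> labels B (set qs2) \<inter> labels B D"
      then have "override_on \<upsilon> \<nu> (set qs2) = override_on \<upsilon> \<nu> D" if "\<forall>q\<in>set qs2. \<upsilon> q = 0" for \<upsilon>
        using that by (auto simp: labels_def override_on_def D_def fun_eq_iff)
      then show "(if (\<forall>q\<in>set qs1. \<sigma> q = 0 \<and> \<tau> q = 0) \<and> \<nu> \<in> labels B D
        then T (override_on \<sigma> \<nu> (set qs2)) (override_on \<tau> \<nu> (set qs2)) else 0) =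
        (if (\<forall>q\<in>set qs1. \<sigma> q = 0 \<and> \<tau> q = 0) then T (override_on \<sigma> \<nu> D) (override_on \<tau> \<nu> D) else 0)"
        using z \<open>\<nu> \<in> _\<close> by simp
    next
      \<comment> \<open>A label on \<open>D\<close> is padded by \<open>0\<close> on the overlap of
        the registers. It is a label on \<open>qs2\<close> only if \<open>0\<close> is legal there;
        this is where \<open>0 \<in> B q\<close> enters.\<close>
      fix \<nu> assume "\<nu> \<in> labels B D - labels B (set qs2)"
      then show "(if (\<forall>q\<in>set qs1. \<sigma> q = 0 \<and> \<tau> q = 0)
        then T (override_on \<sigma> \<nu> D) (override_on \<tau> \<nu> D) else 0) = 0"
        using assms(1) by (auto simp: labels_def D_def)
    qed auto
    finally show ?thesis by (simp only: ptrace_def infsum_if)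
  qed
  note pt = this
  show "sem B (PInit qs1 (zero_ket qs1) ;; PInit qs2 (zero_ket qs2)) \<rho> = sem B (PInit qs (zero_ket qs)) \<rho>"
  proof (intro ext)
    fix \<sigma> \<tau>
    show "sem B (PInit qs1 (zero_ket qs1) ;; PInit qs2 (zero_ket qs2)) \<rho> \<sigma> \<tau> = sem B (PInit qs (zero_ket qs)) \<rho> \<sigma> \<tau>"
      unfolding sem.simps(5) o_apply sem_PInit[OF assms(2)] sem_PInit[OF assms(3)] sem_PInit[OF assms(4)]
        init_op_def[of B qs2] init_op_def[of B qs]
      by (auto simp: pt * zero_ket_map assms(5))
  qed
qed

section \<open>Controlled unitaries\<close>

lemma has_sum_Times_mult:
  fixes f :: "'a \<Rightarrow> complex" and g :: "'b \<Rightarrow> complex"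
  assumes "(\<lambda>x. norm (f x)) summable_on A" "(\<lambda>x. norm (g x)) summable_on B"
  shows "((\<lambda>(x, y). f x * g y) has_sum (infsum f A * infsum g B)) (A \<times> B)"
proof -
  have "(\<lambda>p. norm (case p of (x, y) \<Rightarrow> f x * g y)) summable_on A \<times> B"
    unfolding Infinite_Sum.abs_summable_on_Sigma_iff
    using assms by (auto simp: norm_mult infsum_cmult_right' infsum_nonneg abs_mult
        intro!: summable_on_cmult_right summable_on_cmult_left)
  then have s: "(\<lambda>(x, y). f x * g y) summable_on A \<times> B"
    by (rule abs_summable_summable)
  have "infsum (\<lambda>(x, y). f x * g y) (A \<times> B) = infsum f A * infsum g B"
    using infsum_Sigma_banach[OF s]
    by (simp add: infsum_cmult_right' infsum_cmult_left')
  then show ?thesis using s by (simp add: has_sum_iff)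
qed

lemma has_sum_finite_sum:
  fixes f :: "'i \<Rightarrow> 'a \<Rightarrow> 'b::topological_comm_monoid_add"
  assumes "\<And>i. i \<in> I \<Longrightarrow> (f i has_sum s i) A"
  shows "((\<lambda>x. \<Sum>i\<in>I. f i x) has_sum (\<Sum>i\<in>I. s i)) A"
proof (cases "finite I")
  case True
  then show ?thesis using assms
    by (induction rule: finite_induct) (auto intro!: has_sum_add)
qed simp

lemma unitary_row_ell2:
  assumes "unitary_op X U"
  shows "(\<lambda>y. (cmod (U x y))\<^sup>2) summable_on A"
proof (cases "x \<in> X")
  case True
  have "mult U (adj U) x x = 1"
    using assms True by (simp add: unitary_op_def id_op_def)
  then have "(\<Sum>\<^sub>\<infinity>y. U x y * cnj (U x y)) = 1"
    by (simp add: mult_def adj_def)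
  \<comment> \<open>A family that is not summable would have \<open>infsum\<close> equal to 0, so
    the value 1 proves summability.\<close>
  then have "(\<lambda>y. U x y * cnj (U x y)) summable_on UNIV"
    by (metis infsum_not_exists zero_neq_one)
  then have "(\<lambda>y. Re (U x y * cnj (U x y))) summable_on UNIV"
    by (rule summable_on_Re)
  moreover have "Re (U x y * cnj (U x y)) = (cmod (U x y))\<^sup>2" for y
    unfolding cmod_power2 by (simp add: power2_eq_square)
  ultimately show ?thesis by (auto intro: summable_on_subset_banach)
next
  case False
  then have "U x = (\<lambda>_. 0)"
    using assms by (auto simp: unitary_op_def bounded_op_def)
  then show ?thesis by simp
qed

section \<open>The controlled operator on a joint register\<close>

lemma reg_basis_append:
  "bij_betw (\<lambda>(x, y). x @ y) (reg_basis B qs \<times> reg_basis B rs) (reg_basis B (qs @ rs))"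
proof (rule bij_betw_byWitness[where f' = "\<lambda>z. (take (length qs) z, drop (length qs) z)"])
  show "(\<lambda>(x, y). x @ y) ` (reg_basis B qs \<times> reg_basis B rs) \<subseteq> reg_basis B (qs @ rs)"
    by (auto simp: reg_basis_def intro: list_all2_appendI)
  show "(\<lambda>z. (take (length qs) z, drop (length qs) z)) ` reg_basis B (qs @ rs) \<subseteq> reg_basis B qs \<times> reg_basis B rs"
    by (auto simp: reg_basis_def list_all2_append1)
qed (auto simp: length_reg_basis)

text \<open>The matrix of \<Sum> |\<phi> i\<rangle>\<langle>\<phi> i| \<otimes> U i, where the first
  \<open>length qs\<close> entries of a list belong to the control.\<close>

definition ctrl_op :: "'q list \<Rightarrow> nat \<Rightarrow> (nat \<Rightarrow> 'b list vec) \<Rightarrow> (nat \<Rightarrow> 'b list op) \<Rightarrow> 'b list op" where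
  "ctrl_op qs d \<phi> U = (\<lambda>x y. \<Sum>i=1..d. \<phi> i (take (length qs) x) * cnj (\<phi> i (take (length qs) y)) *
     U i (drop (length qs) x) (drop (length qs) y))"

text \<open>A single intermediate configuration survives: on \<open>qs\<close> it must carry the
  labels of \<tau>, since the right factor leaves them alone, and elsewhere those of \<sigma>, since
  the left factor does.\<close>

lemma mult_ext_disjoint:
  assumes "set qs \<inter> set rs = {}"
  shows "mult (ext B qs A) (ext B rs U) \<sigma> \<tau> =
    (if \<sigma> \<in> conf B \<and> \<tau> \<in> conf B \<and> (\<forall>q. q \<notin> set qs \<union> set rs \<longrightarrow> \<sigma> q = \<tau> q)
     then A (map \<sigma> qs) (map \<tau> qs) * U (map \<sigma> rs) (map \<tau> rs) else 0)"
proof (cases "\<sigma> \<in> conf B \<and> \<tau> \<in> conf B")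
  case True
  define \<nu> where "\<nu> = (\<lambda>q. if q \<in> set qs then \<tau> q else 0)"
  have \<nu>: "\<nu> \<in> labels B (set qs)" "map \<nu> qs = map \<tau> qs"
    using True by (auto simp: \<nu>_def labels_def conf_def)
  have "ext B rs U (override_on \<sigma> \<nu>' (set qs)) \<tau> = 0"
    if "\<nu>' \<in> labels B (set qs)" "\<nu>' \<noteq> \<nu>" for \<nu>'
  proof -
    have "map \<nu>' qs \<noteq> map \<tau> qs"
      using that map_labels_eq_iff[OF that(1) \<nu>(1)] \<nu>(2) by simp
    then obtain q where q: "q \<in> set qs" "\<nu>' q \<noteq> \<tau> q" by auto
    then have "q \<notin> set rs" "override_on \<sigma> \<nu>' (set qs) q \<noteq> \<tau> q"
      using assms by auto
    then show ?thesis unfolding ext_def by meson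
  qed
  then have "(\<Sum>\<^sub>\<infinity>\<nu>\<in>labels B (set qs). A (map \<sigma> qs) (map \<nu> qs) * ext B rs U (override_on \<sigma> \<nu> (set qs)) \<tau>)
    = A (map \<sigma> qs) (map \<nu> qs) * ext B rs U (override_on \<sigma> \<nu> (set qs)) \<tau>"
    using \<nu>(1) by (intro infsum_single_point) simp_all
  then have "mult (ext B qs A) (ext B rs U) \<sigma> \<tau> =
      A (map \<sigma> qs) (map \<tau> qs) * ext B rs U (override_on \<sigma> \<nu> (set qs)) \<tau>"
    using True \<nu>(2) by (simp add: mult_ext del: map_eq_conv)
  moreover have "(\<forall>q. q \<notin> set rs \<longrightarrow> override_on \<sigma> \<nu> (set qs) q = \<tau> q) \<longleftrightarrow>
      (\<forall>q. q \<notin> set qs \<union> set rs \<longrightarrow> \<sigma> q = \<tau> q)"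
    by (auto simp: override_on_def \<nu>_def)
  moreover have "map (override_on \<sigma> \<nu> (set qs)) rs = map \<sigma> rs"
    using assms by (intro map_override_on_disjoint) auto
  moreover have "override_on \<sigma> \<nu> (set qs) \<in> conf B"
    using True \<nu> by (intro override_in_conf) auto
  ultimately show ?thesis
    using True by (simp only: ext_def simp_thms mult_zero_right split: if_split) blast
next
  case False
  then show ?thesis unfolding mult_ext by (auto simp: ext_def)
qed

lemma sum_if: "(\<Sum>x\<in>A. if P then f x else 0) = (if P then sum f A else 0)"
  by simp

lemma circ_sem_CQif_ext:
  assumes "set qs \<inter> set rs = {}" "\<And>i. i \<in> {1..d} \<Longrightarrow> circ_sem B (C i) = ext B rs (U i)"
  shows "circ_sem B (CQif qs d \<phi> C) = ext B (qs @ rs) (ctrl_op qs d \<phi> U)"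
proof (intro HOL.ext)
  fix \<sigma> \<tau>
  have "circ_sem B (CQif qs d \<phi> C) \<sigma> \<tau> =
    (\<Sum>i=1..d. mult (ext B qs (ketbra (\<phi> i) (\<phi> i))) (ext B rs (U i)) \<sigma> \<tau>)"
    by (simp add: assms(2))
  also have "\<dots> = ext B (qs @ rs) (ctrl_op qs d \<phi> U) \<sigma> \<tau>"
    unfolding mult_ext_disjoint[OF assms(1)] sum_if by (auto simp: ext_def ctrl_op_def ketbra_def)
  finally show "circ_sem B (CQif qs d \<phi> C) \<sigma> \<tau> = ext B (qs @ rs) (ctrl_op qs d \<phi> U) \<sigma> \<tau>" .
qed

lemma ctrl_op_outside:
  assumes "\<And>i. i \<in> {1..d} \<Longrightarrow> \<phi> i \<in> hilb (reg_basis B qs)"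
    "\<And>i x y. i \<in> {1..d} \<Longrightarrow> y \<notin> reg_basis B rs \<Longrightarrow> U i x y = 0" "y \<notin> reg_basis B (qs @ rs)"
  shows "ctrl_op qs d \<phi> U x y = 0"
proof -
  have "take (length qs) y \<notin> reg_basis B qs \<or> drop (length qs) y \<notin> reg_basis B rs"
    using assms(3) list_all2_appendI[of "\<lambda>q x. x \<in> B q" qs "take (length qs) y" rs "drop (length qs) y"]
    by (auto simp: reg_basis_def)
  then show ?thesis
    unfolding ctrl_op_def
    by (intro sum.neutral ballI) (use assms(1,2) hilbD in \<open>fastforce\<close>)
qed

text \<open>Splitting a list into its two halves factorises each summand. The control half yields
  \<langle>\<phi> i|\<phi> j\<rangle>, which leaves only \<open>i = j\<close>; the other half yields
  \<open>app (U i) (\<psi> j)\<close>.\<close>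

lemma app_ctrl_op:
  assumes orth: "\<And>i j. i \<in> {1..d} \<Longrightarrow> j \<in> {1..d} \<Longrightarrow> braket (\<phi> i) (\<phi> j) = (if i = j then 1 else 0)"
    and \<phi>: "\<And>i. i \<in> {1..d} \<Longrightarrow> \<phi> i \<in> hilb (reg_basis B qs)"
    and \<psi>: "\<And>i. i \<in> {1..d} \<Longrightarrow> \<psi> i \<in> hilb (reg_basis B rs)"
    and U: "\<And>i. i \<in> {1..d} \<Longrightarrow> unitary_op (reg_basis B rs) (U i)"
  shows "app (ctrl_op qs d \<phi> U) (\<lambda>x. \<Sum>i=1..d. c i * tensor qs (\<phi> i) (\<psi> i) x) x =
    (\<Sum>i=1..d. c i * tensor qs (\<phi> i) (app (U i) (\<psi> i)) x)"
proof -
  let ?n = "length qs"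
  let ?X = "reg_basis B qs" and ?Y = "reg_basis B rs"
  let ?\<chi> = "\<lambda>x. \<Sum>i=1..d. c i * tensor qs (\<phi> i) (\<psi> i) x"
  \<comment> \<open>The contribution of the projector with index \<open>i\<close> applied to the
    component with index \<open>j\<close> of the initial vector.\<close>
  define t where "t i j = \<phi> i (take ?n x) * c j * ((\<Sum>\<^sub>\<infinity>y\<in>?X. cnj (\<phi> i y) * \<phi> j y) *
    (\<Sum>\<^sub>\<infinity>y\<in>?Y. U i (drop ?n x) y * \<psi> j y))" for i j
  have Uz: "y \<notin> ?Y \<Longrightarrow> U i x y = 0" if "i \<in> {1..d}" for i x y
    using U[OF that] by (auto simp: unitary_op_def bounded_op_def)
  have "((\<lambda>(y\<^sub>1, y\<^sub>2). \<phi> i (take ?n x) * c j * ((cnj (\<phi> i y\<^sub>1) * \<phi> j y\<^sub>1) * (U i (drop ?n x) y\<^sub>2 * \<psi> j y\<^sub>2))) has_sum t i j)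
      (?X \<times> ?Y)" if "i \<in> {1..d}" "j \<in> {1..d}" for i j
  proof -
    have "(\<lambda>y. norm (cnj (\<phi> i y) * \<phi> j y)) summable_on ?X"
      by (rule ell2_mult_summable)
        (use hilb_summable[OF \<phi>[OF that(1)]] hilb_summable[OF \<phi>[OF that(2)]] in simp_all)
    moreover have "(\<lambda>y. norm (U i (drop ?n x) y * \<psi> j y)) summable_on ?Y"
      by (rule ell2_mult_summable) (use \<psi> U that in \<open>auto intro: hilb_summable unitary_row_ell2\<close>)
    ultimately show ?thesis
      unfolding t_def case_prod_unfold
      by (intro has_sum_cmult_right has_sum_Times_mult[unfolded case_prod_unfold])
  qed
  then have "((\<lambda>p. \<Sum>i=1..d. \<Sum>j=1..d. (\<lambda>(y\<^sub>1, y\<^sub>2). \<phi> i (take ?n x) * c j * ((cnj (\<phi> i y\<^sub>1) * \<phi> j y\<^sub>1) * (U i (drop ?n x) y\<^sub>2 * \<psi> j y\<^sub>2))) p)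
      has_sum (\<Sum>i=1..d. \<Sum>j=1..d. t i j)) (?X \<times> ?Y)"
    by (intro has_sum_finite_sum) auto
  moreover have "(\<Sum>i=1..d. \<Sum>j=1..d. (\<lambda>(y\<^sub>1, y\<^sub>2). \<phi> i (take ?n x) * c j * ((cnj (\<phi> i y\<^sub>1) * \<phi> j y\<^sub>1) * (U i (drop ?n x) y\<^sub>2 * \<psi> j y\<^sub>2))) p)
      = ctrl_op qs d \<phi> U x ((\<lambda>(x, y). x @ y) p) * ?\<chi> ((\<lambda>(x, y). x @ y) p)" if "p \<in> ?X \<times> ?Y" for p
    using that
    by (auto simp: ctrl_op_def tensor_def length_reg_basis sum_product intro!: sum.cong)
  ultimately have "((\<lambda>p. ctrl_op qs d \<phi> U x ((\<lambda>(x, y). x @ y) p) * ?\<chi> ((\<lambda>(x, y). x @ y) p))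
      has_sum (\<Sum>i=1..d. \<Sum>j=1..d. t i j)) (?X \<times> ?Y)"
    by (subst has_sum_cong) (auto elim!: has_sum_cong[THEN iffD1, rotated])
  then have "((\<lambda>y. ctrl_op qs d \<phi> U x y * ?\<chi> y) has_sum (\<Sum>i=1..d. \<Sum>j=1..d. t i j)) (reg_basis B (qs @ rs))"
    using has_sum_reindex_bij_betw[OF reg_basis_append[of B qs rs], of "\<lambda>y. ctrl_op qs d \<phi> U x y * ?\<chi> y"] by simp
  moreover have "app (ctrl_op qs d \<phi> U) ?\<chi> x = (\<Sum>\<^sub>\<infinity>y\<in>reg_basis B (qs @ rs). ctrl_op qs d \<phi> U x y * ?\<chi> y)"
    unfolding app_def
    by (rule infsum_cong_neutral) (use ctrl_op_outside[of d \<phi> B qs rs U] \<phi> Uz in auto)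
  ultimately have "app (ctrl_op qs d \<phi> U) ?\<chi> x = (\<Sum>i=1..d. \<Sum>j=1..d. t i j)"
    by (simp add: infsumI)
  also have "\<dots> = (\<Sum>i=1..d. \<Sum>j=1..d. if i = j then c i * tensor qs (\<phi> i) (app (U i) (\<psi> i)) x else 0)"
  proof (intro sum.cong refl)
    fix i j assume ij: "i \<in> {1..d}" "j \<in> {1..d}"
    have "(\<Sum>\<^sub>\<infinity>y\<in>?X. cnj (\<phi> i y) * \<phi> j y) = braket (\<phi> i) (\<phi> j)"
      unfolding braket_def by (rule infsum_cong_neutral) (use hilbD[OF \<phi>[OF ij(1)]] in auto)
    moreover have "(\<Sum>\<^sub>\<infinity>y\<in>?Y. U i (drop ?n x) y * \<psi> j y) = app (U i) (\<psi> j) (drop ?n x)"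
      unfolding app_def by (rule infsum_cong_neutral) (use Uz[OF ij(1)] in auto)
    ultimately show "t i j = (if i = j then c i * tensor qs (\<phi> i) (app (U i) (\<psi> i)) x else 0)"
      by (simp add: t_def orth[OF ij] tensor_def)
  qed
  also have "\<dots> = (\<Sum>i=1..d. c i * tensor qs (\<phi> i) (app (U i) (\<psi> i)) x)"
    by (simp add: sum.delta)
  finally show ?thesis .
qed

lemma law_qif_tensor:
  assumes "distinct (qs @ rs)" "orthonormal_basis (reg_basis B qs) d \<phi>"
    and \<psi>: "\<And>i. i \<in> {1..d} \<Longrightarrow> \<psi> i \<in> hilb (reg_basis B rs)"
    and U: "\<And>i. i \<in> {1..d} \<Longrightarrow> unitary_op (reg_basis B rs) (U i)"
    and C: "\<And>i. i \<in> {1..d} \<Longrightarrow> circ_sem B (C i) = ext B rs (U i)"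
  shows "B \<turnstile> PInit (qs @ rs) (\<lambda>x. \<Sum>i=1..d. c i * tensor qs (\<phi> i) (\<psi> i) x) ;; PCirc (CQif qs d \<phi> C)
    \<approx> PInit (qs @ rs) (\<lambda>x. \<Sum>i=1..d. c i * tensor qs (\<phi> i) (app (U i) (\<psi> i)) x)"
proof (rule prog_equivI)
  fix \<rho>
  have disj: "set qs \<inter> set rs = {}" using assms(1) by auto
  have \<phi>: "\<And>i. i \<in> {1..d} \<Longrightarrow> \<phi> i \<in> hilb (reg_basis B qs)"
    and orth: "\<And>i j. i \<in> {1..d} \<Longrightarrow> j \<in> {1..d} \<Longrightarrow> braket (\<phi> i) (\<phi> j) = (if i = j then 1 else 0)"
    using assms(2) unfolding orthonormal_basis_def by blast+
  have Uz: "U i x y = 0" if "i \<in> {1..d}" "y \<notin> reg_basis B rs" for i x y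
    using U[OF that(1)] that(2) by (auto simp: unitary_op_def bounded_op_def)
  have Q: "circ_sem B (CQif qs d \<phi> C) = ext B (qs @ rs) (ctrl_op qs d \<phi> U)"
    by (rule circ_sem_CQif_ext[OF disj C])
  have outside: "ctrl_op qs d \<phi> U x y = 0" if "y \<notin> reg_basis B (qs @ rs)" for x y
    by (rule ctrl_op_outside[OF \<phi> Uz that])
  have app: "app (ctrl_op qs d \<phi> U) (\<lambda>x. \<Sum>i=1..d. c i * tensor qs (\<phi> i) (\<psi> i) x) =
      (\<lambda>x. \<Sum>i=1..d. c i * tensor qs (\<phi> i) (app (U i) (\<psi> i)) x)"
    by (intro HOL.ext app_ctrl_op[OF orth \<phi> \<psi> U])
  show "sem B (PInit (qs @ rs) (\<lambda>x. \<Sum>i=1..d. c i * tensor qs (\<phi> i) (\<psi> i) x) ;; PCirc (CQif qs d \<phi> C)) \<rho>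
    = sem B (PInit (qs @ rs) (\<lambda>x. \<Sum>i=1..d. c i * tensor qs (\<phi> i) (app (U i) (\<psi> i)) x)) \<rho>"
    unfolding sem.simps(4,5) o_apply sem_PInit[OF assms(1)] Q
    by (subst sandwich_ext_init_op[OF assms(1) _ blind_ptrace]) (rule outside, assumption, simp only: app)
qed

section \<open>Circuits are bounded operators\<close>

text \<open>Boundedness as an estimate of the bilinear form on finite sets, with the same finite set
  for both arguments. No infinite sum occurs, the constant survives adjoints and extensions, and
  square-summable rows and columns follow at once.\<close>

definition bdd_by :: "'x op \<Rightarrow> real \<Rightarrow> bool" where
  "bdd_by A c \<longleftrightarrow> 0 \<le> c \<and> (\<forall>F w v. finite F \<longrightarrow>
     cmod (\<Sum>x\<in>F. \<Sum>y\<in>F. w x * A x y * v y) \<le>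
       c * L2_set (\<lambda>x. cmod (w x)) F * L2_set (\<lambda>x. cmod (v x)) F)"

lemma bdd_byI:
  assumes "0 \<le> c" "\<And>F w v. finite F \<Longrightarrow> cmod (\<Sum>x\<in>F. \<Sum>y\<in>F. w x * A x y * v y) \<le>
       c * L2_set (\<lambda>x. cmod (w x)) F * L2_set (\<lambda>x. cmod (v x)) F"
  shows "bdd_by A c"
  using assms by (simp add: bdd_by_def)

lemma bdd_by_nonneg: "bdd_by A c \<Longrightarrow> 0 \<le> c"
  by (simp add: bdd_by_def)

lemma L2_set_mono_set: "finite G \<Longrightarrow> F \<subseteq> G \<Longrightarrow> L2_set f F \<le> L2_set f G"
  unfolding L2_set_def by (intro real_sqrt_le_mono sum_mono2) auto

lemma L2_set_power2: "(L2_set f F)\<^sup>2 = (\<Sum>x\<in>F. (f x)\<^sup>2)"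
  by (simp add: L2_set_def sum_nonneg)

lemma bdd_byD:
  assumes "bdd_by A c" "finite F" "finite G"
  shows "cmod (\<Sum>x\<in>F. \<Sum>y\<in>G. w x * A x y * v y) \<le>
       c * L2_set (\<lambda>x. cmod (w x)) F * L2_set (\<lambda>x. cmod (v x)) G"
proof -
  define w' v' where "w' = (\<lambda>x. if x \<in> F then w x else 0)" and "v' = (\<lambda>x. if x \<in> G then v x else 0)"
  have "(\<Sum>x\<in>F. \<Sum>y\<in>G. w x * A x y * v y) = (\<Sum>x\<in>F \<union> G. \<Sum>y\<in>F \<union> G. w' x * A x y * v' y)"
  proof (rule sum.mono_neutral_cong_left)
    show "(\<Sum>y\<in>G. w x * A x y * v y) = (\<Sum>y\<in>F \<union> G. w' x * A x y * v' y)" if "x \<in> F" for x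
      using assms that by (intro sum.mono_neutral_cong_left) (auto simp: w'_def v'_def)
  qed (use assms in \<open>auto simp: w'_def\<close>)
  moreover have "L2_set (\<lambda>x. cmod (w' x)) (F \<union> G) = L2_set (\<lambda>x. cmod (w x)) F"
    unfolding L2_set_def using assms
    by (intro arg_cong[of _ _ sqrt] sum.mono_neutral_cong_right) (auto simp: w'_def)
  moreover have "L2_set (\<lambda>x. cmod (v' x)) (F \<union> G) = L2_set (\<lambda>x. cmod (v x)) G"
    unfolding L2_set_def using assms
    by (intro arg_cong[of _ _ sqrt] sum.mono_neutral_cong_right) (auto simp: v'_def)
  moreover have "cmod (\<Sum>x\<in>F \<union> G. \<Sum>y\<in>F \<union> G. w' x * A x y * v' y) \<le>
      c * L2_set (\<lambda>x. cmod (w' x)) (F \<union> G) * L2_set (\<lambda>x. cmod (v' x)) (F \<union> G)"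
    using assms unfolding bdd_by_def by (meson finite_UnI)
  ultimately show ?thesis by simp
qed

lemma bdd_by_adj:
  assumes "bdd_by A c"
  shows "bdd_by (adj A) c"
proof (rule bdd_byI)
  fix F :: "'a set" and w v :: "'a \<Rightarrow> complex" assume F: "finite F"
  have "(\<Sum>x\<in>F. \<Sum>y\<in>F. w x * adj A x y * v y) = cnj (\<Sum>x\<in>F. \<Sum>y\<in>F. cnj (v x) * A x y * cnj (w y))"
    by (subst sum.swap) (simp add: adj_def mult_ac)
  then have "cmod (\<Sum>x\<in>F. \<Sum>y\<in>F. w x * adj A x y * v y) = cmod (\<Sum>x\<in>F. \<Sum>y\<in>F. cnj (v x) * A x y * cnj (w y))"
    by (simp only: complex_mod_cnj)
  also have "\<dots> \<le> c * L2_set (\<lambda>x. cmod (cnj (v x))) F * L2_set (\<lambda>x. cmod (cnj (w x))) F"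
    by (rule bdd_byD[OF assms F F])
  finally show "cmod (\<Sum>x\<in>F. \<Sum>y\<in>F. w x * adj A x y * v y)
      \<le> c * L2_set (\<lambda>x. cmod (w x)) F * L2_set (\<lambda>x. cmod (v x)) F"
    by (simp add: mult_ac)
qed (rule bdd_by_nonneg[OF assms])

lemma le_if_square_le:
  assumes "0 \<le> b" "(a::real)\<^sup>2 \<le> b * a"
  shows "a \<le> b"
proof (cases "a \<le> 0")
  case False
  then show ?thesis using assms(2) by (simp add: power2_eq_square)
qed (use assms in simp)

text \<open>Duality: testing against the conjugate of the vector \<open>?X\<close> itself bounds its
  squared norm by \<open>c\<close> times the norm of \<open>w\<close> times the norm of
  \<open>?X\<close>, and one factor cancels.\<close>

lemma bdd_by_left:
  assumes "bdd_by A c" "finite F" "finite Z"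
  shows "L2_set (\<lambda>z. cmod (\<Sum>x\<in>F. w x * A x z)) Z \<le> c * L2_set (\<lambda>x. cmod (w x)) F"
proof -
  let ?X = "\<lambda>z. \<Sum>x\<in>F. w x * A x z"
  have "complex_of_real ((L2_set (\<lambda>z. cmod (?X z)) Z)\<^sup>2) = (\<Sum>z\<in>Z. ?X z * cnj (?X z))"
    by (simp only: L2_set_power2 of_real_sum complex_norm_square)
  also have "\<dots> = (\<Sum>x\<in>F. \<Sum>z\<in>Z. w x * A x z * cnj (?X z))"
    by (subst sum.swap) (simp only: sum_distrib_right)
  finally have eq: "complex_of_real ((L2_set (\<lambda>z. cmod (?X z)) Z)\<^sup>2) = (\<Sum>x\<in>F. \<Sum>z\<in>Z. w x * A x z * cnj (?X z))" .
  have "(L2_set (\<lambda>z. cmod (?X z)) Z)\<^sup>2 = cmod (\<Sum>x\<in>F. \<Sum>z\<in>Z. w x * A x z * cnj (?X z))"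
    unfolding eq[symmetric] norm_of_real abs_power2 ..
  also have "\<dots> \<le> c * L2_set (\<lambda>x. cmod (w x)) F * L2_set (\<lambda>z. cmod (cnj (?X z))) Z"
    by (rule bdd_byD[OF assms])
  also have "\<dots> = c * L2_set (\<lambda>x. cmod (w x)) F * L2_set (\<lambda>z. cmod (?X z)) Z"
    by (simp only: complex_mod_cnj)
  finally show ?thesis
    by (rule le_if_square_le[rotated]) (simp add: bdd_by_nonneg[OF assms(1)])
qed

lemma bdd_by_right:
  assumes "bdd_by A c" "finite F" "finite Z"
  shows "L2_set (\<lambda>z. cmod (\<Sum>y\<in>F. A z y * v y)) Z \<le> c * L2_set (\<lambda>x. cmod (v x)) F"
proof -
  have "cmod (\<Sum>y\<in>F. A z y * v y) = cmod (\<Sum>y\<in>F. cnj (v y) * adj A y z)" for z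
  proof -
    have "(\<Sum>y\<in>F. A z y * v y) = cnj (\<Sum>y\<in>F. cnj (v y) * adj A y z)"
      by (simp add: adj_def mult.commute)
    then show ?thesis by (simp only: complex_mod_cnj)
  qed
  then show ?thesis
    using bdd_by_left[OF bdd_by_adj[OF assms(1)] assms(2,3), of "\<lambda>y. cnj (v y)"] by simp
qed

lemma bdd_by_row:
  assumes "bdd_by A c"
  shows "(\<lambda>y. (cmod (A x y))\<^sup>2) summable_on Y"
proof (rule nonneg_bdd_above_summable_on)
  show "bdd_above (sum (\<lambda>y. (cmod (A x y))\<^sup>2) ` {F. F \<subseteq> Y \<and> finite F})"
  proof (rule bdd_aboveI2)
    fix F assume "F \<in> {F. F \<subseteq> Y \<and> finite F}"
    then have "L2_set (\<lambda>z. cmod (A x z)) F \<le> c"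
      using bdd_by_left[OF assms, of "{x}" F "\<lambda>_. 1"] by simp
    then have "(L2_set (\<lambda>z. cmod (A x z)) F)\<^sup>2 \<le> c\<^sup>2"
      by (intro power_mono) auto
    then show "(\<Sum>y\<in>F. (cmod (A x y))\<^sup>2) \<le> c\<^sup>2" by (simp add: L2_set_power2)
  qed
qed simp

lemma bdd_by_column:
  assumes "bdd_by A c"
  shows "(\<lambda>x. (cmod (A x y))\<^sup>2) summable_on X"
  using bdd_by_row[OF bdd_by_adj[OF assms], of y X] by (simp add: adj_def)

lemma has_sum_norm_le:
  fixes f :: "'a \<Rightarrow> 'b::real_normed_vector"
  assumes "(f has_sum s) A" "\<And>F. finite F \<Longrightarrow> F \<subseteq> A \<Longrightarrow> norm (sum f F) \<le> b"
  shows "norm s \<le> b"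
proof (rule tendsto_upperbound)
  show "((\<lambda>F. norm (sum f F)) \<longlongrightarrow> norm s) (finite_subsets_at_top A)"
    using assms(1) unfolding has_sum_def by (rule tendsto_norm)
  show "\<forall>\<^sub>F F in finite_subsets_at_top A. norm (sum f F) \<le> b"
    by (rule eventually_finite_subsets_at_top_weakI) (use assms(2) in auto)
qed simp

text \<open>Since \<open>w\<close> and \<open>v\<close> range over finite sets, their sums move
  inside the sum over the intermediate index \<open>z\<close>, which becomes a pairing of
  \<open>?X\<close> with \<open>?Y\<close>. The finite partial sums of that pairing obey the
  Cauchy-Schwarz inequality, and the bound passes to the limit.\<close>

lemma bdd_by_mult:
  assumes "bdd_by A c" "bdd_by A' c'"
  shows "bdd_by (mult A A') (c * c')"
proof (rule bdd_byI)
  fix F :: "'a set" and w v :: "'a \<Rightarrow> complex" assume F: "finite F"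
  let ?X = "\<lambda>z. \<Sum>x\<in>F. w x * A x z" and ?Y = "\<lambda>z. \<Sum>y\<in>F. A' z y * v y"
  have "((\<lambda>z. A x z * A' z y) has_sum mult A A' x y) UNIV" for x y
    unfolding mult_def
    by (rule has_sum_infsum, rule abs_summable_summable, rule ell2_mult_summable)
      (rule bdd_by_row[OF assms(1)], rule bdd_by_column[OF assms(2)])
  then have "((\<lambda>z. \<Sum>x\<in>F. \<Sum>y\<in>F. w x * (A x z * A' z y) * v y) has_sum
      (\<Sum>x\<in>F. \<Sum>y\<in>F. w x * mult A A' x y * v y)) UNIV"
    by (intro has_sum_finite_sum has_sum_cmult_left has_sum_cmult_right)
  moreover have "(\<Sum>x\<in>F. \<Sum>y\<in>F. w x * (A x z * A' z y) * v y) = ?X z * ?Y z" for z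
    unfolding sum_product by (intro sum.cong refl) (simp only: mult_ac)
  ultimately have "((\<lambda>z. ?X z * ?Y z) has_sum (\<Sum>x\<in>F. \<Sum>y\<in>F. w x * mult A A' x y * v y)) UNIV"
    by simp
  then show "cmod (\<Sum>x\<in>F. \<Sum>y\<in>F. w x * mult A A' x y * v y)
      \<le> c * c' * L2_set (\<lambda>x. cmod (w x)) F * L2_set (\<lambda>x. cmod (v x)) F"
  proof (rule has_sum_norm_le)
    fix Z :: "'a set" assume Z: "finite Z"
    have "cmod (\<Sum>z\<in>Z. ?X z * ?Y z) \<le> (\<Sum>z\<in>Z. \<bar>cmod (?X z)\<bar> * \<bar>cmod (?Y z)\<bar>)"
      by (rule order_trans[OF norm_sum]) (simp add: norm_mult)
    also have "\<dots> \<le> L2_set (\<lambda>z. cmod (?X z)) Z * L2_set (\<lambda>z. cmod (?Y z)) Z"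
      by (rule L2_set_mult_ineq)
    also have "\<dots> \<le> (c * L2_set (\<lambda>x. cmod (w x)) F) * (c' * L2_set (\<lambda>x. cmod (v x)) F)"
      by (intro mult_mono bdd_by_left[OF assms(1) F Z] bdd_by_right[OF assms(2) F Z])
        (simp_all add: bdd_by_nonneg[OF assms(1)])
    finally show "cmod (\<Sum>z\<in>Z. ?X z * ?Y z) \<le> c * c' * L2_set (\<lambda>x. cmod (w x)) F * L2_set (\<lambda>x. cmod (v x)) F"
      by (simp add: mult_ac)
  qed
qed (simp add: bdd_by_nonneg[OF assms(1)] bdd_by_nonneg[OF assms(2)])

lemma bdd_by_sum:
  fixes A :: "'i \<Rightarrow> 'a op"
  assumes "\<And>i. i \<in> I \<Longrightarrow> bdd_by (A i) (c i)"
  shows "bdd_by (\<lambda>x y. \<Sum>i\<in>I. A i x y) (\<Sum>i\<in>I. c i)"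
proof (rule bdd_byI)
  fix F :: "'a set" and w v :: "'a \<Rightarrow> complex" assume F: "finite F"
  let ?b = "\<lambda>i. \<Sum>x\<in>F. \<Sum>y\<in>F. w x * A i x y * v y"
  have "(\<Sum>x\<in>F. \<Sum>y\<in>F. w x * (\<Sum>i\<in>I. A i x y) * v y) = (\<Sum>x\<in>F. \<Sum>y\<in>F. \<Sum>i\<in>I. w x * A i x y * v y)"
    by (simp add: sum_distrib_left sum_distrib_right)
  also have "\<dots> = (\<Sum>x\<in>F. \<Sum>i\<in>I. \<Sum>y\<in>F. w x * A i x y * v y)"
    by (intro sum.cong refl sum.swap)
  also have "\<dots> = (\<Sum>i\<in>I. ?b i)" by (rule sum.swap)
  also have "cmod \<dots> \<le> (\<Sum>i\<in>I. c i * L2_set (\<lambda>x. cmod (w x)) F * L2_set (\<lambda>x. cmod (v x)) F)"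
    by (rule order_trans[OF norm_sum], rule sum_mono, rule bdd_byD[OF assms F F])
  finally show "cmod (\<Sum>x\<in>F. \<Sum>y\<in>F. w x * (\<Sum>i\<in>I. A i x y) * v y)
    \<le> (\<Sum>i\<in>I. c i) * L2_set (\<lambda>x. cmod (w x)) F * L2_set (\<lambda>x. cmod (v x)) F"
    by (simp add: sum_distrib_right)
qed (intro sum_nonneg bdd_by_nonneg[OF assms])

lemma bdd_by_id: "bdd_by (id_op X) 1"
proof (rule bdd_byI)
  fix F :: "'a set" and w v :: "'a \<Rightarrow> complex" assume F: "finite F"
  have "(\<Sum>x\<in>F. \<Sum>y\<in>F. w x * id_op X x y * v y) = (\<Sum>x\<in>F. if x \<in> X then w x * v x else 0)"
  proof (rule sum.cong)
    fix x assume "x \<in> F"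
    have "(\<Sum>y\<in>F. w x * id_op X x y * v y) = (\<Sum>y\<in>F. if x = y then (if x \<in> X then w x * v x else 0) else 0)"
      by (rule sum.cong) (auto simp: id_op_def)
    then show "(\<Sum>y\<in>F. w x * id_op X x y * v y) = (if x \<in> X then w x * v x else 0)"
      using F \<open>x \<in> F\<close> by (simp add: sum.delta)
  qed simp
  also have "cmod \<dots> \<le> (\<Sum>x\<in>F. \<bar>cmod (w x)\<bar> * \<bar>cmod (v x)\<bar>)"
    by (rule order_trans[OF norm_sum], rule sum_mono) (simp add: norm_mult)
  also have "\<dots> \<le> L2_set (\<lambda>x. cmod (w x)) F * L2_set (\<lambda>x. cmod (v x)) F"
    by (rule L2_set_mult_ineq)
  finally show "cmod (\<Sum>x\<in>F. \<Sum>y\<in>F. w x * id_op X x y * v y)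
    \<le> 1 * L2_set (\<lambda>x. cmod (w x)) F * L2_set (\<lambda>x. cmod (v x)) F" by simp
qed simp

section \<open>Bounds for concrete operators and for circuits\<close>

lemma L2_set_le_vnorm:
  assumes "v \<in> hilb X" "finite F"
  shows "L2_set (\<lambda>x. cmod (v x)) F \<le> vnorm v"
  unfolding L2_set_def vnorm_def
  by (intro real_sqrt_le_mono finite_sum_le_infsum hilb_summable[OF assms(1)] assms(2)) auto

lemma bdd_by_bounded_op:
  assumes "bounded_op X A"
  shows "\<exists>c. bdd_by A c"
proof -
  from assms obtain c where
    c: "\<And>v. v \<in> hilb X \<Longrightarrow> app A v \<in> hilb X \<and> vnorm (app A v) \<le> c * vnorm v"
    unfolding bounded_op_def by blast
  have z: "A x y = 0" if "x \<notin> X \<or> y \<notin> X" for x y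
    using assms that unfolding bounded_op_def by blast
  \<comment> \<open>The constant in \<open>bounded_op\<close> carries no sign, while
    \<open>bdd_by\<close> demands a nonnegative one.\<close>
  have "bdd_by A \<bar>c\<bar>"
  proof (rule bdd_byI)
    fix F :: "'a set" and w v :: "'a \<Rightarrow> complex" assume F: "finite F"
    define v' where "v' = (\<lambda>x. if x \<in> F \<inter> X then v x else 0)"
    have v': "v' \<in> hilb X"
      by (rule hilb_finite_support[of "F \<inter> X"]) (auto simp: v'_def F)
    have "vnorm v' = L2_set (\<lambda>x. cmod (v x)) (F \<inter> X)"
    proof -
      have "(\<Sum>\<^sub>\<infinity>x. (cmod (v' x))\<^sup>2) = (\<Sum>\<^sub>\<infinity>x\<in>F \<inter> X. (cmod (v x))\<^sup>2)"
        by (rule infsum_cong_neutral) (auto simp: v'_def)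
      then show ?thesis using F by (simp add: vnorm_def L2_set_def)
    qed
    also have "\<dots> \<le> L2_set (\<lambda>x. cmod (v x)) F"
      by (rule L2_set_mono_set) (use F in auto)
    finally have nv: "vnorm v' \<le> L2_set (\<lambda>x. cmod (v x)) F" .
    have vn: "0 \<le> vnorm v'" by (simp add: vnorm_def infsum_nonneg)
    have "(\<Sum>x\<in>F. \<Sum>y\<in>F. w x * A x y * v y) = (\<Sum>x\<in>F. w x * app A v' x)"
    proof (intro sum.cong refl)
      fix x
      have "app A v' x = (\<Sum>y\<in>F. A x y * v' y)"
        by (rule app_finite_support[OF F]) (simp add: v'_def)
      then show "(\<Sum>y\<in>F. w x * A x y * v y) = w x * app A v' x"
        by (auto simp: sum_distrib_left v'_def z intro!: sum.cong)
    qed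
    also have "cmod \<dots> \<le> (\<Sum>x\<in>F. \<bar>cmod (w x)\<bar> * \<bar>cmod (app A v' x)\<bar>)"
      by (rule order_trans[OF norm_sum]) (simp add: norm_mult)
    also have "\<dots> \<le> L2_set (\<lambda>x. cmod (w x)) F * L2_set (\<lambda>x. cmod (app A v' x)) F"
      by (rule L2_set_mult_ineq)
    also have "\<dots> \<le> L2_set (\<lambda>x. cmod (w x)) F * (\<bar>c\<bar> * L2_set (\<lambda>x. cmod (v x)) F)"
    proof (rule mult_left_mono)
      have "L2_set (\<lambda>x. cmod (app A v' x)) F \<le> vnorm (app A v')"
        using c[OF v'] F by (intro L2_set_le_vnorm[of _ X]) auto
      also have "\<dots> \<le> c * vnorm v'" using c[OF v'] by simp
      also have "\<dots> \<le> \<bar>c\<bar> * vnorm v'" using vn by (intro mult_right_mono) auto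
      also have "\<dots> \<le> \<bar>c\<bar> * L2_set (\<lambda>x. cmod (v x)) F" using nv by (intro mult_left_mono) auto
      finally show "L2_set (\<lambda>x. cmod (app A v' x)) F \<le> \<bar>c\<bar> * L2_set (\<lambda>x. cmod (v x)) F" .
    qed simp
    finally show "cmod (\<Sum>x\<in>F. \<Sum>y\<in>F. w x * A x y * v y)
      \<le> \<bar>c\<bar> * L2_set (\<lambda>x. cmod (w x)) F * L2_set (\<lambda>x. cmod (v x)) F"
      by (simp add: mult_ac)
  qed simp
  then show ?thesis ..
qed

lemma bdd_by_ketbra:
  assumes "\<phi> \<in> hilb X"
  shows "bdd_by (ketbra \<phi> \<phi>) ((vnorm \<phi>)\<^sup>2)"
proof (rule bdd_byI)
  fix F :: "'a set" and w v :: "'a \<Rightarrow> complex" assume F: "finite F"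
  have b: "cmod (\<Sum>x\<in>F. w x * u x) \<le> L2_set (\<lambda>x. cmod (w x)) F * L2_set (\<lambda>x. cmod (u x)) F" for w u :: "'a \<Rightarrow> complex"
    using L2_set_mult_ineq[of "\<lambda>x. cmod (w x)" "\<lambda>x. cmod (u x)" F]
    by (intro order_trans[OF norm_sum]) (simp add: norm_mult)
  have n: "L2_set (\<lambda>x. cmod (\<phi> x)) F \<le> vnorm \<phi>" by (rule L2_set_le_vnorm[OF assms F])
  have vn: "0 \<le> vnorm \<phi>" by (simp add: vnorm_def infsum_nonneg)
  have "(\<Sum>x\<in>F. \<Sum>y\<in>F. w x * ketbra \<phi> \<phi> x y * v y) = (\<Sum>x\<in>F. w x * \<phi> x) * (\<Sum>y\<in>F. v y * cnj (\<phi> y))"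
    unfolding sum_product ketbra_def by (intro sum.cong refl) (simp only: mult_ac)
  also have "cmod \<dots> \<le> (L2_set (\<lambda>x. cmod (w x)) F * L2_set (\<lambda>x. cmod (\<phi> x)) F) *
      (L2_set (\<lambda>x. cmod (v x)) F * L2_set (\<lambda>x. cmod (cnj (\<phi> x))) F)"
    unfolding norm_mult by (intro mult_mono b) simp_all
  also have "\<dots> \<le> (L2_set (\<lambda>x. cmod (w x)) F * vnorm \<phi>) * (L2_set (\<lambda>x. cmod (v x)) F * vnorm \<phi>)"
    using n vn by (intro mult_mono mult_left_mono) simp_all
  finally show "cmod (\<Sum>x\<in>F. \<Sum>y\<in>F. w x * ketbra \<phi> \<phi> x y * v y)
    \<le> (vnorm \<phi>)\<^sup>2 * L2_set (\<lambda>x. cmod (w x)) F * L2_set (\<lambda>x. cmod (v x)) F"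
    by (simp add: power2_eq_square mult_ac)
qed simp

text \<open>The blocks of \<open>ext B qs A\<close> are indexed by the labels outside \<open>qs\<close>, and each is a submatrix of \<open>A\<close>.\<close>

lemma bdd_by_ext:
  fixes B :: "'a \<Rightarrow> 'b::zero set"
  assumes "bdd_by A c"
  shows "bdd_by (ext B qs A) c"
proof (rule bdd_byI)
  fix F :: "('a \<Rightarrow> 'b) set" and w v :: "('a \<Rightarrow> 'b) \<Rightarrow> complex" assume F: "finite F"
  define H where "H = F \<inter> conf B"
  define key where "key \<sigma> = override_on \<sigma> (\<lambda>_. 0::'b) (set qs)" for \<sigma> :: "'a \<Rightarrow> 'b"
  define K where "K = key ` H"
  define Hk where "Hk k = {\<sigma> \<in> H. key \<sigma> = k}" for k
  have fin: "finite H" "finite K" "finite (Hk k)" for k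
    using F by (auto simp: H_def K_def Hk_def)
  have key: "key \<sigma> = key \<tau> \<longleftrightarrow> (\<forall>q. q \<notin> set qs \<longrightarrow> \<sigma> q = \<tau> q)" for \<sigma> \<tau>
    by (auto simp: key_def override_on_def fun_eq_iff)
  have inj: "inj_on (\<lambda>\<sigma>. map \<sigma> qs) (Hk k)" for k
  proof (rule inj_onI)
    fix \<sigma> \<tau> assume "\<sigma> \<in> Hk k" "\<tau> \<in> Hk k" and m: "map \<sigma> qs = map \<tau> qs"
    then have "\<forall>q. q \<notin> set qs \<longrightarrow> \<sigma> q = \<tau> q" using key[of \<sigma> \<tau>] by (simp add: Hk_def)
    moreover have "\<forall>q\<in>set qs. \<sigma> q = \<tau> q" using m by simp
    ultimately show "\<sigma> = \<tau>" by (intro HOL.ext) blast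
  qed
  have split: "(\<Sum>\<sigma>\<in>H. f \<sigma>) = (\<Sum>k\<in>K. \<Sum>\<sigma>\<in>Hk k. f \<sigma>)" for f :: "('a \<Rightarrow> 'b) \<Rightarrow> 'c::comm_monoid_add"
    unfolding Hk_def K_def by (rule sum.image_gen[OF fin(1)])
  have L2: "L2_set (\<lambda>k. L2_set f (Hk k)) K \<le> L2_set f F" for f
  proof -
    have "(\<Sum>k\<in>K. (L2_set f (Hk k))\<^sup>2) = (\<Sum>\<sigma>\<in>H. (f \<sigma>)\<^sup>2)"
      by (simp only: L2_set_power2 split)
    then have "L2_set (\<lambda>k. L2_set f (Hk k)) K = L2_set f H"
      by (simp only: L2_set_def[of _ K] L2_set_def[of _ H])
    also have "\<dots> \<le> L2_set f F"
      by (rule L2_set_mono_set) (use F in \<open>auto simp: H_def\<close>)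
    finally show ?thesis .
  qed
  have block: "cmod (\<Sum>\<sigma>\<in>Hk k. \<Sum>\<tau>\<in>Hk k. w \<sigma> * A (map \<sigma> qs) (map \<tau> qs) * v \<tau>) \<le>
      c * L2_set (\<lambda>\<sigma>. cmod (w \<sigma>)) (Hk k) * L2_set (\<lambda>\<sigma>. cmod (v \<sigma>)) (Hk k)" for k
  proof -
    let ?m = "\<lambda>\<sigma>. map \<sigma> qs"
    let ?i = "the_inv_into (Hk k) ?m"
    have i: "?i (?m \<sigma>) = \<sigma>" if "\<sigma> \<in> Hk k" for \<sigma>
      by (rule the_inv_into_f_f[OF inj that])
    have "cmod (\<Sum>x\<in>?m ` Hk k. \<Sum>y\<in>?m ` Hk k. w (?i x) * A x y * v (?i y)) \<le>
       c * L2_set (\<lambda>x. cmod (w (?i x))) (?m ` Hk k) * L2_set (\<lambda>x. cmod (v (?i x))) (?m ` Hk k)"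
      by (intro bdd_byD[OF assms] finite_imageI fin)
    then show ?thesis
      by (simp add: sum.reindex[OF inj] L2_set_def o_def i cong: sum.cong)
  qed
  have "(\<Sum>\<sigma>\<in>F. \<Sum>\<tau>\<in>F. w \<sigma> * ext B qs A \<sigma> \<tau> * v \<tau>) =
      (\<Sum>\<sigma>\<in>H. \<Sum>\<tau>\<in>Hk (key \<sigma>). w \<sigma> * A (map \<sigma> qs) (map \<tau> qs) * v \<tau>)"
  proof (rule sum.mono_neutral_cong_right[OF F])
    fix \<sigma> assume "\<sigma> \<in> H"
    then show "(\<Sum>\<tau>\<in>F. w \<sigma> * ext B qs A \<sigma> \<tau> * v \<tau>) =
      (\<Sum>\<tau>\<in>Hk (key \<sigma>). w \<sigma> * A (map \<sigma> qs) (map \<tau> qs) * v \<tau>)"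
      using F by (intro sum.mono_neutral_cong_right) (auto simp: ext_def H_def Hk_def key)
  qed (auto simp: H_def ext_def)
  also have "\<dots> = (\<Sum>k\<in>K. \<Sum>\<sigma>\<in>Hk k. \<Sum>\<tau>\<in>Hk k. w \<sigma> * A (map \<sigma> qs) (map \<tau> qs) * v \<tau>)"
    unfolding split by (intro sum.cong refl) (simp add: Hk_def)
  also have "cmod \<dots> \<le> (\<Sum>k\<in>K. c * L2_set (\<lambda>\<sigma>. cmod (w \<sigma>)) (Hk k) * L2_set (\<lambda>\<sigma>. cmod (v \<sigma>)) (Hk k))"
    by (rule order_trans[OF norm_sum], rule sum_mono, rule block)
  also have "\<dots> = c * (\<Sum>k\<in>K. \<bar>L2_set (\<lambda>\<sigma>. cmod (w \<sigma>)) (Hk k)\<bar> * \<bar>L2_set (\<lambda>\<sigma>. cmod (v \<sigma>)) (Hk k)\<bar>)"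
    by (simp add: sum_distrib_left mult_ac)
  \<comment> \<open>A second Cauchy-Schwarz inequality, now over the blocks. The norms of the blocks
    recombine to norms on \<open>F\<close>, so the constant stays \<open>c\<close>.\<close>
  also have "\<dots> \<le> c * (L2_set (\<lambda>k. L2_set (\<lambda>\<sigma>. cmod (w \<sigma>)) (Hk k)) K * L2_set (\<lambda>k. L2_set (\<lambda>\<sigma>. cmod (v \<sigma>)) (Hk k)) K)"
    by (intro mult_left_mono L2_set_mult_ineq bdd_by_nonneg[OF assms])
  also have "\<dots> \<le> c * (L2_set (\<lambda>\<sigma>. cmod (w \<sigma>)) F * L2_set (\<lambda>\<sigma>. cmod (v \<sigma>)) F)"
    by (intro mult_left_mono mult_mono L2 bdd_by_nonneg[OF assms]) simp_all
  finally show "cmod (\<Sum>\<sigma>\<in>F. \<Sum>\<tau>\<in>F. w \<sigma> * ext B qs A \<sigma> \<tau> * v \<tau>)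
    \<le> c * L2_set (\<lambda>\<sigma>. cmod (w \<sigma>)) F * L2_set (\<lambda>\<sigma>. cmod (v \<sigma>)) F" by (simp add: mult.assoc)
qed (rule bdd_by_nonneg[OF assms])

text \<open>Gates are bounded as unitaries, and a quantum case is a finite sum of products of
  bounded operators. The constant may grow with the circuit; only its existence matters.\<close>

lemma bdd_by_circ_sem: "wf_circ B G C \<Longrightarrow> \<exists>c. bdd_by (circ_sem B C) c"
proof (induction C)
  case CSkip
  then show ?case using bdd_by_id by auto
next
  case (CGate U qs)
  then show ?case
    using bdd_by_bounded_op bdd_by_ext by (auto simp: unitary_op_def) blast
next
  case (CSeq C1 C2)
  then show ?case using bdd_by_mult by auto blast
next
  case (CQif qs d \<psi> C)
  have "\<exists>c. bdd_by (mult (ext B qs (ketbra (\<psi> i) (\<psi> i))) (circ_sem B (C i))) c" if "i \<in> {1..d}" for i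
  proof -
    have "\<psi> i \<in> hilb (reg_basis B qs)"
      using CQif.prems that unfolding wf_circ.simps orthonormal_basis_def by blast
    moreover have "\<exists>c. bdd_by (circ_sem B (C i)) c"
      using CQif.IH[of "C i"] CQif.prems that by auto
    ultimately show ?thesis using bdd_by_mult[OF bdd_by_ext[OF bdd_by_ketbra]] by blast
  qed
  then have "\<exists>c. \<forall>i\<in>{1..d}. bdd_by (mult (ext B qs (ketbra (\<psi> i) (\<psi> i))) (circ_sem B (C i))) (c i)"
    by (intro bchoice ballI)
  then obtain c where c: "\<And>i. i \<in> {1..d} \<Longrightarrow> bdd_by (mult (ext B qs (ketbra (\<psi> i) (\<psi> i))) (circ_sem B (C i))) (c i)"
    by blast
  show ?case unfolding circ_sem.simps by (rule exI, rule bdd_by_sum, rule c)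
qed

section \<open>Quantum case on a basis state\<close>

text \<open>The matrix form of \<open>A = I \<otimes> A'\<close> with \<open>I\<close> acting on
  \<open>W\<close>: diagonal in the labels on \<open>W\<close>, with the same block for each of
  them. This second condition is what \<open>keeps\<close> lacks.\<close>

definition local_op :: "('q \<Rightarrow> 'b::zero set) \<Rightarrow> 'q set \<Rightarrow> ('q \<Rightarrow> 'b) op \<Rightarrow> bool" where
  "local_op B W A \<longleftrightarrow>
     (\<forall>\<sigma> \<tau>. A \<sigma> \<tau> \<noteq> 0 \<longrightarrow> \<sigma> \<in> conf B \<and> \<tau> \<in> conf B \<and> (\<forall>q\<in>W. \<sigma> q = \<tau> q)) \<and>
     (\<forall>\<sigma>\<in>conf B. \<forall>\<tau>\<in>conf B. \<forall>\<nu>\<in>conf B. (\<forall>q\<in>W. \<sigma> q = \<tau> q) \<longrightarrow>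
        A (override_on \<sigma> \<nu> W) (override_on \<tau> \<nu> W) = A \<sigma> \<tau>)"

lemma local_op_nonzeroD:
  "local_op B W A \<Longrightarrow> A \<sigma> \<tau> \<noteq> 0 \<Longrightarrow> \<sigma> \<in> conf B \<and> \<tau> \<in> conf B \<and> (\<forall>q\<in>W. \<sigma> q = \<tau> q)"
  unfolding local_op_def by blast

lemma local_op_override:
  "local_op B W A \<Longrightarrow> \<sigma> \<in> conf B \<Longrightarrow> \<tau> \<in> conf B \<Longrightarrow> \<nu> \<in> conf B \<Longrightarrow> (\<forall>q\<in>W. \<sigma> q = \<tau> q) \<Longrightarrow>
    A (override_on \<sigma> \<nu> W) (override_on \<tau> \<nu> W) = A \<sigma> \<tau>"
  unfolding local_op_def by blast

lemma override_on_eq_iff: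
  "\<forall>q\<in>W. \<sigma> q = \<tau> q \<Longrightarrow> override_on \<sigma> \<nu> W = override_on \<tau> \<nu> W \<longleftrightarrow> \<sigma> = \<tau>"
  unfolding fun_eq_iff override_on_def by meson

lemma local_op_id: "finite W \<Longrightarrow> local_op B W (id_op (conf B))"
  unfolding local_op_def id_op_def by (auto simp: override_on_eq_iff override_in_conf)

lemma local_op_ext:
  assumes "W \<inter> set qs = {}" "finite W"
  shows "local_op B W (ext B qs A)"
  unfolding local_op_def
proof (intro conjI allI impI ballI)
  fix \<sigma> \<tau> \<nu> assume *: "\<sigma> \<in> conf B" "\<tau> \<in> conf B" "\<nu> \<in> conf B" "\<forall>q\<in>W. \<sigma> q = \<tau> q"
  have 1: "(\<forall>q. q \<notin> set qs \<longrightarrow> override_on \<sigma> \<nu> W q = override_on \<tau> \<nu> W q) \<longleftrightarrow> (\<forall>q. q \<notin> set qs \<longrightarrow> \<sigma> q = \<tau> q)"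
    using *(4) unfolding override_on_def by meson
  have 2: "map (override_on \<sigma> \<nu> W) qs = map \<sigma> qs" "map (override_on \<tau> \<nu> W) qs = map \<tau> qs"
    using assms(1) by (intro map_override_on_disjoint, blast)+
  have 3: "override_on \<sigma> \<nu> W \<in> conf B" "override_on \<tau> \<nu> W \<in> conf B"
    using * assms(2) by (auto intro: override_in_conf)
  show "ext B qs A (override_on \<sigma> \<nu> W) (override_on \<tau> \<nu> W) = ext B qs A \<sigma> \<tau>"
    unfolding ext_def 1 2 by (simp only: 3 *(1,2) simp_thms)
qed (use assms in \<open>auto simp: ext_def split: if_splits\<close>)

text \<open>Intermediate configurations share their labels on \<open>W\<close> with the row.
  Overwriting these labels by \<nu> is a bijection between the ranges of summation, and both factors
  are invariant under it.\<close>

lemma local_op_mult: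
  assumes "local_op B W A" "local_op B W A'" "finite W"
  shows "local_op B W (mult A A')"
  unfolding local_op_def
proof (intro conjI allI impI ballI)
  fix \<sigma> \<tau> assume "mult A A' \<sigma> \<tau> \<noteq> 0"
  then obtain \<upsilon> where "A \<sigma> \<upsilon> \<noteq> 0" "A' \<upsilon> \<tau> \<noteq> 0" by (rule mult_nonzeroD)
  then have "\<sigma> \<in> conf B \<and> \<tau> \<in> conf B \<and> (\<forall>q\<in>W. \<sigma> q = \<tau> q)"
    using local_op_nonzeroD[OF assms(1)] local_op_nonzeroD[OF assms(2)] by metis
  then show "\<sigma> \<in> conf B" "\<tau> \<in> conf B" "q \<in> W \<Longrightarrow> \<sigma> q = \<tau> q" for q by auto
next
  fix \<sigma> \<tau> \<nu> assume *: "\<sigma> \<in> conf B" "\<tau> \<in> conf B" "\<nu> \<in> conf B" "\<forall>q\<in>W. \<sigma> q = \<tau> q"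
  let ?S = "\<lambda>\<kappa>. {\<upsilon> \<in> conf B. \<forall>q\<in>W. \<upsilon> q = \<kappa> q}"
  have mult_eq: "mult A A' \<alpha> \<beta> = (\<Sum>\<^sub>\<infinity>\<upsilon>\<in>?S \<kappa>. A \<alpha> \<upsilon> * A' \<upsilon> \<beta>)" if "\<forall>q\<in>W. \<alpha> q = \<kappa> q" for \<alpha> \<beta> \<kappa>
    unfolding mult_def
  proof (rule infsum_cong_neutral)
    fix \<upsilon> assume "\<upsilon> \<in> UNIV - ?S \<kappa>"
    then have "A \<alpha> \<upsilon> = 0" using local_op_nonzeroD[OF assms(1), of \<alpha> \<upsilon>] that by force
    then show "A \<alpha> \<upsilon> * A' \<upsilon> \<beta> = 0" by simp
  qed auto
  have bij: "bij_betw (\<lambda>\<upsilon>. override_on \<upsilon> \<nu> W) (?S \<sigma>) (?S \<nu>)"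
  proof (rule bij_betw_byWitness[where f' = "\<lambda>\<upsilon>. override_on \<upsilon> \<sigma> W"])
    show "\<forall>a\<in>?S \<sigma>. override_on (override_on a \<nu> W) \<sigma> W = a"
      "\<forall>a\<in>?S \<nu>. override_on (override_on a \<sigma> W) \<nu> W = a"
      by (auto simp: override_on_def fun_eq_iff)
    show "(\<lambda>\<upsilon>. override_on \<upsilon> \<nu> W) ` ?S \<sigma> \<subseteq> ?S \<nu>" "(\<lambda>\<upsilon>. override_on \<upsilon> \<sigma> W) ` ?S \<nu> \<subseteq> ?S \<sigma>"
      using *(1,3) assms(3) by (auto intro: override_in_conf)
  qed
  have "mult A A' (override_on \<sigma> \<nu> W) (override_on \<tau> \<nu> W) =
      (\<Sum>\<^sub>\<infinity>\<upsilon>\<in>?S \<nu>. A (override_on \<sigma> \<nu> W) \<upsilon> * A' \<upsilon> (override_on \<tau> \<nu> W))"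
    by (rule mult_eq) simp
  also have "\<dots> = (\<Sum>\<^sub>\<infinity>\<upsilon>\<in>?S \<sigma>. A (override_on \<sigma> \<nu> W) (override_on \<upsilon> \<nu> W) *
      A' (override_on \<upsilon> \<nu> W) (override_on \<tau> \<nu> W))"
    by (rule infsum_reindex_bij_betw[OF bij, symmetric])
  also have "\<dots> = (\<Sum>\<^sub>\<infinity>\<upsilon>\<in>?S \<sigma>. A \<sigma> \<upsilon> * A' \<upsilon> \<tau>)"
    using * by (intro infsum_cong) (simp add: local_op_override[OF assms(1)] local_op_override[OF assms(2)])
  also have "\<dots> = mult A A' \<sigma> \<tau>"
    by (rule mult_eq[symmetric]) simp
  finally show "mult A A' (override_on \<sigma> \<nu> W) (override_on \<tau> \<nu> W) = mult A A' \<sigma> \<tau>" .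
qed

lemma local_op_sum:
  assumes "\<And>i. i \<in> I \<Longrightarrow> local_op B W (A i)"
  shows "local_op B W (\<lambda>\<sigma> \<tau>. \<Sum>i\<in>I. A i \<sigma> \<tau>)"
  unfolding local_op_def
proof (intro conjI allI impI ballI)
  fix \<sigma> \<tau> assume "(\<Sum>i\<in>I. A i \<sigma> \<tau>) \<noteq> 0"
  then obtain i where "i \<in> I" "A i \<sigma> \<tau> \<noteq> 0"
    by (rule sum.not_neutral_contains_not_neutral)
  then have "\<sigma> \<in> conf B \<and> \<tau> \<in> conf B \<and> (\<forall>q\<in>W. \<sigma> q = \<tau> q)"
    using local_op_nonzeroD[OF assms] by blast
  then show "\<sigma> \<in> conf B" "\<tau> \<in> conf B" "q \<in> W \<Longrightarrow> \<sigma> q = \<tau> q" for q by auto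
qed (intro sum.cong refl local_op_override[OF assms], auto)

lemma local_op_circ_sem:
  "W \<inter> circ_vars C = {} \<Longrightarrow> finite W \<Longrightarrow> local_op B W (circ_sem B C)"
proof (induction C)
  case CSkip
  then show ?case by (simp add: local_op_id)
next
  case (CGate U qs)
  then show ?case by (simp add: local_op_ext)
next
  case (CSeq C1 C2)
  then show ?case by (simp add: local_op_mult Int_Un_distrib)
next
  case (CQif qs d \<psi> C)
  have "local_op B W (circ_sem B (C i))" if "i \<in> {1..d}" for i
    using CQif.prems that by (intro CQif.IH) auto
  moreover have "W \<inter> set qs = {}" using CQif.prems by auto
  ultimately show ?case unfolding circ_sem.simps
    using CQif.prems(2) by (intro local_op_sum local_op_mult local_op_ext)
qed

section \<open>Splitting configurations into labels of a register and labels of the rest\<close>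

definition zeros :: "('q \<Rightarrow> 'b::zero set) \<Rightarrow> 'q set \<Rightarrow> ('q \<Rightarrow> 'b) set" where
  "zeros B W = {r \<in> conf B. \<forall>q\<in>W. r q = 0}"

lemma labels_subset_conf: "(\<And>q. 0 \<in> B q) \<Longrightarrow> finite W \<Longrightarrow> labels B W \<subseteq> conf B"
  by (auto simp: labels_def conf_def intro: finite_subset[of _ W])

lemma zero_conf: "(\<And>q. 0 \<in> B q) \<Longrightarrow> (\<lambda>_. 0) \<in> conf B"
  by (simp add: conf_def)

text \<open>The tensor factorisation of the state space at the level of bases: the label
  \<open>0\<close> on \<open>W\<close> serves as the representative that indexes the space of the
  remaining variables.\<close>

lemma bij_betw_zeros_labels:
  assumes "\<And>q. 0 \<in> B q" "finite W"
  shows "bij_betw (\<lambda>(r, \<nu>). override_on r \<nu> W) (zeros B W \<times> labels B W) (conf B)"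
proof (rule bij_betw_byWitness[where f' = "\<lambda>\<upsilon>. (override_on \<upsilon> (\<lambda>_. 0) W, override_on (\<lambda>_. 0) \<upsilon> W)"])
  show "\<forall>a\<in>zeros B W \<times> labels B W. (\<lambda>\<upsilon>. (override_on \<upsilon> (\<lambda>_. 0) W, override_on (\<lambda>_. 0) \<upsilon> W))
      ((\<lambda>(r, \<nu>). override_on r \<nu> W) a) = a"
    by (auto simp: zeros_def labels_def override_on_def fun_eq_iff)
  show "\<forall>a\<in>conf B. (\<lambda>(r, \<nu>). override_on r \<nu> W)
      ((\<lambda>\<upsilon>. (override_on \<upsilon> (\<lambda>_. 0) W, override_on (\<lambda>_. 0) \<upsilon> W)) a) = a"
    by (auto simp: override_on_def fun_eq_iff)
  show "(\<lambda>(r, \<nu>). override_on r \<nu> W) ` (zeros B W \<times> labels B W) \<subseteq> conf B"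
    using assms(2) by (auto simp: zeros_def intro: override_in_conf)
  show "(\<lambda>\<upsilon>. (override_on \<upsilon> (\<lambda>_. 0) W, override_on (\<lambda>_. 0) \<upsilon> W)) ` conf B \<subseteq> zeros B W \<times> labels B W"
    using override_in_conf[OF _ _ assms(2), of _ B "\<lambda>_. 0"] zero_conf[of B] assms
    by (auto simp: zeros_def labels_def override_on_def conf_def)
qed

lemma bij_betw_zeros_slice:
  assumes "\<And>q. 0 \<in> B q" "finite W" "\<sigma> \<in> conf B"
  shows "bij_betw (\<lambda>r. override_on r \<sigma> W) (zeros B W) {\<upsilon> \<in> conf B. \<forall>q\<in>W. \<sigma> q = \<upsilon> q}"
proof (rule bij_betw_byWitness[where f' = "\<lambda>\<upsilon>. override_on \<upsilon> (\<lambda>_. 0) W"])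
  show "(\<lambda>r. override_on r \<sigma> W) ` zeros B W \<subseteq> {\<upsilon> \<in> conf B. \<forall>q\<in>W. \<sigma> q = \<upsilon> q}"
    using assms by (auto simp: zeros_def intro: override_in_conf)
  show "(\<lambda>\<upsilon>. override_on \<upsilon> (\<lambda>_. 0) W) ` {\<upsilon> \<in> conf B. \<forall>q\<in>W. \<sigma> q = \<upsilon> q} \<subseteq> zeros B W"
    using assms zero_conf[of B] by (auto simp: zeros_def intro: override_in_conf)
qed (auto simp: zeros_def override_on_def fun_eq_iff)

text \<open>For \<open>A = I \<otimes> A'\<close> with \<open>I\<close> on \<open>W\<close>, this is
  \<open>A'\<close> applied to \<open>h\<close>, both read on the representatives with label
  \<open>0\<close> on \<open>W\<close>.\<close>

definition reduced :: "('q \<Rightarrow> 'b::zero set) \<Rightarrow> 'q set \<Rightarrow> ('q \<Rightarrow> 'b) op \<Rightarrow> (('q \<Rightarrow> 'b) \<Rightarrow> complex) \<Rightarrow> ('q \<Rightarrow> 'b) \<Rightarrow> complex" where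
  "reduced B W A h \<sigma> = (\<Sum>\<^sub>\<infinity>r\<in>zeros B W. A (override_on \<sigma> (\<lambda>_. 0) W) r * h r)"

lemma local_op_zeros:
  assumes "\<And>q. 0 \<in> B q" "finite W" "local_op B W A" "\<sigma> \<in> conf B" "r \<in> zeros B W" "\<nu> \<in> conf B"
  shows "A (override_on \<sigma> \<nu> W) (override_on r \<nu> W) = A (override_on \<sigma> (\<lambda>_. 0) W) r"
proof -
  have "A (override_on (override_on \<sigma> (\<lambda>_. 0) W) \<nu> W) (override_on r \<nu> W) = A (override_on \<sigma> (\<lambda>_. 0) W) r"
    using assms zero_conf[of B]
    by (intro local_op_override[OF assms(3)] override_in_conf) (auto simp: zeros_def)
  then show ?thesis by simp
qed

text \<open>In tensor notation, \<open>I \<otimes> A'\<close> sends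
  \<open>\<phi> \<otimes> h\<close> to \<open>\<phi> \<otimes> A' h\<close>.\<close>

lemma local_op_slice:
  assumes "\<And>q. 0 \<in> B q" "local_op B (set qs) A" "\<sigma> \<in> conf B"
    "\<And>\<upsilon> \<nu>. h (override_on \<upsilon> \<nu> (set qs)) = h \<upsilon>"
  shows "(\<Sum>\<^sub>\<infinity>\<upsilon>. A \<sigma> \<upsilon> * (if \<upsilon> \<in> conf B then \<phi> (map \<upsilon> qs) * h \<upsilon> else 0)) =
    \<phi> (map \<sigma> qs) * reduced B (set qs) A h \<sigma>"
proof -
  have "(\<Sum>\<^sub>\<infinity>\<upsilon>. A \<sigma> \<upsilon> * (if \<upsilon> \<in> conf B then \<phi> (map \<upsilon> qs) * h \<upsilon> else 0)) =
      (\<Sum>\<^sub>\<infinity>\<upsilon>\<in>{\<upsilon> \<in> conf B. \<forall>q\<in>set qs. \<sigma> q = \<upsilon> q}. A \<sigma> \<upsilon> * (\<phi> (map \<upsilon> qs) * h \<upsilon>))"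
  proof (rule infsum_cong_neutral)
    fix \<upsilon> assume "\<upsilon> \<in> UNIV - {\<upsilon> \<in> conf B. \<forall>q\<in>set qs. \<sigma> q = \<upsilon> q}"
    then have "A \<sigma> \<upsilon> = 0" using local_op_nonzeroD[OF assms(2), of \<sigma> \<upsilon>] by blast
    then show "A \<sigma> \<upsilon> * (if \<upsilon> \<in> conf B then \<phi> (map \<upsilon> qs) * h \<upsilon> else 0) = 0" by simp
  qed auto
  also have "\<dots> = (\<Sum>\<^sub>\<infinity>r\<in>zeros B (set qs). A \<sigma> (override_on r \<sigma> (set qs)) *
      (\<phi> (map (override_on r \<sigma> (set qs)) qs) * h (override_on r \<sigma> (set qs))))"
    by (rule infsum_reindex_bij_betw[OF bij_betw_zeros_slice, symmetric]) (use assms in auto)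
  also have "\<dots> = (\<Sum>\<^sub>\<infinity>r\<in>zeros B (set qs). \<phi> (map \<sigma> qs) * (A (override_on \<sigma> (\<lambda>_. 0) (set qs)) r * h r))"
  proof (rule infsum_cong)
    fix r assume "r \<in> zeros B (set qs)"
    then have "A (override_on \<sigma> \<sigma> (set qs)) (override_on r \<sigma> (set qs)) = A (override_on \<sigma> (\<lambda>_. 0) (set qs)) r"
      by (intro local_op_zeros[OF assms(1) _ assms(2,3) _ assms(3)]) simp
    moreover have "override_on \<sigma> \<sigma> (set qs) = \<sigma>" by (simp add: override_on_def)
    ultimately show "A \<sigma> (override_on r \<sigma> (set qs)) *
      (\<phi> (map (override_on r \<sigma> (set qs)) qs) * h (override_on r \<sigma> (set qs))) =
      \<phi> (map \<sigma> qs) * (A (override_on \<sigma> (\<lambda>_. 0) (set qs)) r * h r)"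
      by (simp only: assms(4) map_override_on mult_ac)
  qed
  finally show ?thesis by (simp only: infsum_cmult_right' reduced_def)
qed

text \<open>The entries of |\<phi>\<rangle>\<langle>\<phi>| \<otimes> A': as \<open>A\<close> does
  not change labels on \<open>qs\<close>, the intermediate label must be the label \<nu> of the
  column.\<close>

lemma mult_ketbra_local_op:
  assumes "\<And>q. 0 \<in> B q" "local_op B (set qs) A" "\<sigma> \<in> conf B" "r \<in> zeros B (set qs)" "\<nu> \<in> labels B (set qs)"
  shows "mult (ext B qs (ketbra \<phi> \<phi>)) A \<sigma> (override_on r \<nu> (set qs)) =
    \<phi> (map \<sigma> qs) * cnj (\<phi> (map \<nu> qs)) * A (override_on \<sigma> (\<lambda>_. 0) (set qs)) r"
proof -
  have "A (override_on \<sigma> \<nu>' (set qs)) (override_on r \<nu> (set qs)) = 0"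
    if "\<nu>' \<in> labels B (set qs)" "\<nu>' \<noteq> \<nu>" for \<nu>'
  proof (rule ccontr)
    assume "A (override_on \<sigma> \<nu>' (set qs)) (override_on r \<nu> (set qs)) \<noteq> 0"
    from local_op_nonzeroD[OF assms(2), OF this] have "map \<nu>' qs = map \<nu> qs" by simp
    then show False using map_labels_eq_iff[OF that(1) assms(5)] that(2) by simp
  qed
  then have "(\<Sum>\<^sub>\<infinity>\<nu>'\<in>labels B (set qs). ketbra \<phi> \<phi> (map \<sigma> qs) (map \<nu>' qs) *
      A (override_on \<sigma> \<nu>' (set qs)) (override_on r \<nu> (set qs))) =
    ketbra \<phi> \<phi> (map \<sigma> qs) (map \<nu> qs) * A (override_on \<sigma> \<nu> (set qs)) (override_on r \<nu> (set qs))"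
    using assms(5) by (intro infsum_single_point[where a = \<nu>]) simp_all
  moreover have "A (override_on \<sigma> \<nu> (set qs)) (override_on r \<nu> (set qs)) = A (override_on \<sigma> (\<lambda>_. 0) (set qs)) r"
    using assms(1,5) labels_subset_conf[of B "set qs"]
    by (intro local_op_zeros[OF assms(1) _ assms(2-4)]) auto
  ultimately show ?thesis
    using assms(3) by (simp add: mult_ext ketbra_def)
qed

lemma mult_zero_row: "(\<And>y. A x y = 0) \<Longrightarrow> mult A A' x z = 0"
  by (simp add: mult_def)

text \<open>
  The sum over a configuration splits into one over the labels of \<open>qs\<close> and one over the remaining
  variables. The former is \<open>\<langle>\<phi> i|\<phi> j\<rangle>\<close>.
\<close>

lemma qif_mult_basis:
  fixes d :: nat
  assumes zero: "\<And>q. 0 \<in> B q" and dist: "distinct qs"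
    and \<phi>: "\<And>i. i \<in> {1..d} \<Longrightarrow> \<phi> i \<in> hilb (reg_basis B qs)"
    and orth: "\<And>i j. i \<in> {1..d} \<Longrightarrow> j \<in> {1..d} \<Longrightarrow> braket (\<phi> i) (\<phi> j) = (if i = j then 1 else 0)"
    and A: "\<And>i. i \<in> {1..d} \<Longrightarrow> local_op B (set qs) (A i)"
      "\<And>i \<sigma>. i \<in> {1..d} \<Longrightarrow> (\<lambda>\<tau>. (cmod (A i \<sigma> \<tau>))\<^sup>2) summable_on zeros B (set qs)"
    and j: "j \<in> {1..d}"
    and Z: "\<And>\<upsilon> \<tau>. Z \<upsilon> \<tau> = (if \<upsilon> \<in> conf B then \<phi> j (map \<upsilon> qs) * h \<tau> \<upsilon> else 0)"
    and h: "\<And>\<tau> \<upsilon> \<nu>. h \<tau> (override_on \<upsilon> \<nu> (set qs)) = h \<tau> \<upsilon>"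
      "\<And>\<tau>. (\<lambda>r. (cmod (h \<tau> r))\<^sup>2) summable_on zeros B (set qs)"
  shows "mult (\<lambda>\<sigma> \<tau>. \<Sum>i=1..d. mult (ext B qs (ketbra (\<phi> i) (\<phi> i))) (A i) \<sigma> \<tau>) Z = mult (A j) Z"
proof (intro HOL.ext)
  fix \<sigma> \<tau>
  let ?W = "set qs"
  let ?Q = "\<lambda>\<sigma> \<tau>. \<Sum>i=1..d. mult (ext B qs (ketbra (\<phi> i) (\<phi> i))) (A i) \<sigma> \<tau>"
  show "mult ?Q Z \<sigma> \<tau> = mult (A j) Z \<sigma> \<tau>"
  proof (cases "\<sigma> \<in> conf B")
    case True
    let ?a = "\<lambda>i r. A i (override_on \<sigma> (\<lambda>_. 0) ?W) r * h \<tau> r"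
    let ?b = "\<lambda>i \<nu>. \<phi> i (map \<sigma> qs) * (cnj (\<phi> i (map \<nu> qs)) * \<phi> j (map \<nu> qs))"
    let ?ov = "\<lambda>(r, \<nu>). override_on r \<nu> ?W"
    have "mult ?Q Z \<sigma> \<tau> = (\<Sum>\<^sub>\<infinity>\<upsilon>\<in>conf B. ?Q \<sigma> \<upsilon> * Z \<upsilon> \<tau>)"
      unfolding mult_def by (rule infsum_cong_neutral) (auto simp: Z)
    also have "\<dots> = (\<Sum>\<^sub>\<infinity>p\<in>zeros B ?W \<times> labels B ?W. ?Q \<sigma> (?ov p) * Z (?ov p) \<tau>)"
      by (rule infsum_reindex_bij_betw[OF bij_betw_zeros_labels, symmetric]) (simp_all add: zero)
    also have "\<dots> = (\<Sum>\<^sub>\<infinity>p\<in>zeros B ?W \<times> labels B ?W. \<Sum>i=1..d. (\<lambda>(r, \<nu>). ?a i r * ?b i \<nu>) p)"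
    proof (rule infsum_cong)
      fix p assume "p \<in> zeros B ?W \<times> labels B ?W"
      then obtain r \<nu> where p: "p = (r, \<nu>)" "r \<in> zeros B ?W" "\<nu> \<in> labels B ?W" by auto
      have "override_on r \<nu> ?W \<in> conf B"
        using p by (intro override_in_conf) (auto simp: zeros_def)
      then have Zov: "Z (override_on r \<nu> ?W) \<tau> = \<phi> j (map \<nu> qs) * h \<tau> r"
        by (simp add: Z h(1))
      have Qov: "?Q \<sigma> (override_on r \<nu> ?W) =
          (\<Sum>i=1..d. \<phi> i (map \<sigma> qs) * cnj (\<phi> i (map \<nu> qs)) * A i (override_on \<sigma> (\<lambda>_. 0) ?W) r)"
        by (intro sum.cong refl mult_ketbra_local_op zero A(1) True p)
      show "?Q \<sigma> (?ov p) * Z (?ov p) \<tau> = (\<Sum>i=1..d. (\<lambda>(r, \<nu>). ?a i r * ?b i \<nu>) p)"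
        unfolding p(1) prod.case Zov Qov sum_distrib_right
        by (intro sum.cong refl) (simp only: mult_ac)
    qed
    also have "\<dots> = (\<Sum>i=1..d. infsum (?a i) (zeros B ?W) * infsum (?b i) (labels B ?W))"
    proof (intro infsumI has_sum_finite_sum has_sum_Times_mult)
      fix i assume i: "i \<in> {1..d}"
      show "(\<lambda>r. norm (?a i r)) summable_on zeros B ?W"
        by (rule ell2_mult_summable[OF A(2)[OF i] h(2)])
      have s: "(\<lambda>\<nu>. (cmod (\<phi> k (map \<nu> qs)))\<^sup>2) summable_on labels B ?W" if "k \<in> {1..d}" for k
        using summable_on_reindex_bij_betw[OF bij_betw_labels[OF dist, of B], of "\<lambda>x. (cmod (\<phi> k x))\<^sup>2"]
          hilb_summable[OF \<phi>[OF that]] by simp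
      have "(\<lambda>\<nu>. norm (cnj (\<phi> i (map \<nu> qs)) * \<phi> j (map \<nu> qs))) summable_on labels B ?W"
        by (rule ell2_mult_summable) (simp_all add: s[OF i] s[OF j])
      then show "(\<lambda>\<nu>. norm (?b i \<nu>)) summable_on labels B ?W"
        unfolding norm_mult[of "\<phi> i _"] by (rule summable_on_cmult_right)
    qed
    also have "\<dots> = (\<Sum>i=1..d. if i = j then \<phi> j (map \<sigma> qs) * reduced B ?W (A j) (h \<tau>) \<sigma> else 0)"
    proof (rule sum.cong[OF refl])
      fix i assume i: "i \<in> {1..d}"
      have "infsum (?b i) (labels B ?W) = \<phi> i (map \<sigma> qs) * braket (\<phi> i) (\<phi> j)"
        by (simp only: infsum_cmult_right' braket_reg_basis[OF dist \<phi>[OF i]])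
      then show "infsum (?a i) (zeros B ?W) * infsum (?b i) (labels B ?W) =
          (if i = j then \<phi> j (map \<sigma> qs) * reduced B ?W (A j) (h \<tau>) \<sigma> else 0)"
        by (simp add: orth[OF i j] reduced_def)
    qed
    also have "\<dots> = \<phi> j (map \<sigma> qs) * reduced B ?W (A j) (h \<tau>) \<sigma>"
      using j by (subst sum.delta) auto
    also have "\<dots> = mult (A j) Z \<sigma> \<tau>"
      unfolding mult_def Z by (rule local_op_slice[OF zero A(1)[OF j] True h(1), symmetric])
    finally show ?thesis .
  next
    case False
    then have "?Q \<sigma> \<upsilon> = 0" "A j \<sigma> \<upsilon> = 0" for \<upsilon>
      using local_op_nonzeroD[OF A(1)[OF j], of \<sigma>] by (auto simp: mult_ext)
    then show ?thesis by (simp only: mult_zero_row)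
  qed
qed

lemma infsum_cauchy_schwarz:
  fixes f g :: "'a \<Rightarrow> real"
  assumes "(\<lambda>x. (f x)\<^sup>2) summable_on A" "(\<lambda>x. (g x)\<^sup>2) summable_on A" "\<And>x. 0 \<le> f x" "\<And>x. 0 \<le> g x"
  shows "(\<lambda>x. f x * g x) summable_on A"
    "(\<Sum>\<^sub>\<infinity>x\<in>A. f x * g x) \<le> sqrt (\<Sum>\<^sub>\<infinity>x\<in>A. (f x)\<^sup>2) * sqrt (\<Sum>\<^sub>\<infinity>x\<in>A. (g x)\<^sup>2)"
proof -
  have "(\<lambda>x. norm (complex_of_real (f x) * complex_of_real (g x))) summable_on A"
    by (rule ell2_mult_summable) (use assms in simp_all)
  then show s: "(\<lambda>x. f x * g x) summable_on A"
    using assms(3,4) by (simp add: norm_mult)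
  have L: "L2_set u F \<le> sqrt (\<Sum>\<^sub>\<infinity>x\<in>A. (u x)\<^sup>2)" if "(\<lambda>x. (u x)\<^sup>2) summable_on A" "finite F" "F \<subseteq> A" for u F
    unfolding L2_set_def by (intro real_sqrt_le_mono finite_sum_le_infsum that) auto
  show "(\<Sum>\<^sub>\<infinity>x\<in>A. f x * g x) \<le> sqrt (\<Sum>\<^sub>\<infinity>x\<in>A. (f x)\<^sup>2) * sqrt (\<Sum>\<^sub>\<infinity>x\<in>A. (g x)\<^sup>2)"
  proof (rule infsum_le_finite_sums[OF s])
    fix F assume F: "finite F" "F \<subseteq> A"
    have "(\<Sum>x\<in>F. f x * g x) \<le> L2_set f F * L2_set g F"
      using L2_set_mult_ineq[of f g F] assms(3,4) by simp
    also have "\<dots> \<le> sqrt (\<Sum>\<^sub>\<infinity>x\<in>A. (f x)\<^sup>2) * sqrt (\<Sum>\<^sub>\<infinity>x\<in>A. (g x)\<^sup>2)"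
      by (intro mult_mono L assms F) (simp_all add: infsum_nonneg)
    finally show "(\<Sum>x\<in>F. f x * g x) \<le> sqrt (\<Sum>\<^sub>\<infinity>x\<in>A. (f x)\<^sup>2) * sqrt (\<Sum>\<^sub>\<infinity>x\<in>A. (g x)\<^sup>2)" .
  qed
qed

text \<open>\<open>G \<sigma>\<close> is the norm of the weight \<open>g\<close> along the slice
  through \<sigma>. The bound is the Cauchy-Schwarz inequality on two slices, and summing
  \<open>(G r)\<^sup>2\<close> over the remaining variables recovers the full sum of the squares of
  \<open>g\<close>. So a partial trace of a dominated matrix is dominated on the rest.\<close>

lemma ptrace_bound:
  assumes zero: "\<And>q. 0 \<in> B q" and "finite W" "dominated \<rho> g"
  obtains G where "\<And>\<sigma> \<tau>. cmod (ptrace B W \<rho> \<sigma> \<tau>) \<le> G \<sigma> * G \<tau>" "\<And>\<sigma>. 0 \<le> G \<sigma>"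
    "\<And>\<sigma> \<nu>. G (override_on \<sigma> \<nu> W) = G \<sigma>" "(\<lambda>r. (G r)\<^sup>2) summable_on zeros B W"
proof -
  define G where "G \<sigma> = sqrt (\<Sum>\<^sub>\<infinity>\<nu>\<in>labels B W. (g (override_on \<sigma> \<nu> W))\<^sup>2)" for \<sigma>
  have g: "\<And>s t. cmod (\<rho> s t) \<le> g s * g t" "\<And>s. 0 \<le> g s" "(\<lambda>s. (g s)\<^sup>2) summable_on UNIV"
    using assms(3) by (auto simp: dominated_def)
  note sl = summable_on_slice[OF g(3), of _ W B]
  show thesis
  proof
    fix \<sigma> \<tau>
    note s = dominated_slice_summable[OF assms(3), of \<sigma> W \<tau> B]
    note cs = infsum_cauchy_schwarz[OF sl[of \<sigma>] sl[of \<tau>] g(2) g(2)]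
    have "cmod (ptrace B W \<rho> \<sigma> \<tau>) \<le> (\<Sum>\<^sub>\<infinity>\<nu>\<in>labels B W. norm (\<rho> (override_on \<sigma> \<nu> W) (override_on \<tau> \<nu> W)))"
      unfolding ptrace_def by (rule norm_infsum_bound[OF s])
    also have "\<dots> \<le> (\<Sum>\<^sub>\<infinity>\<nu>\<in>labels B W. g (override_on \<sigma> \<nu> W) * g (override_on \<tau> \<nu> W))"
      by (rule infsum_mono[OF s cs(1)]) (rule g(1))
    also have "\<dots> \<le> G \<sigma> * G \<tau>" unfolding G_def by (rule cs(2))
    finally show "cmod (ptrace B W \<rho> \<sigma> \<tau>) \<le> G \<sigma> * G \<tau>" .
  next
    fix \<sigma> \<nu> show "0 \<le> G \<sigma>" "G (override_on \<sigma> \<nu> W) = G \<sigma>"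
      by (simp_all add: G_def infsum_nonneg)
  next
    have "(\<lambda>s. (g s)\<^sup>2) summable_on conf B" by (rule summable_on_subset_banach[OF g(3)]) simp
    then have "(\<lambda>(r, \<nu>). (g (override_on r \<nu> W))\<^sup>2) summable_on zeros B W \<times> labels B W"
      using summable_on_reindex_bij_betw[OF bij_betw_zeros_labels[OF zero assms(2)], of "\<lambda>s. (g s)\<^sup>2"]
      by (simp add: case_prod_unfold)
    from summable_on_Sigma_banach[OF this]
    show "(\<lambda>r. (G r)\<^sup>2) summable_on zeros B W"
      by (simp add: G_def infsum_nonneg)
  qed
qed

text \<open>By \<open>sandwich_adj\<close>, conjugation consists of two left multiplications. Before
  each of them every column has the form \<open>\<phi> j \<otimes> h\<close>: initially by
  construction, and afterwards because the branch \<open>C j\<close> does not touch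
  \<open>qs\<close>. So \<open>qif_mult_basis\<close> applies twice, and what has to be checked is
  the square-summability of \<open>h\<close>.\<close>

lemma sandwich_qif_init_basis:
  assumes zero: "\<And>q. 0 \<in> B q" and wf: "wf_circ B G (CQif qs d \<phi> C)" and j: "j \<in> {1..d}"
    and \<rho>: "dominated \<rho> g"
  shows "sandwich (circ_sem B (CQif qs d \<phi> C)) (init_op B qs (\<phi> j) (ptrace B (set qs) \<rho>)) =
    sandwich (circ_sem B (C j)) (init_op B qs (\<phi> j) (ptrace B (set qs) \<rho>))"
proof -
  let ?W = "set qs" and ?Q = "circ_sem B (CQif qs d \<phi> C)" and ?A = "\<lambda>i. circ_sem B (C i)"
  let ?T = "ptrace B ?W \<rho>"
  let ?I = "init_op B qs (\<phi> j) ?T"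
  have dist: "distinct qs" and onb: "orthonormal_basis (reg_basis B qs) d \<phi>"
    and wfC: "\<And>i. i \<in> {1..d} \<Longrightarrow> wf_circ B G (C i)"
    and disj: "\<And>i. i \<in> {1..d} \<Longrightarrow> ?W \<inter> circ_vars (C i) = {}"
    using wf by auto
  have \<phi>: "\<And>i. i \<in> {1..d} \<Longrightarrow> \<phi> i \<in> hilb (reg_basis B qs)"
    and orth: "\<And>i k. i \<in> {1..d} \<Longrightarrow> k \<in> {1..d} \<Longrightarrow> braket (\<phi> i) (\<phi> k) = (if i = k then 1 else 0)"
    using onb unfolding orthonormal_basis_def by blast+
  have loc: "local_op B ?W (?A i)" if "i \<in> {1..d}" for i
    using disj[OF that] by (intro local_op_circ_sem) auto
  have row: "(\<lambda>\<tau>. (cmod (?A i \<sigma> \<tau>))\<^sup>2) summable_on zeros B ?W" if "i \<in> {1..d}" for i \<sigma>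
    using bdd_by_circ_sem[OF wfC[OF that]] bdd_by_row by metis
  obtain H where H: "\<And>\<sigma> \<tau>. cmod (?T \<sigma> \<tau>) \<le> H \<sigma> * H \<tau>" "\<And>\<sigma>. 0 \<le> H \<sigma>"
    "\<And>\<sigma> \<nu>. H (override_on \<sigma> \<nu> ?W) = H \<sigma>" "(\<lambda>r. (H r)\<^sup>2) summable_on zeros B ?W"
    using ptrace_bound[of B ?W \<rho> g, OF zero _ \<rho>] by auto
  note basis = qif_mult_basis[OF zero dist \<phi> orth loc row j]
  have bound: "(\<lambda>r. (cmod (f r))\<^sup>2) summable_on zeros B ?W" if "\<And>r. cmod (f r) \<le> K * H r" for f K
  proof (rule summable_on_comparison_test)
    show "(\<lambda>r. K\<^sup>2 * (H r)\<^sup>2) summable_on zeros B ?W"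
      by (rule summable_on_cmult_right[OF H(4)])
    show "(cmod (f r))\<^sup>2 \<le> K\<^sup>2 * (H r)\<^sup>2" for r
      using power_mono[OF that[of r] norm_ge_zero, of 2] by (simp add: power_mult_distrib)
  qed simp
  have "mult ?Q ?I = mult (?A j) ?I"
    unfolding circ_sem.simps
  proof (rule basis)
    let ?h = "\<lambda>\<tau> \<upsilon>. if \<tau> \<in> conf B then cnj (\<phi> j (map \<tau> qs)) * ?T \<upsilon> \<tau> else 0"
    show "?I \<upsilon> \<tau> = (if \<upsilon> \<in> conf B then \<phi> j (map \<upsilon> qs) * ?h \<tau> \<upsilon> else 0)" for \<upsilon> \<tau>
      by (simp add: init_op_def)
    show "?h \<tau> (override_on \<upsilon> \<nu> ?W) = ?h \<tau> \<upsilon>" for \<tau> \<upsilon> \<nu>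
      by (simp add: blindD1[OF blind_ptrace])
    show "(\<lambda>r. (cmod (?h \<tau> r))\<^sup>2) summable_on zeros B ?W" for \<tau>
    proof (rule bound)
      show "cmod (?h \<tau> r) \<le> (cmod (\<phi> j (map \<tau> qs)) * H \<tau>) * H r" for r
        using mult_left_mono[OF H(1)[of r \<tau>], of "cmod (\<phi> j (map \<tau> qs))"] H(2)
        by (simp add: norm_mult mult_ac)
    qed
  qed
  moreover have "mult ?Q (adj (mult (?A j) ?I)) = mult (?A j) (adj (mult (?A j) ?I))"
    unfolding circ_sem.simps
  proof (rule basis)
    let ?z = "\<lambda>\<sigma>. override_on \<sigma> (\<lambda>_. 0) ?W"
    \<comment> \<open>The product of the branch operator and the partial trace, taken over the
      remaining variables alone.\<close>
    let ?r = "\<lambda>\<sigma> \<upsilon>. \<Sum>\<^sub>\<infinity>r\<in>zeros B ?W. ?A j (?z \<sigma>) r * ?T r \<upsilon>"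
    let ?h = "\<lambda>\<sigma> \<upsilon>. if \<sigma> \<in> conf B then cnj (\<phi> j (map \<sigma> qs) * ?r \<sigma> \<upsilon>) else 0"
    show "adj (mult (?A j) ?I) \<upsilon> \<sigma> = (if \<upsilon> \<in> conf B then \<phi> j (map \<upsilon> qs) * ?h \<sigma> \<upsilon> else 0)" for \<upsilon> \<sigma>
    proof (cases "\<sigma> \<in> conf B \<and> \<upsilon> \<in> conf B")
      case True
      have "mult (?A j) ?I \<sigma> \<upsilon> = (\<Sum>\<^sub>\<infinity>\<kappa>. ?A j \<sigma> \<kappa> *
          (if \<kappa> \<in> conf B then \<phi> j (map \<kappa> qs) * (cnj (\<phi> j (map \<upsilon> qs)) * ?T \<kappa> \<upsilon>) else 0))"
        unfolding mult_def by (rule infsum_cong) (simp add: init_op_def True)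
      also have "\<dots> = \<phi> j (map \<sigma> qs) * reduced B ?W (?A j) (\<lambda>\<kappa>. cnj (\<phi> j (map \<upsilon> qs)) * ?T \<kappa> \<upsilon>) \<sigma>"
        using True by (intro local_op_slice[OF zero loc[OF j]]) (simp_all add: blindD1[OF blind_ptrace])
      also have "reduced B ?W (?A j) (\<lambda>\<kappa>. cnj (\<phi> j (map \<upsilon> qs)) * ?T \<kappa> \<upsilon>) \<sigma> =
          cnj (\<phi> j (map \<upsilon> qs)) * ?r \<sigma> \<upsilon>"
        unfolding reduced_def by (subst infsum_cmult_right'[symmetric]) (simp only: mult_ac)
      finally show ?thesis using True by (simp add: adj_def)
    next
      case False
      have "mult (?A j) ?I \<sigma> \<upsilon> = 0"
      proof (cases "\<sigma> \<in> conf B")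
        case True
        then show ?thesis using False by (simp add: mult_def init_op_def)
      next
        case False
        then have "?A j \<sigma> = (\<lambda>_. 0)" using local_op_nonzeroD[OF loc[OF j], of \<sigma>] by (auto simp: fun_eq_iff)
        then show ?thesis by (simp add: mult_def)
      qed
      then show ?thesis using False by (auto simp: adj_def)
    qed
    show "?h \<sigma> (override_on \<upsilon> \<nu> ?W) = ?h \<sigma> \<upsilon>" for \<sigma> \<upsilon> \<nu>
      by (simp add: blindD2[OF blind_ptrace])
    show "(\<lambda>\<upsilon>. (cmod (?h \<sigma> \<upsilon>))\<^sup>2) summable_on zeros B ?W" for \<sigma>
    proof (rule bound)
      fix \<upsilon>
      \<comment> \<open>\<open>?K\<close> is an honest value, since a row of the branch operator and
        \<open>H\<close> are both square-summable. It does not depend on \<upsilon>, so the decay in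
        \<upsilon> is that of \<open>H\<close>.\<close>
      let ?K = "\<Sum>\<^sub>\<infinity>r\<in>zeros B ?W. cmod (?A j (?z \<sigma>) r) * H r"
      have K: "(\<lambda>r. cmod (?A j (?z \<sigma>) r) * H r) summable_on zeros B ?W"
        by (rule infsum_cauchy_schwarz(1)[OF row[OF j] H(4) _ H(2)]) simp
      have Ka: "(\<lambda>r. cmod (?A j (?z \<sigma>) r) * H r * H \<upsilon>) summable_on zeros B ?W"
        by (rule summable_on_cmult_left[OF K])
      have le: "norm (?A j (?z \<sigma>) r * ?T r \<upsilon>) \<le> cmod (?A j (?z \<sigma>) r) * H r * H \<upsilon>" for r
        using mult_left_mono[OF H(1)[of r \<upsilon>], of "cmod (?A j (?z \<sigma>) r)"] by (simp add: norm_mult mult_ac)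
      have s: "(\<lambda>r. norm (?A j (?z \<sigma>) r * ?T r \<upsilon>)) summable_on zeros B ?W"
        by (rule summable_on_comparison_test[OF Ka]) (simp_all add: le)
      have "cmod (?r \<sigma> \<upsilon>) \<le> (\<Sum>\<^sub>\<infinity>r\<in>zeros B ?W. norm (?A j (?z \<sigma>) r * ?T r \<upsilon>))"
        by (rule norm_infsum_bound[OF s])
      also have "\<dots> \<le> (\<Sum>\<^sub>\<infinity>r\<in>zeros B ?W. cmod (?A j (?z \<sigma>) r) * H r * H \<upsilon>)"
        by (rule infsum_mono[OF s Ka le])
      also have "\<dots> = ?K * H \<upsilon>" by (rule infsum_cmult_left')
      finally have r: "cmod (?r \<sigma> \<upsilon>) \<le> ?K * H \<upsilon>" .
      have "0 \<le> ?K" using H(2) by (intro infsum_nonneg) simp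
      then show "cmod (?h \<sigma> \<upsilon>) \<le> (cmod (\<phi> j (map \<sigma> qs)) * ?K) * H \<upsilon>"
        using mult_left_mono[OF r, of "cmod (\<phi> j (map \<sigma> qs))"] H(2)[of \<upsilon>]
        by (simp add: norm_mult mult_ac)
    qed
  qed
  ultimately show ?thesis by (simp only: sandwich_adj)
qed

section \<open>Quantum case controlled by one qubit\<close>

lemma init_op_phase:
  assumes "cmod l = 1"
  shows "init_op B qs (\<lambda>x. l * \<phi> x) T = init_op B qs \<phi> T"
proof -
  have "l * cnj l = 1" using assms by (simp add: complex_mult_cnj cmod_def)
  then have "l * a * cnj (l * b) = a * cnj b" for a b
    by (simp add: mult_ac flip: mult.assoc)
  then show ?thesis by (simp add: init_op_def fun_eq_iff)
qed

text \<open>With two basis vectors, orthogonality to one leaves a multiple of the other, and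
  normalisation makes the factor a phase. Phases cancel in |\<psi>\<rangle>\<langle>\<psi>|.\<close>

lemma phase_of_orthogonal:
  assumes onb: "orthonormal_basis X 2 \<phi>" and \<psi>: "unit_vec X \<psi>" and orth: "braket \<psi> (\<phi> 1) = 0"
  obtains l where "cmod l = 1" "\<psi> = (\<lambda>x. l * \<phi> 2 x)"
proof -
  have \<phi>: "\<phi> 1 \<in> hilb X" "\<phi> 2 \<in> hilb X"
    and b: "braket (\<phi> 1) (\<phi> 1) = 1" "braket (\<phi> 2) (\<phi> 1) = 0" "braket (\<phi> 2) (\<phi> 2) = 1"
    using onb by (auto simp: orthonormal_basis_def)
  from onb unit_vec_hilb[OF \<psi>] obtain c where "\<psi> = (\<lambda>x. \<Sum>i=1..2. c i * \<phi> i x)"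
    unfolding orthonormal_basis_def by blast
  moreover have "{1..2} = {1, 2::nat}" by auto
  ultimately have c: "\<psi> = (\<lambda>x. c 1 * \<phi> 1 x + c 2 * \<phi> 2 x)" by simp
  have "braket \<psi> (\<phi> 1) = (\<Sum>\<^sub>\<infinity>x. cnj (c 1) * (cnj (\<phi> 1 x) * \<phi> 1 x) + cnj (c 2) * (cnj (\<phi> 2 x) * \<phi> 1 x))"
    unfolding braket_def c by (simp add: algebra_simps)
  also have "\<dots> = cnj (c 1) * braket (\<phi> 1) (\<phi> 1) + cnj (c 2) * braket (\<phi> 2) (\<phi> 1)"
    unfolding braket_def
    by (simp only: infsum_add[OF summable_on_cmult_right[OF braket_summable[OF \<phi>(1) \<phi>(1)]]
        summable_on_cmult_right[OF braket_summable[OF \<phi>(2) \<phi>(1)]]] infsum_cmult_right')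
  finally have "c 1 = 0" using orth b by simp
  then have l: "\<psi> = (\<lambda>x. c 2 * \<phi> 2 x)" using c by simp
  have "braket \<psi> \<psi> = (\<Sum>\<^sub>\<infinity>x. (cnj (c 2) * c 2) * (cnj (\<phi> 2 x) * \<phi> 2 x))"
    unfolding braket_def l by (simp add: mult_ac)
  also have "\<dots> = (cnj (c 2) * c 2) * braket (\<phi> 2) (\<phi> 2)"
    unfolding braket_def by (rule infsum_cmult_right')
  finally have "cnj (c 2) * c 2 = 1" using b braket_unit_vec[OF \<psi>] by simp
  then have "cmod (c 2) * cmod (c 2) = 1"
    by (metis complex_mod_cnj norm_mult norm_one)
  then have "cmod (c 2) = 1 \<or> cmod (c 2) = - 1"
    using power2_eq_1_iff[of "cmod (c 2)"] by (simp add: power2_eq_square)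
  then have "cmod (c 2) = 1"
    using norm_ge_zero[of "c 2"] by linarith
  then show thesis using l that by blast
qed

lemma law_qif2:
  assumes zero: "\<And>q. 0 \<in> B q" and wf: "wf_circ B G (qif2 q \<phi>\<^sub>0 C\<^sub>0 \<phi>\<^sub>1 C\<^sub>1)"
    and \<psi>: "unit_vec (reg_basis B [q]) \<psi>" "braket \<psi> \<phi>\<^sub>0 = 0"
  shows "B \<turnstile> PInit [q] \<psi> ;; PCirc (qif2 q \<phi>\<^sub>0 C\<^sub>0 \<phi>\<^sub>1 C\<^sub>1) \<approx> PInit [q] \<phi>\<^sub>1 ;; PCirc C\<^sub>1"
    and "B \<turnstile> PInit [q] \<phi>\<^sub>1 ;; PCirc C\<^sub>1 \<approx> PInit [q] \<psi> ;; PCirc C\<^sub>1"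
proof -
  let ?\<phi> = "\<lambda>i::nat. if i = 1 then \<phi>\<^sub>0 else \<phi>\<^sub>1"
  have "orthonormal_basis (reg_basis B [q]) 2 ?\<phi>"
    using wf unfolding qif2_def wf_circ.simps by blast
  then obtain l where l: "cmod l = 1" "\<psi> = (\<lambda>x. l * \<phi>\<^sub>1 x)"
    using phase_of_orthogonal[of "reg_basis B [q]" ?\<phi> \<psi>] \<psi> by auto
  have d: "distinct [q]" by simp
  have init: "sem B (PInit [q] \<psi>) \<rho> = sem B (PInit [q] \<phi>\<^sub>1) \<rho>" for \<rho>
    unfolding sem_PInit[OF d] l(2) by (rule init_op_phase[OF l(1)])
  show "B \<turnstile> PInit [q] \<psi> ;; PCirc (qif2 q \<phi>\<^sub>0 C\<^sub>0 \<phi>\<^sub>1 C\<^sub>1) \<approx> PInit [q] \<phi>\<^sub>1 ;; PCirc C\<^sub>1"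
  proof (rule prog_equivI)
    fix \<rho> assume "partial_density (conf B) \<rho>"
    from sandwich_qif_init_basis[OF zero wf[unfolded qif2_def] _ partial_density_dominated[OF this], of 2]
    show "sem B (PInit [q] \<psi> ;; PCirc (qif2 q \<phi>\<^sub>0 C\<^sub>0 \<phi>\<^sub>1 C\<^sub>1)) \<rho> = sem B (PInit [q] \<phi>\<^sub>1 ;; PCirc C\<^sub>1) \<rho>"
      unfolding sem.simps(4,5) o_apply init unfolding sem_PInit[OF d] qif2_def by simp
  qed
  show "B \<turnstile> PInit [q] \<phi>\<^sub>1 ;; PCirc C\<^sub>1 \<approx> PInit [q] \<psi> ;; PCirc C\<^sub>1"
    by (rule prog_equivI) (simp only: sem.simps(5) o_apply init)
qed

section \<open>Measurements preserve the trace\<close>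

text \<open>A congruence of \<open>R\<close>. As \<open>f\<close> need not be injective,
  coefficients with the same image are added up in \<open>u\<close>, and the form of the pullback at
  \<open>v\<close> is that of \<open>R\<close> at \<open>u\<close>.\<close>

lemma psd_pullback:
  assumes "psd R"
  shows "psd (\<lambda>s t. cnj (e s) * R (f s) (f t) * e t)"
  unfolding psd_def
proof (intro allI impI)
  fix F :: "'b set" and v :: "'b \<Rightarrow> complex" assume F: "finite F"
  define u where "u a = (\<Sum>s\<in>{s\<in>F. f s = a}. e s * v s)" for a
  have gen: "(\<Sum>a\<in>f ` F. h a * u a) = (\<Sum>s\<in>F. h (f s) * (e s * v s))" for h
  proof -
    have "(\<Sum>s\<in>F. h (f s) * (e s * v s)) = (\<Sum>a\<in>f ` F. \<Sum>s\<in>{s\<in>F. f s = a}. h (f s) * (e s * v s))"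
      by (rule sum.image_gen[OF F])
    also have "\<dots> = (\<Sum>a\<in>f ` F. h a * u a)"
      by (intro sum.cong refl) (simp add: u_def sum_distrib_left)
    finally show ?thesis ..
  qed
  have "(\<Sum>a\<in>f ` F. \<Sum>b\<in>f ` F. cnj (u a) * R a b * u b) =
      (\<Sum>a\<in>f ` F. cnj (u a) * (\<Sum>t\<in>F. R a (f t) * (e t * v t)))"
    by (simp only: gen mult.assoc flip: sum_distrib_left)
  also have "\<dots> = cnj (\<Sum>a\<in>f ` F. cnj (\<Sum>t\<in>F. R a (f t) * (e t * v t)) * u a)"
    by (simp only: cnj_sum complex_cnj_mult complex_cnj_cnj mult.commute)
  also have "\<dots> = cnj (\<Sum>s\<in>F. cnj (\<Sum>t\<in>F. R (f s) (f t) * (e t * v t)) * (e s * v s))"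
    by (simp only: gen)
  also have "\<dots> = (\<Sum>s\<in>F. \<Sum>t\<in>F. cnj (v s) * (cnj (e s) * R (f s) (f t) * e t) * v t)"
    by (simp add: sum_distrib_left sum_distrib_right mult_ac)
  finally show "(\<Sum>s\<in>F. \<Sum>t\<in>F. cnj (v s) * (cnj (e s) * R (f s) (f t) * e t) * v t) \<in> \<real>\<^sub>\<ge>\<^sub>0"
    using psdD[OF assms finite_imageI[OF F], of u f] by simp
qed

section \<open>Trace preservation by a finite Kraus family\<close>

lemma nonneg_Reals_sum: "(\<And>x. x \<in> A \<Longrightarrow> f x \<in> \<real>\<^sub>\<ge>\<^sub>0) \<Longrightarrow> sum f A \<in> (\<real>\<^sub>\<ge>\<^sub>0 :: complex set)"
  by (induction A rule: infinite_finite_induct) (auto intro: nonneg_Reals_add_I)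

text \<open>A finite set of pairs lies in the square of the union of its projections, so squares are
  cofinal. This turns an unordered sum over pairs into a limit of finite sections.\<close>

lemma filterlim_square_finite_subsets:
  "filterlim (\<lambda>F. F \<times> F) (finite_subsets_at_top (L \<times> L)) (finite_subsets_at_top L)"
  unfolding filterlim_def le_filter_def eventually_filtermap
proof (intro allI impI)
  fix P assume "eventually P (finite_subsets_at_top (L \<times> L))"
  then have "\<exists>G. finite G \<and> G \<subseteq> L \<times> L \<and> (\<forall>Y. finite Y \<and> G \<subseteq> Y \<and> Y \<subseteq> L \<times> L \<longrightarrow> P Y)"
    by (simp only: eventually_finite_subsets_at_top)
  then obtain G where G: "finite G" "G \<subseteq> L \<times> L" and P: "\<forall>Y. finite Y \<and> G \<subseteq> Y \<and> Y \<subseteq> L \<times> L \<longrightarrow> P Y"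
    by (elim exE conjE)
  show "\<forall>\<^sub>F F in finite_subsets_at_top L. P (F \<times> F)"
    unfolding eventually_finite_subsets_at_top
  proof (intro exI[of _ "fst ` G \<union> snd ` G"] conjI allI impI)
    show "finite (fst ` G \<union> snd ` G)" using G(1) by simp
    show "fst ` G \<union> snd ` G \<subseteq> L" using G(2) by auto
    fix Y assume Y: "finite Y \<and> fst ` G \<union> snd ` G \<subseteq> Y \<and> Y \<subseteq> L"
    have "G \<subseteq> Y \<times> Y"
    proof
      fix p assume "p \<in> G"
      then show "p \<in> Y \<times> Y" using Y by (cases p) force
    qed
    moreover have "Y \<times> Y \<subseteq> L \<times> L" using Y by (intro Sigma_mono) auto
    ultimately show "P (Y \<times> Y)" using P Y by simp
  qed
qed

text \<open>The matrices of a measurement with the quantum variables forgotten;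
  \<open>isometry\<close> is the completeness relation written entrywise.\<close>

locale kraus_family =
  fixes L :: "'x set" and S :: "'o set" and K :: "'o \<Rightarrow> 'x \<Rightarrow> 'x \<Rightarrow> complex"
  assumes finite_S: "finite S"
    and row: "m \<in> S \<Longrightarrow> n \<in> L \<Longrightarrow> (\<lambda>a. (cmod (K m n a))\<^sup>2) summable_on L"
    and column: "m \<in> S \<Longrightarrow> a \<in> L \<Longrightarrow> (\<lambda>n. (cmod (K m n a))\<^sup>2) summable_on L"
    and isometry: "a \<in> L \<Longrightarrow> b \<in> L \<Longrightarrow>
      (\<Sum>m\<in>S. \<Sum>\<^sub>\<infinity>n\<in>L. cnj (K m n b) * K m n a) = (if a = b then 1 else 0)"
begin

text \<open>The terms of the diagonal entry at \<open>n\<close> of \<open>K m\<close> times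
  \<open>R\<close> times the adjoint of \<open>K m\<close>, as a family over pairs. Hence
  \<open>diag R\<close> is the diagonal of the state after the measurement, summed over
  outcomes.\<close>

definition entry :: "'x op \<Rightarrow> 'o \<Rightarrow> 'x \<Rightarrow> 'x \<times> 'x \<Rightarrow> complex" where
  "entry R m n = (\<lambda>(b, a). cnj (K m n b) * (K m n a * R a b))"

definition diag :: "'x op \<Rightarrow> 'x \<Rightarrow> complex" where
  "diag R n = (\<Sum>m\<in>S. \<Sum>\<^sub>\<infinity>p\<in>L \<times> L. entry R m n p)"

text \<open>Excludes the default value of \<open>infsum\<close> in \<open>diag\<close>, which would
  destroy linearity.\<close>

definition summ :: "'x op \<Rightarrow> bool" where
  "summ R \<longleftrightarrow> (\<forall>m\<in>S. \<forall>n\<in>L. entry R m n summable_on L \<times> L)"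

lemma summ_lin: "summ R \<Longrightarrow> summ R' \<Longrightarrow> summ (\<lambda>a b. c * R a b + d * R' a b)"
proof -
  assume s: "summ R" "summ R'"
  have "entry (\<lambda>a b. c * R a b + d * R' a b) m n = (\<lambda>p. c * entry R m n p + d * entry R' m n p)" for m n
    by (auto simp: entry_def fun_eq_iff algebra_simps)
  then show ?thesis
    using s by (auto simp: summ_def intro!: summable_on_add summable_on_cmult_right)
qed

lemma diag_lin:
  assumes "summ R" "summ R'" "n \<in> L"
  shows "diag (\<lambda>a b. c * R a b + d * R' a b) n = c * diag R n + d * diag R' n"
proof -
  have e: "entry (\<lambda>a b. c * R a b + d * R' a b) m n = (\<lambda>p. c * entry R m n p + d * entry R' m n p)" for m
    by (auto simp: entry_def fun_eq_iff algebra_simps)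
  have "(\<Sum>\<^sub>\<infinity>p\<in>L \<times> L. c * entry R m n p + d * entry R' m n p) =
      c * (\<Sum>\<^sub>\<infinity>p\<in>L \<times> L. entry R m n p) + d * (\<Sum>\<^sub>\<infinity>p\<in>L \<times> L. entry R' m n p)" if "m \<in> S" for m
    using assms that
    by (subst infsum_add) (auto simp: summ_def infsum_cmult_right' intro!: summable_on_cmult_right)
  then show ?thesis
    by (simp add: diag_def e sum.distrib sum_distrib_left)
qed

text \<open>With \<open>g\<close> the root of the diagonal of \<open>R\<close>, a term is at most
  the product of \<open>cmod (K m n b) * g b\<close> and \<open>cmod (K m n a) * g a\<close>, each
  summable because rows of \<open>K m\<close> and \<open>g\<close> are square-summable.\<close>

lemma psd_summ:
  assumes "psd R" "(\<lambda>a. Re (R a a)) summable_on L"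
  shows "summ R"
  unfolding summ_def
proof (intro ballI)
  fix m n assume mn: "m \<in> S" "n \<in> L"
  define g where "g a = sqrt (Re (R a a))" for a
  have nn: "Re (R a a) \<ge> 0" for a
    using psd_diag[OF assms(1), of a] by (simp add: complex_nonneg_Reals_iff)
  have dom: "cmod (R a b) \<le> g a * g b" for a b
    using psd_cauchy_schwarz[OF assms(1), of a b] by (simp add: g_def real_le_rsqrt flip: real_sqrt_mult)
  have g2: "(\<lambda>a. (cmod (of_real (g a)))\<^sup>2) summable_on L"
    using assms(2) nn by (simp add: g_def)
  have s: "(\<lambda>a. norm (K m n a * of_real (g a))) summable_on L"
    by (rule ell2_mult_summable[OF row[OF mn] g2])
  have s': "(\<lambda>a. norm (complex_of_real (norm (K m n a * of_real (g a))))) summable_on L"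
    using s by simp
  have "(\<lambda>(b, a). complex_of_real (norm (K m n b * of_real (g b))) * complex_of_real (norm (K m n a * of_real (g a)))) summable_on L \<times> L"
    using has_sum_Times_mult[OF s' s'] by (rule has_sum_imp_summable)
  then have "(\<lambda>p. norm ((\<lambda>(b, a). complex_of_real (norm (K m n b * of_real (g b))) * complex_of_real (norm (K m n a * of_real (g a)))) p)) summable_on L \<times> L"
    by (simp only: summable_on_iff_abs_summable_on_complex)
  then have "(\<lambda>p. norm (entry R m n p)) summable_on L \<times> L"
  proof (rule Infinite_Sum.abs_summable_on_comparison_test)
    fix p assume "p \<in> L \<times> L"
    obtain b a where p: "p = (b, a)" by (cases p)
    have "cmod (K m n b) * (cmod (K m n a) * cmod (R a b)) \<le> cmod (K m n b) * (cmod (K m n a) * (g a * g b))"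
      by (intro mult_left_mono dom) auto
    then show "norm (entry R m n p) \<le> norm ((\<lambda>(b, a). complex_of_real (norm (K m n b * of_real (g b))) * complex_of_real (norm (K m n a * of_real (g a)))) p)"
      using nn by (simp add: p entry_def norm_mult mult_ac g_def)
  qed
  then show "entry R m n summable_on L \<times> L" by (rule abs_summable_summable)
qed

text \<open>With \<open>a\<close> and \<open>b\<close> in a finite set the sum over \<open>n\<close>
  can be carried out first, and \<open>isometry\<close> leaves exactly the trace of the
  section.\<close>

lemma finite_section_has_sum:
  assumes "finite F" "F \<subseteq> L"
  shows "((\<lambda>n. \<Sum>m\<in>S. \<Sum>p\<in>F \<times> F. entry R m n p) has_sum (\<Sum>a\<in>F. R a a)) L"
proof -
  have "((\<lambda>n. cnj (K m n b) * K m n a) has_sum (\<Sum>\<^sub>\<infinity>n\<in>L. cnj (K m n b) * K m n a)) L"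
    if "m \<in> S" "a \<in> F" "b \<in> F" for m a b
    using that assms column
    by (intro has_sum_infsum, intro abs_summable_summable[OF ell2_mult_summable]) (auto simp: subset_iff)
  then have "((\<lambda>n. \<Sum>m\<in>S. \<Sum>p\<in>F \<times> F. R (snd p) (fst p) * (cnj (K m n (fst p)) * K m n (snd p))) has_sum
      (\<Sum>m\<in>S. \<Sum>p\<in>F \<times> F. R (snd p) (fst p) * (\<Sum>\<^sub>\<infinity>n\<in>L. cnj (K m n (fst p)) * K m n (snd p)))) L"
    by (intro has_sum_finite_sum has_sum_cmult_right) auto
  moreover have "(\<Sum>m\<in>S. \<Sum>p\<in>F \<times> F. R (snd p) (fst p) * (\<Sum>\<^sub>\<infinity>n\<in>L. cnj (K m n (fst p)) * K m n (snd p))) = (\<Sum>a\<in>F. R a a)"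
  proof -
    have "(\<Sum>m\<in>S. \<Sum>p\<in>F \<times> F. R (snd p) (fst p) * (\<Sum>\<^sub>\<infinity>n\<in>L. cnj (K m n (fst p)) * K m n (snd p))) =
      (\<Sum>p\<in>F \<times> F. R (snd p) (fst p) * (\<Sum>m\<in>S. \<Sum>\<^sub>\<infinity>n\<in>L. cnj (K m n (fst p)) * K m n (snd p)))"
      by (subst sum.swap) (simp only: sum_distrib_left)
    also have "\<dots> = (\<Sum>p\<in>F \<times> F. R (snd p) (fst p) * (if snd p = fst p then 1 else 0))"
      by (intro sum.cong refl arg_cong2[where f = "(*)"] isometry) (use assms in auto)
    also have "\<dots> = (\<Sum>b\<in>F. \<Sum>a\<in>F. if a = b then R a b else 0)"
      unfolding sum.cartesian_product by (intro sum.cong refl) auto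
    also have "\<dots> = (\<Sum>b\<in>F. R b b)"
      using assms(1) by (intro sum.cong refl) (simp add: sum.delta)
    finally show ?thesis .
  qed
  moreover have "(\<Sum>p\<in>F \<times> F. R (snd p) (fst p) * (cnj (K m n (fst p)) * K m n (snd p))) = (\<Sum>p\<in>F \<times> F. entry R m n p)" for m n
    by (intro sum.cong refl) (auto simp: entry_def)
  ultimately show ?thesis by simp
qed

lemma finite_section_nonneg:
  assumes "psd R" "finite F"
  shows "(\<Sum>m\<in>S. \<Sum>p\<in>F \<times> F. entry R m n p) \<in> \<real>\<^sub>\<ge>\<^sub>0"
proof (rule nonneg_Reals_sum)
  fix m
  have "(\<Sum>p\<in>F \<times> F. entry R m n p) = (\<Sum>b\<in>F. \<Sum>a\<in>F. cnj (K m n b) * (K m n a * R a b))"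
    unfolding sum.cartesian_product entry_def by (intro sum.cong refl)
  also have "\<dots> = (\<Sum>a\<in>F. \<Sum>b\<in>F. cnj (cnj (K m n a)) * R a b * cnj (K m n b))"
    by (subst sum.swap) (simp add: mult_ac)
  finally show "(\<Sum>p\<in>F \<times> F. entry R m n p) \<in> \<real>\<^sub>\<ge>\<^sub>0"
    using psdD[OF assms, of "\<lambda>a. cnj (K m n a)"] by simp
qed

lemma finite_section_tendsto:
  assumes "summ R" "n \<in> L"
  shows "((\<lambda>F. \<Sum>m\<in>S. \<Sum>p\<in>F \<times> F. entry R m n p) \<longlongrightarrow> diag R n) (finite_subsets_at_top L)"
  unfolding diag_def
proof (rule tendsto_sum)
  fix m assume "m \<in> S"
  then have "(sum (entry R m n) \<longlongrightarrow> (\<Sum>\<^sub>\<infinity>p\<in>L \<times> L. entry R m n p)) (finite_subsets_at_top (L \<times> L))"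
    using assms has_sum_infsum by (auto simp: summ_def has_sum_def)
  from filterlim_compose[OF this filterlim_square_finite_subsets]
  show "((\<lambda>F. \<Sum>p\<in>F \<times> F. entry R m n p) \<longlongrightarrow> (\<Sum>\<^sub>\<infinity>p\<in>L \<times> L. entry R m n p)) (finite_subsets_at_top L)" .
qed

text \<open>A Fatou argument. For finitely many \<open>n\<close>, the diagonal of a finite section
  sums to at most the trace of that section, hence of \<open>R\<close>; then the section grows.
  Positivity permits dropping the other \<open>n\<close>, and mass may so far be lost at
  infinity.\<close>

lemma diag_psd:
  assumes R: "psd R" "(\<lambda>a. Re (R a a)) summable_on L"
  shows "n \<in> L \<Longrightarrow> diag R n \<in> \<real>\<^sub>\<ge>\<^sub>0"
    and "(\<lambda>n. Re (diag R n)) summable_on L"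
    and "(\<Sum>\<^sub>\<infinity>n\<in>L. Re (diag R n)) \<le> (\<Sum>\<^sub>\<infinity>a\<in>L. Re (R a a))"
proof -
  let ?t = "\<Sum>\<^sub>\<infinity>a\<in>L. Re (R a a)" and ?s = "\<lambda>F n. \<Sum>m\<in>S. \<Sum>p\<in>F \<times> F. entry R m n p"
  note lim = finite_section_tendsto[OF psd_summ[OF R]]
  have nn: "0 \<le> Re (R a a)" for a
    using psd_diag[OF R(1), of a] by (simp add: complex_nonneg_Reals_iff)
  show diag: "diag R n \<in> \<real>\<^sub>\<ge>\<^sub>0" if "n \<in> L" for n
  proof (rule Lim_in_closed_set[OF _ _ _ lim[OF that]])
    show "\<forall>\<^sub>F F in finite_subsets_at_top L. ?s F n \<in> \<real>\<^sub>\<ge>\<^sub>0"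
      by (rule eventually_finite_subsets_at_top_weakI) (rule finite_section_nonneg[OF R(1)])
  qed (simp_all add: closed_nonneg_Reals_complex)
  have fin: "(\<Sum>n\<in>N. Re (diag R n)) \<le> ?t" if N: "finite N" "N \<subseteq> L" for N
  proof (rule tendsto_upperbound)
    show "((\<lambda>F. \<Sum>n\<in>N. Re (?s F n)) \<longlongrightarrow> (\<Sum>n\<in>N. Re (diag R n))) (finite_subsets_at_top L)"
      using N by (intro tendsto_sum tendsto_Re lim) auto
    show "\<forall>\<^sub>F F in finite_subsets_at_top L. (\<Sum>n\<in>N. Re (?s F n)) \<le> ?t"
    proof (rule eventually_finite_subsets_at_top_weakI)
      fix F assume F: "finite F" "F \<subseteq> L"
      have "((\<lambda>n. Re (?s F n)) has_sum Re (\<Sum>a\<in>F. R a a)) L"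
        by (rule has_sum_Re[OF finite_section_has_sum[OF F]])
      then have "(\<Sum>n\<in>N. Re (?s F n)) \<le> Re (\<Sum>a\<in>F. R a a)"
        using N finite_section_nonneg[OF R(1) F(1)]
        by (intro finite_sum_le_has_sum[where A = L]) (auto simp: complex_nonneg_Reals_iff)
      also have "\<dots> \<le> ?t"
        unfolding Re_sum by (rule finite_sum_le_infsum[OF R(2) F]) (simp add: nn)
      finally show "(\<Sum>n\<in>N. Re (?s F n)) \<le> ?t" .
    qed
  qed simp
  show s: "(\<lambda>n. Re (diag R n)) summable_on L"
  proof (rule nonneg_bdd_above_summable_on)
    show "bdd_above (sum (\<lambda>n. Re (diag R n)) ` {F. F \<subseteq> L \<and> finite F})"
      by (rule bdd_aboveI2[where M = ?t]) (use fin in auto)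
  qed (use diag in \<open>auto simp: complex_nonneg_Reals_iff\<close>)
  show "(\<Sum>\<^sub>\<infinity>n\<in>L. Re (diag R n)) \<le> ?t"
    by (rule infsum_le_finite_sums[OF s]) (use fin in auto)
qed

text \<open>
  With \<open>P\<close> the projection onto a finite set \<open>F\<close> of basis vectors and \<open>Q = 1 - P\<close>, the operators
  \<open>R\<close> and \<open>(P - Q) R (P - Q)\<close> have the same trace and add up to \<open>2 (P R P + Q R Q)\<close>. Since
  \<^term>\<open>diag\<close> does not increase the trace of a positive operator and preserves that of \<open>P R P\<close>,
  it loses at most the trace of \<open>2 Q R Q\<close> on \<open>R\<close>.
\<close>

lemma diag_psd_has_sum:
  assumes R: "psd R" "(\<lambda>a. Re (R a a)) summable_on L"
  shows "(diag R has_sum (\<Sum>\<^sub>\<infinity>a\<in>L. R a a)) L"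
proof -
  let ?t = "\<Sum>\<^sub>\<infinity>a\<in>L. Re (R a a)" and ?u = "\<Sum>\<^sub>\<infinity>n\<in>L. Re (diag R n)"
  have nn: "0 \<le> Re (R a a)" and im: "Im (R a a) = 0" for a
    using psd_diag[OF R(1), of a] by (simp_all add: complex_nonneg_Reals_iff)
  have lower: "2 * (\<Sum>a\<in>F. Re (R a a)) - ?t \<le> ?u" if F: "finite F" "F \<subseteq> L" for F
  proof -
    \<comment> \<open>The diagonals of P - Q, P and Q.\<close>
    define e\<^sub>1 e\<^sub>2 e\<^sub>3 :: "'x \<Rightarrow> complex"
      where "e\<^sub>1 a = (if a \<in> F then 1 else - 1)" and "e\<^sub>2 a = (if a \<in> F then 1 else 0)"
        and "e\<^sub>3 a = (if a \<in> F then 0 else 1)" for a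
    define R\<^sub>1 R\<^sub>2 R\<^sub>3 where "R\<^sub>1 = (\<lambda>a b. cnj (e\<^sub>1 a) * R a b * e\<^sub>1 b)"
      and "R\<^sub>2 = (\<lambda>a b. cnj (e\<^sub>2 a) * R a b * e\<^sub>2 b)" and "R\<^sub>3 = (\<lambda>a b. cnj (e\<^sub>3 a) * R a b * e\<^sub>3 b)"
    note defs = R\<^sub>1_def R\<^sub>2_def R\<^sub>3_def e\<^sub>1_def e\<^sub>2_def e\<^sub>3_def
    have psd: "psd R\<^sub>1" "psd R\<^sub>2" "psd R\<^sub>3"
      unfolding R\<^sub>1_def R\<^sub>2_def R\<^sub>3_def using psd_pullback[OF R(1), of _ "\<lambda>a. a"] by blast+
    have t1: "Re (R\<^sub>1 a a) = Re (R a a)" for a by (simp add: defs)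
    have tr: "(\<lambda>a. Re (R\<^sub>1 a a)) summable_on L" "(\<lambda>a. Re (R\<^sub>2 a a)) summable_on L" "(\<lambda>a. Re (R\<^sub>3 a a)) summable_on L"
      by (rule summable_on_comparison_test[OF R(2)]; simp add: defs nn)+
    note summ = psd_summ[OF R] psd_summ[OF psd(1) tr(1)] psd_summ[OF psd(2) tr(2)] psd_summ[OF psd(3) tr(3)]
    have rel: "Re (diag R n) + Re (diag R\<^sub>1 n) = 2 * Re (diag R\<^sub>2 n) + 2 * Re (diag R\<^sub>3 n)" if "n \<in> L" for n
    proof -
      have "(\<lambda>a b. 1 * R a b + 1 * R\<^sub>1 a b) = (\<lambda>a b. 2 * R\<^sub>2 a b + 2 * R\<^sub>3 a b)"
        by (auto simp: defs fun_eq_iff)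
      then have "1 * diag R n + 1 * diag R\<^sub>1 n = 2 * diag R\<^sub>2 n + 2 * diag R\<^sub>3 n"
        by (simp only: diag_lin[OF summ(1,2) that, symmetric] diag_lin[OF summ(3,4) that, symmetric])
      from arg_cong[OF this, of Re] show ?thesis by simp
    qed
    \<comment> \<open>Outside \<open>F\<close> the entries of \<open>R\<^sub>2\<close> vanish, so
      its \<open>diag\<close> is a finite section, whose trace is exact.\<close>
    have "(\<Sum>\<^sub>\<infinity>n\<in>L. Re (diag R\<^sub>2 n)) = (\<Sum>a\<in>F. Re (R a a))"
    proof -
      have "(\<Sum>\<^sub>\<infinity>p\<in>L \<times> L. entry R\<^sub>2 m n p) = (\<Sum>\<^sub>\<infinity>p\<in>F \<times> F. entry R m n p)" for m n
        by (rule infsum_cong_neutral) (use F in \<open>auto simp: entry_def defs split: if_splits\<close>)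
      then have "diag R\<^sub>2 n = (\<Sum>m\<in>S. \<Sum>p\<in>F \<times> F. entry R m n p)" for n
        using F by (simp add: diag_def)
      then show ?thesis
        using has_sum_Re[OF finite_section_has_sum[OF F, of R]] by (simp add: infsumI)
    qed
    moreover have "?u + (\<Sum>\<^sub>\<infinity>n\<in>L. Re (diag R\<^sub>1 n)) = 2 * (\<Sum>\<^sub>\<infinity>n\<in>L. Re (diag R\<^sub>2 n)) + 2 * (\<Sum>\<^sub>\<infinity>n\<in>L. Re (diag R\<^sub>3 n))"
    proof -
      note s = diag_psd(2)[OF R] diag_psd(2)[OF psd(1) tr(1)] diag_psd(2)[OF psd(2) tr(2)] diag_psd(2)[OF psd(3) tr(3)]
      have "?u + (\<Sum>\<^sub>\<infinity>n\<in>L. Re (diag R\<^sub>1 n)) = (\<Sum>\<^sub>\<infinity>n\<in>L. Re (diag R n) + Re (diag R\<^sub>1 n))"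
        by (rule infsum_add[OF s(1,2), symmetric])
      also have "\<dots> = (\<Sum>\<^sub>\<infinity>n\<in>L. 2 * Re (diag R\<^sub>2 n) + 2 * Re (diag R\<^sub>3 n))"
        by (rule infsum_cong) (rule rel)
      also have "\<dots> = 2 * (\<Sum>\<^sub>\<infinity>n\<in>L. Re (diag R\<^sub>2 n)) + 2 * (\<Sum>\<^sub>\<infinity>n\<in>L. Re (diag R\<^sub>3 n))"
        by (subst infsum_add[OF summable_on_cmult_right[OF s(3)] summable_on_cmult_right[OF s(4)]])
          (simp only: infsum_cmult_right')
      finally show ?thesis .
    qed
    moreover have "(\<Sum>\<^sub>\<infinity>n\<in>L. Re (diag R\<^sub>1 n)) \<le> ?t"
      using diag_psd(3)[OF psd(1) tr(1)] by (simp add: t1)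
    moreover have "0 \<le> (\<Sum>\<^sub>\<infinity>n\<in>L. Re (diag R\<^sub>3 n))"
      using diag_psd(1)[OF psd(3) tr(3)] by (intro infsum_nonneg) (simp add: complex_nonneg_Reals_iff)
    ultimately show ?thesis by linarith
  qed
  \<comment> \<open>The bound \<open>lower\<close> solved for the partial trace over
    \<open>F\<close>, so that it passes to the supremum over all finite \<open>F\<close>.\<close>
  have "?t \<le> (?u + ?t) / 2"
    by (rule infsum_le_finite_sums[OF R(2)]) (use lower in \<open>simp add: field_simps\<close>)
  then have u: "?u = ?t" using diag_psd(3)[OF R] by simp
  have h: "((\<lambda>n. complex_of_real (Re (diag R n))) has_sum of_real ?t) L"
    using has_sum_infsum[OF diag_psd(2)[OF R]] unfolding u by (rule has_sum_of_real)
  have "complex_of_real (Re (diag R n)) = diag R n" if "n \<in> L" for n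
    using diag_psd(1)[OF R that] by (simp add: complex_nonneg_Reals_iff complex_eq_iff)
  then have "(diag R has_sum of_real ?t) L"
    by (rule has_sum_cong[THEN iffD1, OF _ h])
  moreover have "complex_of_real ?t = (\<Sum>\<^sub>\<infinity>a\<in>L. R a a)"
  proof -
    have "((\<lambda>a. complex_of_real (Re (R a a))) has_sum of_real ?t) L"
      by (rule has_sum_of_real[OF has_sum_infsum[OF R(2)]])
    moreover have "complex_of_real (Re (R a a)) = R a a" for a
      using im by (simp add: complex_eq_iff)
    ultimately show ?thesis by (simp add: infsumI)
  qed
  ultimately show ?thesis by simp
qed

text \<open>Trace preservation bundled with the summability that makes it linear, so that
  polarisation can carry it from positive matrices to others.\<close>

definition trace_preserved :: "'x op \<Rightarrow> bool" where
  "trace_preserved R \<longleftrightarrow>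
     summ R \<and> (\<lambda>a. R a a) summable_on L \<and> (diag R has_sum (\<Sum>\<^sub>\<infinity>a\<in>L. R a a)) L"

lemma trace_preserved_lin:
  assumes "trace_preserved R" "trace_preserved R'"
  shows "trace_preserved (\<lambda>a b. c * R a b + d * R' a b)"
proof -
  let ?N = "\<lambda>a b. c * R a b + d * R' a b"
  have s: "summ R" "summ R'" and t: "(\<lambda>a. R a a) summable_on L" "(\<lambda>a. R' a a) summable_on L"
    and h: "(diag R has_sum (\<Sum>\<^sub>\<infinity>a\<in>L. R a a)) L" "(diag R' has_sum (\<Sum>\<^sub>\<infinity>a\<in>L. R' a a)) L"
    using assms by (auto simp: trace_preserved_def)
  have "((\<lambda>a. ?N a a) has_sum c * (\<Sum>\<^sub>\<infinity>a\<in>L. R a a) + d * (\<Sum>\<^sub>\<infinity>a\<in>L. R' a a)) L"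
    by (intro has_sum_add has_sum_cmult_right has_sum_infsum t)
  then have N: "(\<lambda>a. ?N a a) summable_on L"
    "(\<Sum>\<^sub>\<infinity>a\<in>L. ?N a a) = c * (\<Sum>\<^sub>\<infinity>a\<in>L. R a a) + d * (\<Sum>\<^sub>\<infinity>a\<in>L. R' a a)"
    by (auto simp: has_sum_iff)
  have "((\<lambda>n. c * diag R n + d * diag R' n) has_sum (\<Sum>\<^sub>\<infinity>a\<in>L. ?N a a)) L"
    unfolding N(2) by (intro has_sum_add has_sum_cmult_right h)
  then have "(diag ?N has_sum (\<Sum>\<^sub>\<infinity>a\<in>L. ?N a a)) L"
    by (rule has_sum_cong[THEN iffD1, rotated]) (simp add: diag_lin[OF s])
  then show ?thesis using N(1) summ_lin[OF s] by (simp add: trace_preserved_def)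
qed

lemma trace_preserved_psd:
  assumes "psd R" "(\<lambda>a. R a a) summable_on L"
  shows "trace_preserved R"
  using assms diag_psd_has_sum[OF assms(1) summable_on_Re[OF assms(2)]]
    psd_summ[OF assms(1) summable_on_Re[OF assms(2)]] by (simp add: trace_preserved_def)

end

section \<open>Polarisation of the blocks of a state\<close>

lemma psd_sum_pairs:
  assumes "psd W" "finite I"
  shows "psd (\<lambda>a b. \<Sum>p\<in>I. \<Sum>r\<in>I. W (p, a) (r, b))"
  unfolding psd_def
proof (intro allI impI)
  fix F :: "'b set" and v :: "'b \<Rightarrow> complex" assume F: "finite F"
  have "(\<Sum>s\<in>I \<times> F. \<Sum>t\<in>I \<times> F. cnj (v (snd s)) * W s t * v (snd t)) =
    (\<Sum>p\<in>I. \<Sum>a\<in>F. \<Sum>r\<in>I. \<Sum>b\<in>F. cnj (v a) * W (p, a) (r, b) * v b)"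
    by (simp add: sum.cartesian_product')
  also have "\<dots> = (\<Sum>a\<in>F. \<Sum>p\<in>I. \<Sum>b\<in>F. \<Sum>r\<in>I. cnj (v a) * W (p, a) (r, b) * v b)"
    by (subst sum.swap) (intro sum.cong refl sum.swap)
  also have "\<dots> = (\<Sum>a\<in>F. \<Sum>b\<in>F. cnj (v a) * (\<Sum>p\<in>I. \<Sum>r\<in>I. W (p, a) (r, b)) * v b)"
    by (intro sum.cong refl, subst sum.swap) (simp only: sum_distrib_left sum_distrib_right)
  finally show "(\<Sum>a\<in>F. \<Sum>b\<in>F. cnj (v a) * (\<Sum>p\<in>I. \<Sum>r\<in>I. W (p, a) (r, b)) * v b) \<in> \<real>\<^sub>\<ge>\<^sub>0"
    using psdD[OF assms(1), of "I \<times> F" "\<lambda>s. v (snd s)"] assms(2) F by simp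
qed

text \<open>The compression of \<rho> by the map that sends the basis vector of \<open>a\<close> to
  that of \<open>f a\<close> plus \<open>z\<close> times that of \<open>g a\<close>. The Boolean
  index tells the two summands apart, and \<open>psd_sum_pairs\<close> adds them.\<close>

lemma psd_two_maps:
  assumes "psd \<rho>"
  shows "psd (\<lambda>a b. \<rho> (f a) (f b) + z * \<rho> (f a) (g b) + cnj z * \<rho> (g a) (f b) + z * cnj z * \<rho> (g a) (g b))"
proof -
  define h where "h = (\<lambda>(p, a). if p then g a else f a)"
  define x where "x = (\<lambda>(p :: bool, a :: 'b). if p then z else 1)"
  have "psd (\<lambda>a b. \<Sum>p\<in>UNIV. \<Sum>r\<in>UNIV. cnj (x (p, a)) * \<rho> (h (p, a)) (h (r, b)) * x (r, b))"
    by (rule psd_sum_pairs[OF psd_pullback[OF assms]]) simp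
  moreover have "(\<Sum>p\<in>UNIV. \<Sum>r\<in>UNIV. cnj (x (p, a)) * \<rho> (h (p, a)) (h (r, b)) * x (r, b)) =
      \<rho> (f a) (f b) + z * \<rho> (f a) (g b) + cnj z * \<rho> (g a) (f b) + z * cnj z * \<rho> (g a) (g b)" for a b
    by (simp add: UNIV_bool x_def h_def mult_ac add_ac)
  ultimately show ?thesis by simp
qed

text \<open>Rows and columns are square-summable because each \<open>M m\<close> is bounded; the
  completeness relation moves from lists to labels along \<open>bij_betw_labels\<close>.\<close>

lemma kraus_family_measurement:
  assumes "distinct qs" "measurement (reg_basis B qs) S M" "finite S"
  shows "kraus_family (labels B (set qs)) S (\<lambda>m n a. M m (map n qs) (map a qs))"
proof
  let ?L = "labels B (set qs)" and ?X = "reg_basis B qs"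
  note bij = bij_betw_labels[OF assms(1), of B]
  have bd: "bounded_op ?X (M m)" if "m \<in> S" for m
    using assms(2) that by (simp add: measurement_def)
  show "finite S" by fact
  fix m n assume m: "m \<in> S"
  obtain c where c: "bdd_by (M m) c" using bdd_by_bounded_op[OF bd[OF m]] by blast
  show "(\<lambda>a. (cmod (M m (map n qs) (map a qs)))\<^sup>2) summable_on ?L"
    using summable_on_reindex_bij_betw[OF bij, of "\<lambda>y. (cmod (M m (map n qs) y))\<^sup>2"] bdd_by_row[OF c] by simp
  show "(\<lambda>a. (cmod (M m (map a qs) (map n qs)))\<^sup>2) summable_on ?L"
    using summable_on_reindex_bij_betw[OF bij, of "\<lambda>y. (cmod (M m y (map n qs)))\<^sup>2"] bdd_by_column[OF c] by simp
next
  fix a b assume ab: "a \<in> labels B (set qs)" "b \<in> labels B (set qs)"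
  have z: "M m x y = 0" if "m \<in> S" "x \<notin> reg_basis B qs" for m x y
    using assms(2) that unfolding measurement_def bounded_op_def by blast
  have "mult (adj (M m)) (M m) (map b qs) (map a qs) =
      (\<Sum>\<^sub>\<infinity>n\<in>labels B (set qs). cnj (M m (map n qs) (map b qs)) * M m (map n qs) (map a qs))" if "m \<in> S" for m
  proof -
    have "mult (adj (M m)) (M m) (map b qs) (map a qs) =
        (\<Sum>\<^sub>\<infinity>x\<in>reg_basis B qs. cnj (M m x (map b qs)) * M m x (map a qs))"
      unfolding mult_def adj_def by (rule infsum_cong_neutral) (use z[OF that] in auto)
    then show ?thesis by (simp add: infsum_reg_basis[OF assms(1)])
  qed
  moreover have "(\<Sum>m\<in>S. mult (adj (M m)) (M m) (map b qs) (map a qs)) = id_op (reg_basis B qs) (map b qs) (map a qs)"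
  proof -
    have "((\<lambda>m. mult (adj (M m)) (M m) (map b qs) (map a qs)) has_sum id_op (reg_basis B qs) (map b qs) (map a qs)) S"
      using assms(2) unfolding measurement_def by blast
    then show ?thesis unfolding has_sum_finite_iff[OF assms(3)] by (rule sym)
  qed
  moreover have "map b qs \<in> reg_basis B qs"
    using bij_betw_labels[OF assms(1), of B] ab(2) unfolding bij_betw_def by blast
  ultimately show "(\<Sum>m\<in>S. \<Sum>\<^sub>\<infinity>n\<in>labels B (set qs). cnj (M m (map n qs) (map b qs)) * M m (map n qs) (map a qs)) =
      (if a = b then 1 else 0)"
    using map_labels_eq_iff[OF ab(2,1)] by (auto simp: id_op_def simp del: map_eq_conv)
qed

text \<open>The two uses of \<open>mult_ext\<close> produce an iterated sum with \<open>b\<close>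
  outside, which explains why \<open>entry\<close> takes its pairs in the order
  \<open>(b, a)\<close>.\<close>

lemma sandwich_ext_override:
  assumes "\<sigma> \<in> conf B" "\<tau> \<in> conf B" "n \<in> labels B (set qs)"
  shows "sandwich (ext B qs A) \<rho> (override_on \<sigma> n (set qs)) (override_on \<tau> n (set qs)) =
    (\<Sum>\<^sub>\<infinity>b\<in>labels B (set qs). \<Sum>\<^sub>\<infinity>a\<in>labels B (set qs). cnj (A (map n qs) (map b qs)) *
      (A (map n qs) (map a qs) * \<rho> (override_on \<sigma> a (set qs)) (override_on \<tau> b (set qs))))"
proof -
  have c: "override_on \<sigma> n (set qs) \<in> conf B" "override_on \<tau> n (set qs) \<in> conf B"
    using assms by (auto intro: override_in_conf)
  show ?thesis
    by (simp add: sandwich_adj adj_def mult_ext c infsum_cmult_right' flip: infsum_cnj)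
qed

text \<open>For distinct \<sigma> and \<tau> the block \<open>R\<close> need not even be Hermitian.
  It is recovered from the positive matrices \<open>P z\<close>, which compress \<rho> to
  combinations of the slices through \<sigma> and \<tau>.\<close>

lemma ptrace_measurement:
  assumes "distinct qs" "measurement (reg_basis B qs) S M" "finite S"
    "partial_density (conf B) \<rho>" "\<sigma> \<in> conf B" "\<tau> \<in> conf B"
  shows "ptrace B (set qs) (\<lambda>\<sigma> \<tau>. \<Sum>m\<in>S. sandwich (ext B qs (M m)) \<rho> \<sigma> \<tau>) \<sigma> \<tau> = ptrace B (set qs) \<rho> \<sigma> \<tau>"
proof -
  let ?L = "labels B (set qs)"
  interpret kraus_family ?L S "\<lambda>m n a. M m (map n qs) (map a qs)"
    by (rule kraus_family_measurement[OF assms(1-3)])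
  let ?f = "\<lambda>a. override_on \<sigma> a (set qs)" and ?g = "\<lambda>a. override_on \<tau> a (set qs)"
  define R where "R a b = \<rho> (?f a) (?g b)" for a b
  define P where "P z a b = \<rho> (?f a) (?f b) + z * \<rho> (?f a) (?g b) + cnj z * \<rho> (?g a) (?f b) +
      z * cnj z * \<rho> (?g a) (?g b)" for z a b
  note sl = abs_summable_summable[OF dominated_slice_summable[OF partial_density_dominated[OF assms(4)]]]
  have P: "trace_preserved (P z)" for z
  proof (rule trace_preserved_psd)
    show "psd (P z)"
      unfolding P_def by (rule psd_two_maps[OF psd_partial_density[OF assms(4)]])
    show "(\<lambda>a. P z a a) summable_on ?L"
      unfolding P_def by (intro summable_on_add summable_on_cmult_right sl)
  qed
  \<comment> \<open>Each \<open>P z\<close> has weight \<open>cnj z / 4\<close>, with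
    \<open>z\<close> running over the fourth roots of unity: the terms without \<open>z\<close> and
    those with \<open>cnj z\<close> or \<open>z * cnj z\<close> cancel, and \<open>R\<close>
    remains.\<close>
  have "trace_preserved (\<lambda>a b. (1/4) * (1 * P 1 a b + (- 1) * P (- 1) a b) +
      (1/4) * ((- \<i>) * P \<i> a b + \<i> * P (- \<i>) a b))"
    by (intro trace_preserved_lin P)
  moreover have "(\<lambda>a b. (1/4) * (1 * P 1 a b + (- 1) * P (- 1) a b) +
      (1/4) * ((- \<i>) * P \<i> a b + \<i> * P (- \<i>) a b)) = R"
    by (intro HOL.ext) (simp add: P_def R_def algebra_simps)
  ultimately have R: "trace_preserved R" by simp
  have "(\<Sum>m\<in>S. sandwich (ext B qs (M m)) \<rho> (?f n) (?g n)) = diag R n" if "n \<in> ?L" for n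
    unfolding diag_def
  proof (rule sum.cong[OF refl])
    fix m assume m: "m \<in> S"
    then have s: "entry R m n summable_on ?L \<times> ?L"
      using R that by (simp add: trace_preserved_def summ_def)
    show "sandwich (ext B qs (M m)) \<rho> (?f n) (?g n) = infsum (entry R m n) (?L \<times> ?L)"
      unfolding infsum_Sigma_banach[OF s, symmetric]
      by (simp add: sandwich_ext_override[OF assms(5,6) that] entry_def R_def)
  qed
  then have "ptrace B (set qs) (\<lambda>\<sigma> \<tau>. \<Sum>m\<in>S. sandwich (ext B qs (M m)) \<rho> \<sigma> \<tau>) \<sigma> \<tau> = infsum (diag R) ?L"
    unfolding ptrace_def by (intro infsum_cong)
  also have "\<dots> = (\<Sum>\<^sub>\<infinity>a\<in>?L. R a a)"
    using R by (simp add: trace_preserved_def infsumI)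
  finally show ?thesis by (simp add: ptrace_def R_def)
qed

lemma law_meas_only:
  assumes "distinct qs" "measurement (reg_basis B qs) binary_outcomes M"
  shows "B \<turnstile> meas_only M qs ;; PInit qs \<phi> \<approx> PInit qs \<phi>"
proof (rule prog_equivI)
  fix \<rho> assume pd: "partial_density (conf B) \<rho>"
  have fin: "finite (binary_outcomes :: 'b list set)" by (simp add: binary_outcomes_def)
  have eq: "sem B (meas_only M qs) \<rho> = (\<lambda>\<sigma> \<tau>. \<Sum>m\<in>binary_outcomes. sandwich (ext B qs (M m)) \<rho> \<sigma> \<tau>)"
    by (simp add: meas_only_def cond_def fin)
  show "sem B (meas_only M qs ;; PInit qs \<phi>) \<rho> = sem B (PInit qs \<phi>) \<rho>"
    unfolding sem.simps(5) o_apply sem_PInit[OF assms(1)] eq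
    by (intro HOL.ext) (simp add: init_op_def ptrace_measurement[OF assms fin pd])
qed

theorem proposition5p1:
  fixes B :: "'q \<Rightarrow> 'b::zero_neq_one set" and G :: "'b list op set"
  assumes zero_in: "\<And>q. 0 \<in> B q"
  shows
    "((\<forall>qs \<phi> \<psi>. distinct qs \<and> unit_vec (reg_basis B qs) \<phi> \<and> unit_vec (reg_basis B qs) \<psi> \<longrightarrow>
         B \<turnstile> PInit qs \<phi> ;; PInit qs \<psi> \<approx> PInit qs \<psi>) \<and>
      (\<forall>qs\<^sub>1 qs\<^sub>2 \<phi> \<psi>. distinct qs\<^sub>1 \<and> distinct qs\<^sub>2 \<and> set qs\<^sub>1 \<inter> set qs\<^sub>2 = {} \<and>
         unit_vec (reg_basis B qs\<^sub>1) \<phi> \<and> unit_vec (reg_basis B qs\<^sub>2) \<psi> \<longrightarrow>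
         B \<turnstile> PInit qs\<^sub>1 \<phi> ;; PInit qs\<^sub>2 \<psi> \<approx> PInit (qs\<^sub>1 @ qs\<^sub>2) (tensor qs\<^sub>1 \<phi> \<psi>)) \<and>
      (\<forall>qs qs\<^sub>1 qs\<^sub>2. distinct qs \<and> distinct qs\<^sub>1 \<and> distinct qs\<^sub>2 \<and> set qs = set qs\<^sub>1 \<union> set qs\<^sub>2 \<longrightarrow>
         B \<turnstile> PInit qs\<^sub>1 (zero_ket qs\<^sub>1) ;; PInit qs\<^sub>2 (zero_ket qs\<^sub>2) \<approx> PInit qs (zero_ket qs)))
     \<and>
     ((\<forall>qs \<psi> C U. distinct qs \<and> unit_vec (reg_basis B qs) \<psi> \<and> wf_circ B G C \<and>
         unitary_op (reg_basis B qs) U \<and> circ_sem B C = ext B qs U \<longrightarrow>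
         B \<turnstile> PInit qs \<psi> ;; PCirc C \<approx> PInit qs (app U \<psi>)) \<and>
      (\<forall>qs \<psi> U. distinct qs \<and> unit_vec (reg_basis B qs) \<psi> \<and>
         U \<in> G \<and> unitary_op (reg_basis B qs) U \<longrightarrow>
         B \<turnstile> PInit qs \<psi> ;; PCirc (CGate U qs) \<approx> PInit qs (app U \<psi>)))
     \<and>
     ((\<forall>q \<phi>\<^sub>0 \<phi>\<^sub>1 \<psi> C\<^sub>0 C\<^sub>1. qubit B q \<and> wf_circ B G (qif2 q \<phi>\<^sub>0 C\<^sub>0 \<phi>\<^sub>1 C\<^sub>1) \<and>
         unit_vec (reg_basis B [q]) \<psi> \<and> braket \<psi> \<phi>\<^sub>0 = 0 \<longrightarrow>
         B \<turnstile> PInit [q] \<psi> ;; PCirc (qif2 q \<phi>\<^sub>0 C\<^sub>0 \<phi>\<^sub>1 C\<^sub>1) \<approx> PInit [q] \<phi>\<^sub>1 ;; PCirc C\<^sub>1 \<and>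
         B \<turnstile> PInit [q] \<phi>\<^sub>1 ;; PCirc C\<^sub>1 \<approx> PInit [q] \<psi> ;; PCirc C\<^sub>1) \<and>
      (\<forall>qs rs d c \<phi> \<psi> C U. distinct (qs @ rs) \<and> wf_circ B G (CQif qs d \<phi> C) \<and>
         (\<forall>i\<in>{1..d}. \<psi> i \<in> hilb (reg_basis B rs)) \<and>
         unit_vec (reg_basis B (qs @ rs)) (\<lambda>x. \<Sum>i=1..d. c i * tensor qs (\<phi> i) (\<psi> i) x) \<and>
         (\<forall>i\<in>{1..d}. unitary_op (reg_basis B rs) (U i) \<and> circ_sem B (C i) = ext B rs (U i)) \<longrightarrow>
         B \<turnstile> PInit (qs @ rs) (\<lambda>x. \<Sum>i=1..d. c i * tensor qs (\<phi> i) (\<psi> i) x) ;;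
               PCirc (CQif qs d \<phi> C)
           \<approx> PInit (qs @ rs) (\<lambda>x. \<Sum>i=1..d. c i * tensor qs (\<phi> i) (app (U i) (\<psi> i)) x)))
     \<and>
     ((\<forall>qs M \<phi>. distinct qs \<and> measurement (reg_basis B qs) binary_outcomes M \<and>
         unit_vec (reg_basis B qs) \<phi> \<longrightarrow>
         B \<turnstile> meas_only M qs ;; PInit qs \<phi> \<approx> PInit qs \<phi>) \<and>
      (\<forall>qs M \<psi> P\<^sub>0 P\<^sub>1. distinct qs \<and> unit_vec (reg_basis B qs) \<psi> \<and>
         is_test (reg_basis B qs) \<psi> M \<and> wf_prog B G P\<^sub>0 \<and> wf_prog B G P\<^sub>1 \<longrightarrow>
         B \<turnstile> PInit qs \<psi> ;; cond P\<^sub>0 M qs P\<^sub>1 \<approx> PInit qs \<psi> ;; P\<^sub>1) \<and>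
      (\<forall>qs M \<psi> \<phi> P\<^sub>0 P\<^sub>1. distinct qs \<and> unit_vec (reg_basis B qs) \<psi> \<and>
         unit_vec (reg_basis B qs) \<phi> \<and> is_test (reg_basis B qs) \<psi> M \<and> braket \<phi> \<psi> = 0 \<and>
         wf_prog B G P\<^sub>0 \<and> wf_prog B G P\<^sub>1 \<longrightarrow>
         B \<turnstile> PInit qs \<phi> ;; cond P\<^sub>0 M qs P\<^sub>1 \<approx> PInit qs \<phi> ;; P\<^sub>0))
     \<and>
     (\<forall>qs rs P. distinct qs \<and> distinct rs \<and> (\<forall>r\<in>set rs. qubit B r) \<and> set qs \<subseteq> set rs \<and>
         (\<forall>m\<in>bit_strings (length qs). wf_prog B G (P m) \<and> set rs \<inter> prog_vars (P m) = {}) \<longrightarrow>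
         B \<turnstile> comp_if qs P ;; PInit rs (zero_ket rs)
           \<approx> comp_if rs (\<lambda>k. P (restrict_string rs qs k)) ;; PInit rs (zero_ket rs))"
proof (intro conjI allI impI; (elim conjE)?)
  show "B \<turnstile> PInit qs \<phi> ;; PInit qs \<psi> \<approx> PInit qs \<psi>"
    if "distinct qs" "unit_vec (reg_basis B qs) \<phi>" for qs \<phi> \<psi>
    by (rule law_cancel_same[OF that])
  show "B \<turnstile> PInit qs\<^sub>1 \<phi> ;; PInit qs\<^sub>2 \<psi> \<approx> PInit (qs\<^sub>1 @ qs\<^sub>2) (tensor qs\<^sub>1 \<phi> \<psi>)"
    if "distinct qs\<^sub>1" "distinct qs\<^sub>2" "set qs\<^sub>1 \<inter> set qs\<^sub>2 = {}" for qs\<^sub>1 qs\<^sub>2 \<phi> \<psi>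
    by (rule law_cancel_tensor[OF that])
  show "B \<turnstile> PInit qs\<^sub>1 (zero_ket qs\<^sub>1) ;; PInit qs\<^sub>2 (zero_ket qs\<^sub>2) \<approx> PInit qs (zero_ket qs)"
    if "distinct qs" "distinct qs\<^sub>1" "distinct qs\<^sub>2" "set qs = set qs\<^sub>1 \<union> set qs\<^sub>2" for qs qs\<^sub>1 qs\<^sub>2
    by (rule law_cancel_zero[OF zero_in that])
  show "B \<turnstile> PInit qs \<psi> ;; PCirc C \<approx> PInit qs (app U \<psi>)"
    if "distinct qs" "unitary_op (reg_basis B qs) U" "circ_sem B C = ext B qs U" for qs \<psi> C U
    by (rule law_unitary[OF that])
  show "B \<turnstile> PInit qs \<psi> ;; PCirc (CGate U qs) \<approx> PInit qs (app U \<psi>)"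
    if "distinct qs" "unitary_op (reg_basis B qs) U" for qs \<psi> U
    by (rule law_unitary[OF that]) simp
  show "B \<turnstile> PInit [q] \<psi> ;; PCirc (qif2 q \<phi>\<^sub>0 C\<^sub>0 \<phi>\<^sub>1 C\<^sub>1) \<approx> PInit [q] \<phi>\<^sub>1 ;; PCirc C\<^sub>1"
    "B \<turnstile> PInit [q] \<phi>\<^sub>1 ;; PCirc C\<^sub>1 \<approx> PInit [q] \<psi> ;; PCirc C\<^sub>1"
    if "wf_circ B G (qif2 q \<phi>\<^sub>0 C\<^sub>0 \<phi>\<^sub>1 C\<^sub>1)" "unit_vec (reg_basis B [q]) \<psi>" "braket \<psi> \<phi>\<^sub>0 = 0"
    for q \<phi>\<^sub>0 \<phi>\<^sub>1 \<psi> C\<^sub>0 C\<^sub>1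
    by (rule law_qif2[OF zero_in that])+
  show "B \<turnstile> PInit (qs @ rs) (\<lambda>x. \<Sum>i=1..d. c i * tensor qs (\<phi> i) (\<psi> i) x) ;; PCirc (CQif qs d \<phi> C)
      \<approx> PInit (qs @ rs) (\<lambda>x. \<Sum>i=1..d. c i * tensor qs (\<phi> i) (app (U i) (\<psi> i)) x)"
    if "distinct (qs @ rs)" "wf_circ B G (CQif qs d \<phi> C)" "\<forall>i\<in>{1..d}. \<psi> i \<in> hilb (reg_basis B rs)"
      "\<forall>i\<in>{1..d}. unitary_op (reg_basis B rs) (U i) \<and> circ_sem B (C i) = ext B rs (U i)"
    for qs rs d c \<phi> \<psi> C U
    by (rule law_qif_tensor) (use that in auto)
  show "B \<turnstile> meas_only M qs ;; PInit qs \<phi> \<approx> PInit qs \<phi>"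
    if "distinct qs" "measurement (reg_basis B qs) binary_outcomes M" for qs M \<phi>
    by (rule law_meas_only[OF that])
  show "B \<turnstile> PInit qs \<psi> ;; cond P\<^sub>0 M qs P\<^sub>1 \<approx> PInit qs \<psi> ;; P\<^sub>1"
    if "distinct qs" "unit_vec (reg_basis B qs) \<psi>" "is_test (reg_basis B qs) \<psi> M" for qs M \<psi> P\<^sub>0 P\<^sub>1
    by (rule law_cond(1)[OF that(1,2,2,3) refl])
  show "B \<turnstile> PInit qs \<phi> ;; cond P\<^sub>0 M qs P\<^sub>1 \<approx> PInit qs \<phi> ;; P\<^sub>0"
    if "distinct qs" "unit_vec (reg_basis B qs) \<psi>" "unit_vec (reg_basis B qs) \<phi>"
      "is_test (reg_basis B qs) \<psi> M" "braket \<phi> \<psi> = 0" for qs M \<psi> \<phi> P\<^sub>0 P\<^sub>1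
    by (rule law_cond(2)[OF that])
  show "B \<turnstile> comp_if qs P ;; PInit rs (zero_ket rs)
      \<approx> comp_if rs (\<lambda>k. P (restrict_string rs qs k)) ;; PInit rs (zero_ket rs)"
    if "distinct rs" "\<forall>r\<in>set rs. qubit B r" "set qs \<subseteq> set rs"
      "\<forall>m\<in>bit_strings (length qs). wf_prog B G (P m) \<and> set rs \<inter> prog_vars (P m) = {}" for qs rs P
    by (rule law_if_expansion) (use that in auto)
qed

end
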